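(* Let $R$ be a commutative ring with identity and $S$ a multiplicative subset of $R$. The following statements are equivalent: (1) $R$ is a $u$-$S$-von Neumann regular ring; (2) for any $R$-modules $M$ and $N$, there exists $s\in S$ such that $s\,\mathrm{Tor}_1^R(M,N)=0$; (3) there exists $s\in S$ such that $s\,\mathrm{Tor}_1^R(R/I,R/J)=0$ for any ideals $I$ and $J$ of $R$; (4) there exists $s\in S$ such that $s\,\mathrm{Tor}_1^R(R/I,R/J)=0$ for any $S$-finite ideals $I$ and $J$ of $R$; (5) there exists $s\in S$ such that $s\,\mathrm{Tor}_1^R(R/\langle a\rangle,R/\langle a\rangle)=0$ for any element $a\in R$; (6) any $R$-module is $u$-$S$-flat; (7) the class of all principal ideals of $R$ is $u$-$S$-generated by idempotents; (8) the class of all finitely generated ideals of $R$ is $u$-$S$-generated by idempotents.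
   Context: A multiplicative subset $S$ of $R$ is a subset with $1\in S$ and $s_1s_2\in S$ for all $s_1,s_2\in S$. $R$ is $u$-$S$-von Neumann regular if there exists $s\in S$ such that for any $a\in R$ there exists $r\in R$ with $sa=ra^2$. An $R$-module $M$ is $S$-finite if there exist $s\in S$ and a finitely generated submodule $N\subseteq M$ with $sM\subseteq N$. A sequence of $R$-modules $M\xrightarrow{f}N\xrightarrow{g}L$ is $u$-$S$-exact (at $N$) if there is $s\in S$ with $s\,\mathrm{Ker}(g)\subseteq \mathrm{Im}(f)$ and $s\,\mathrm{Im}(f)\subseteq \mathrm{Ker}(g)$. A sequence $0\to A\to B\to C\to 0$ is $u$-$S$-exact if it is $u$-$S$-exact at each of $A,B,C$. An $R$-module $F$ is $u$-$S$-flat if for any $u$-$S$-exact sequence $0\to A\to B\to C\to 0$, the induced sequence $0\to A\otimes_RF\to B\otimes_RF\to C\otimes_RF\to 0$ is $u$-$S$-exact. Let $\{M_j\}_{j\in\Gamma}$ be a family of $R$-modules, let $\{m_{i,j}\}_{i\in\Lambda_j}\subseteq M_j$ for each $j\in\Gamma$, and let $N_j=\langle m_{i,j}\rangle_{i\in\Lambda_j}$ be the submodule generated by these elements. The family $\{M_j\}_{j\in\Gamma}$ is $u$-$S$-generated by $\{\{m_{i,j}\}_{i\in\Lambda_j}\}_{j\in\Gamma}$ if there exists a single $s\in S$ such that $sM_j\subseteq N_j$ for every $j\in\Gamma$. A family of ideals is $u$-$S$-generated by idempotents if it is $u$-$S$-generated by some such family of elements $m_{i,j}\in M_j$ that are all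 idempotents of $R$. *)

theory Defs
  imports "HOL-Algebra.Module" "HOL-Algebra.Ideal"
begin

section \<open>Submodules, quotients, homomorphisms\<close>

definition mod_span :: "('a, 'r) ring_scheme \<Rightarrow> ('a, 'm) module \<Rightarrow> 'm set \<Rightarrow> 'm set" where
  "mod_span R M X = \<Inter>{N. submodule N R M \<and> X \<subseteq> N}"

abbreviation sub_mod :: "('a, 'm) module \<Rightarrow> 'm set \<Rightarrow> ('a, 'm) module" where
  "sub_mod M N \<equiv> M\<lparr>carrier := N\<rparr>"

text \<open>
  The record type of modules extends that of rings; the fields \<open>mult\<close> and \<open>one\<close> play no role
  for modules and are left undefined below.
\<close>

definition quot_mod :: "('a, 'm) module \<Rightarrow> 'm set \<Rightarrow> ('a, 'm set) module" where
  "quot_mod M N =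
    \<lparr>carrier = a_rcosets\<^bsub>M\<^esub> N, mult = undefined, one = undefined,
     zero = N, add = set_add M,
     smult = (\<lambda>r C. \<Union>x\<in>C. N +>\<^bsub>M\<^esub> (r \<odot>\<^bsub>M\<^esub> x))\<rparr>"

definition mod_hom :: "('a, 'r) ring_scheme \<Rightarrow> ('a, 'm) module \<Rightarrow> ('a, 'n) module \<Rightarrow> ('m \<Rightarrow> 'n) set" where
  "mod_hom R M N = {f \<in> carrier M \<rightarrow> carrier N.
     (\<forall>x\<in>carrier M. \<forall>y\<in>carrier M. f (x \<oplus>\<^bsub>M\<^esub> y) = f x \<oplus>\<^bsub>N\<^esub> f y) \<and>
     (\<forall>r\<in>carrier R. \<forall>x\<in>carrier M. f (r \<odot>\<^bsub>M\<^esub> x) = r \<odot>\<^bsub>N\<^esub> f x)}"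

definition zero_mod :: "('a, unit) module" where
  "zero_mod =
    \<lparr>carrier = {()}, mult = undefined, one = undefined,
     zero = (), add = (\<lambda>_ _. ()), smult = (\<lambda>_ _. ())\<rparr>"

definition reg_mod :: "('a, 'r) ring_scheme \<Rightarrow> ('a, 'a) module" where
  "reg_mod R =
    \<lparr>carrier = carrier R, mult = undefined, one = undefined,
     zero = zero R, add = add R, smult = mult R\<rparr>"

abbreviation ideal_mod :: "('a, 'r) ring_scheme \<Rightarrow> 'a set \<Rightarrow> ('a, 'a) module" where
  "ideal_mod R I \<equiv> sub_mod (reg_mod R) I"

abbreviation cyclic_mod :: "('a, 'r) ring_scheme \<Rightarrow> 'a set \<Rightarrow> ('a, 'a set) module" where
  "cyclic_mod R I \<equiv> quot_mod (reg_mod R) I"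

definition fg_mod :: "('a, 'r) ring_scheme \<Rightarrow> ('a, 'm) module \<Rightarrow> bool" where
  "fg_mod R M \<longleftrightarrow> (\<exists>B. finite B \<and> B \<subseteq> carrier M \<and> mod_span R M B = carrier M)"

definition annihilates :: "'a \<Rightarrow> ('a, 'm) module \<Rightarrow> bool" where
  "annihilates s M \<longleftrightarrow> (\<forall>x\<in>carrier M. s \<odot>\<^bsub>M\<^esub> x = \<zero>\<^bsub>M\<^esub>)"


section \<open>Free modules\<close>

definition free_mod :: "('a, 'r) ring_scheme \<Rightarrow> 'x set \<Rightarrow> ('a, 'x \<Rightarrow> 'a) module" where
  "free_mod R X =
    \<lparr>carrier = {h. (\<forall>x\<in>X. h x \<in> carrier R) \<and> (\<forall>x. x \<notin> X \<longrightarrow> h x = \<zero>\<^bsub>R\<^esub>) \<and>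
                   finite {x. h x \<noteq> \<zero>\<^bsub>R\<^esub>}},
     mult = undefined, one = undefined,
     zero = (\<lambda>_. \<zero>\<^bsub>R\<^esub>), add = (\<lambda>h k x. h x \<oplus>\<^bsub>R\<^esub> k x),
     smult = (\<lambda>r h x. r \<otimes>\<^bsub>R\<^esub> h x)\<rparr>"

definition free_basis :: "('a, 'r) ring_scheme \<Rightarrow> 'x \<Rightarrow> 'x \<Rightarrow> 'a" where
  "free_basis R x = (\<lambda>y. if y = x then \<one>\<^bsub>R\<^esub> else \<zero>\<^bsub>R\<^esub>)"

text \<open>The linear extension to a free module of a map \<open>\<phi>\<close> from its basis to the module \<open>P\<close>.\<close>

definition free_lift ::
  "('a, 'r) ring_scheme \<Rightarrow> ('a, 'p) module \<Rightarrow> ('x \<Rightarrow> 'p) \<Rightarrow> ('x \<Rightarrow> 'a) \<Rightarrow> 'p" where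
  "free_lift R P \<phi> h = (\<Oplus>\<^bsub>P\<^esub>x\<in>{x. h x \<noteq> \<zero>\<^bsub>R\<^esub>}. h x \<odot>\<^bsub>P\<^esub> \<phi> x)"


section \<open>Tensor products\<close>

definition tensor_free :: "('a, 'r) ring_scheme \<Rightarrow> ('a, 'm) module \<Rightarrow> ('a, 'n) module
    \<Rightarrow> ('a, 'm \<times> 'n \<Rightarrow> 'a) module" where
  "tensor_free R M N = free_mod R (carrier M \<times> carrier N)"

definition tensor_rel :: "('a, 'r) ring_scheme \<Rightarrow> ('a, 'm) module \<Rightarrow> ('a, 'n) module
    \<Rightarrow> ('m \<times> 'n \<Rightarrow> 'a) set" where
  "tensor_rel R M N = (let F = tensor_free R M N; e = free_basis R in mod_span R F
     ({e (x \<oplus>\<^bsub>M\<^esub> x', y) \<ominus>\<^bsub>F\<^esub> (e (x, y) \<oplus>\<^bsub>F\<^esub> e (x', y)) | x x' y.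
         x \<in> carrier M \<and> x' \<in> carrier M \<and> y \<in> carrier N} \<union>
      {e (x, y \<oplus>\<^bsub>N\<^esub> y') \<ominus>\<^bsub>F\<^esub> (e (x, y) \<oplus>\<^bsub>F\<^esub> e (x, y')) | x y y'.
         x \<in> carrier M \<and> y \<in> carrier N \<and> y' \<in> carrier N} \<union>
      {e (r \<odot>\<^bsub>M\<^esub> x, y) \<ominus>\<^bsub>F\<^esub> (r \<odot>\<^bsub>F\<^esub> e (x, y)) | r x y.
         r \<in> carrier R \<and> x \<in> carrier M \<and> y \<in> carrier N} \<union>
      {e (x, r \<odot>\<^bsub>N\<^esub> y) \<ominus>\<^bsub>F\<^esub> (r \<odot>\<^bsub>F\<^esub> e (x, y)) | r x y.
         r \<in> carrier R \<and> x \<in> carrier M \<and> y \<in> carrier N}))"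

definition tensor :: "('a, 'r) ring_scheme \<Rightarrow> ('a, 'm) module \<Rightarrow> ('a, 'n) module
    \<Rightarrow> ('a, ('m \<times> 'n \<Rightarrow> 'a) set) module" where
  "tensor R M N = quot_mod (tensor_free R M N) (tensor_rel R M N)"

definition pure_tensor :: "('a, 'r) ring_scheme \<Rightarrow> ('a, 'm) module \<Rightarrow> ('a, 'n) module
    \<Rightarrow> 'm \<Rightarrow> 'n \<Rightarrow> ('m \<times> 'n \<Rightarrow> 'a) set" where
  "pure_tensor R M N x y =
     tensor_rel R M N +>\<^bsub>tensor_free R M N\<^esub> free_basis R (x, y)"

text \<open>
  \<open>tensor_map R M M' N f\<close> is the map \<open>f \<otimes> N\<close> from \<open>M \<otimes> N\<close> to \<open>M' \<otimes> N\<close>.  Its value at a class is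
  computed on a representative; for a homomorphism \<open>f\<close> all representatives give the same value,
  which is what \<^const>\<open>the_elem\<close> picks.
\<close>

definition tensor_map :: "('a, 'r) ring_scheme \<Rightarrow> ('a, 'm) module \<Rightarrow> ('a, 'k) module
    \<Rightarrow> ('a, 'n) module \<Rightarrow> ('m \<Rightarrow> 'k) \<Rightarrow> ('m \<times> 'n \<Rightarrow> 'a) set \<Rightarrow> ('k \<times> 'n \<Rightarrow> 'a) set" where
  "tensor_map R M M' N f C =
     the_elem (free_lift R (tensor R M' N) (\<lambda>(x, y). pure_tensor R M' N (f x) y) ` C)"


section \<open>The first Tor module\<close>

text \<open>
  The functorial free resolution of \<open>M\<close>, up to degree 2:
  \<open>F\<^sub>0\<close> is free on the elements of \<open>M\<close>, \<open>F\<^sub>1\<close> on those of \<open>K\<^sub>0 = Ker (F\<^sub>0 \<rightarrow> M)\<close>, and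
  \<open>F\<^sub>2\<close> on those of \<open>K\<^sub>1 = Ker (F\<^sub>1 \<rightarrow> F\<^sub>0)\<close>.
  All augmentations and differentials are linear extensions of the identity of the basis.
\<close>

definition res_F0 :: "('a, 'r) ring_scheme \<Rightarrow> ('a, 'm) module \<Rightarrow> ('a, 'm \<Rightarrow> 'a) module" where
  "res_F0 R M = free_mod R (carrier M)"

definition res_K0 :: "('a, 'r) ring_scheme \<Rightarrow> ('a, 'm) module \<Rightarrow> ('m \<Rightarrow> 'a) set" where
  "res_K0 R M = a_kernel (res_F0 R M) M (free_lift R M (\<lambda>x. x))"

definition res_F1 ::
  "('a, 'r) ring_scheme \<Rightarrow> ('a, 'm) module \<Rightarrow> ('a, ('m \<Rightarrow> 'a) \<Rightarrow> 'a) module" where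
  "res_F1 R M = free_mod R (res_K0 R M)"

definition res_d1 ::
  "('a, 'r) ring_scheme \<Rightarrow> ('a, 'm) module \<Rightarrow> (('m \<Rightarrow> 'a) \<Rightarrow> 'a) \<Rightarrow> 'm \<Rightarrow> 'a" where
  "res_d1 R M = free_lift R (res_F0 R M) (\<lambda>x. x)"

definition res_K1 ::
  "('a, 'r) ring_scheme \<Rightarrow> ('a, 'm) module \<Rightarrow> (('m \<Rightarrow> 'a) \<Rightarrow> 'a) set" where
  "res_K1 R M = a_kernel (res_F1 R M) (res_F0 R M) (res_d1 R M)"

definition res_F2 ::
  "('a, 'r) ring_scheme \<Rightarrow> ('a, 'm) module \<Rightarrow> ('a, (('m \<Rightarrow> 'a) \<Rightarrow> 'a) \<Rightarrow> 'a) module" where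
  "res_F2 R M = free_mod R (res_K1 R M)"

definition res_d2 ::
  "('a, 'r) ring_scheme \<Rightarrow> ('a, 'm) module \<Rightarrow> ((('m \<Rightarrow> 'a) \<Rightarrow> 'a) \<Rightarrow> 'a) \<Rightarrow> ('m \<Rightarrow> 'a) \<Rightarrow> 'a" where
  "res_d2 R M = free_lift R (res_F1 R M) (\<lambda>x. x)"

text \<open>\<open>Tor\<^sub>1(M, N)\<close> is the homology of \<open>F\<^sub>2 \<otimes> N \<rightarrow> F\<^sub>1 \<otimes> N \<rightarrow> F\<^sub>0 \<otimes> N\<close> at \<open>F\<^sub>1 \<otimes> N\<close>.\<close>

definition Tor1 :: "('a, 'r) ring_scheme \<Rightarrow> ('a, 'm) module \<Rightarrow> ('a, 'n) module
    \<Rightarrow> ('a, ((('m \<Rightarrow> 'a) \<Rightarrow> 'a) \<times> 'n \<Rightarrow> 'a) set set) module" where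
  "Tor1 R M N =
    (let F0 = res_F0 R M; F1 = res_F1 R M; F2 = res_F2 R M;
         Z = a_kernel (tensor R F1 N) (tensor R F0 N) (tensor_map R F1 F0 N (res_d1 R M));
         B = tensor_map R F2 F1 N (res_d2 R M) ` carrier (tensor R F2 N)
     in quot_mod (sub_mod (tensor R F1 N) Z) B)"


section \<open>Uniform notions relative to a multiplicative subset\<close>

definition uS_von_Neumann_regular :: "('a, 'r) ring_scheme \<Rightarrow> 'a set \<Rightarrow> bool" where
  "uS_von_Neumann_regular R S \<longleftrightarrow>
     (\<exists>s\<in>S. \<forall>a\<in>carrier R. \<exists>r\<in>carrier R. s \<otimes>\<^bsub>R\<^esub> a = r \<otimes>\<^bsub>R\<^esub> (a [^]\<^bsub>R\<^esub> (2::nat)))"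

definition S_finite :: "('a, 'r) ring_scheme \<Rightarrow> 'a set \<Rightarrow> ('a, 'm) module \<Rightarrow> bool" where
  "S_finite R S M \<longleftrightarrow>
     (\<exists>s\<in>S. \<exists>N. submodule N R M \<and> fg_mod R (sub_mod M N) \<and> (\<forall>x\<in>carrier M. s \<odot>\<^bsub>M\<^esub> x \<in> N))"

text \<open>\<open>uS_exact S M N L f g\<close>: the sequence \<open>M \<rightarrow> N \<rightarrow> L\<close> is \<open>u\<close>-\<open>S\<close>-exact at \<open>N\<close>.\<close>

definition uS_exact :: "'a set \<Rightarrow> ('a, 'm) module \<Rightarrow> ('a, 'n) module \<Rightarrow> ('a, 'l) module
    \<Rightarrow> ('m \<Rightarrow> 'n) \<Rightarrow> ('n \<Rightarrow> 'l) \<Rightarrow> bool" where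
  "uS_exact S M N L f g \<longleftrightarrow>
     (\<exists>s\<in>S. (\<forall>y\<in>a_kernel N L g. s \<odot>\<^bsub>N\<^esub> y \<in> f ` carrier M) \<and>
            (\<forall>y\<in>f ` carrier M. s \<odot>\<^bsub>N\<^esub> y \<in> a_kernel N L g))"

definition uS_short_exact :: "'a set \<Rightarrow> ('a, 'm) module \<Rightarrow> ('a, 'n) module \<Rightarrow> ('a, 'l) module
    \<Rightarrow> ('m \<Rightarrow> 'n) \<Rightarrow> ('n \<Rightarrow> 'l) \<Rightarrow> bool" where
  "uS_short_exact S A B C f g \<longleftrightarrow>
     uS_exact S zero_mod A B (\<lambda>_. \<zero>\<^bsub>A\<^esub>) f \<and>
     uS_exact S A B C f g \<and>
     uS_exact S B C zero_mod g (\<lambda>_. ())"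

text \<open>
  The test sequences range over modules whose carriers lie in the same type \<open>'m\<close> as that of \<open>F\<close>;
  HOL has no quantification over types inside a formula, so \<open>'m\<close> plays the role of a universe.
\<close>

definition uS_flat :: "('a, 'r) ring_scheme \<Rightarrow> 'a set \<Rightarrow> ('a, 'm) module \<Rightarrow> bool" where
  "uS_flat R S F \<longleftrightarrow>
     (\<forall>(A :: ('a, 'm) module) (B :: ('a, 'm) module) (C :: ('a, 'm) module) f g.
        module R A \<longrightarrow> module R B \<longrightarrow> module R C \<longrightarrow>
        f \<in> mod_hom R A B \<longrightarrow> g \<in> mod_hom R B C \<longrightarrow>
        uS_short_exact S A B C f g \<longrightarrow>
        uS_short_exact S (tensor R A F) (tensor R B F) (tensor R C F)
          (tensor_map R A B F f) (tensor_map R B C F g))"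

text \<open>
  A family of modules \<open>M j\<close>, \<open>j \<in> \<Gamma>\<close>; the generators chosen in \<open>M j\<close> enter only through the set
  \<open>G j\<close> of their values.
\<close>

definition uS_generated :: "('a, 'r) ring_scheme \<Rightarrow> 'a set \<Rightarrow> 'j set \<Rightarrow> ('j \<Rightarrow> ('a, 'm) module)
    \<Rightarrow> ('j \<Rightarrow> 'm set) \<Rightarrow> bool" where
  "uS_generated R S \<Gamma> M G \<longleftrightarrow>
     (\<forall>j\<in>\<Gamma>. G j \<subseteq> carrier (M j)) \<and>
     (\<exists>s\<in>S. \<forall>j\<in>\<Gamma>. \<forall>x\<in>carrier (M j). s \<odot>\<^bsub>M j\<^esub> x \<in> mod_span R (M j) (G j))"

definition uS_generated_by_idempotents :: "('a, 'r) ring_scheme \<Rightarrow> 'a set \<Rightarrow> 'a set set \<Rightarrow> bool" where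
  "uS_generated_by_idempotents R S \<I> \<longleftrightarrow>
     (\<exists>G. (\<forall>I\<in>\<I>. G I \<subseteq> {e \<in> I. e \<otimes>\<^bsub>R\<^esub> e = e}) \<and> uS_generated R S \<I> (ideal_mod R) G)"


section \<open>The module universe\<close>

text \<open>
  For a ring with elements in \<open>'a\<close>, statements about all modules are made for the modules with
  elements in the type below.  Since \<open>'u\<close> is arbitrary, this type can be made as large as
  desired; the left summand only ensures that it is never too small: it is infinite, and it has
  room for all finitely generated modules and for direct sums of cyclic modules indexed by
  finitely generated ideals.
\<close>

type_synonym ('a, 'u) univ = "('a list \<Rightarrow> 'a set) + 'u"

end

theory Submission
  imports Defs
begin

text \<open>
  Regularity of \<open>R\<close> with respect to \<open>s\<close> says that \<open>s a\<close> lies in \<open>(a\<^sup>2)\<close> for every \<open>a\<close>, and all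
  conditions are compared with this divisibility.

  From regularity to the other conditions, the point is uniformity: one element of \<open>S\<close> has to serve all
  modules and all ideals.  Inverting \<open>s\<close> would give an honest von Neumann regular ring, in which
  finitely generated ideals are generated by idempotents and all modules are flat.  The idempotents
  exist already in \<open>R\<close>: applying regularity to \<open>s\<^sup>2\<close> gives \<open>s\<^sup>3 = q s\<^sup>4\<close>, so \<open>(q s)\<^sup>3\<close> is an idempotent
  that acts as the identity on \<open>v = s\<^sup>3\<close>, and \<open>s\<close> is invertible on the corresponding factor of \<open>R\<close>.
  Hence every finite family of ring elements has an idempotent combination \<open>g\<close> with \<open>v g k = v k\<close> for
  all members \<open>k\<close> of the family (\<open>idempotent_absorbing_if_vnr\<close>), with the same \<open>v\<close> for all families.
  This yields the two statements on idempotent generators at once.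

  For flatness, let \<open>f : A \<rightarrow> B\<close> be a homomorphism whose kernel is killed by \<open>t\<close>.  An element of
  \<open>A \<otimes> F\<close> is written in coordinates over the free module on the elements of \<open>F\<close>.  If \<open>f \<otimes> F\<close> kills it,
  then the image of its coordinate vector is a combination \<open>\<Sum> b\<^sub>i k\<^sub>i\<close> of relations \<open>k\<^sub>i\<close> of \<open>F\<close>.  The
  absorbing idempotent of the coordinates of one relation, read as a linear functional on coordinate
  vectors, allows one relation after the other to be eliminated from the right-hand side by a
  correction inside \<open>A\<close> (\<open>eliminate_relations\<close>).  In the end the coordinate vector itself is a combination of
  relations with coefficients in \<open>A\<close>, up to the factor \<open>t v\<close>, so \<open>t v\<close> kills the kernel of \<open>f \<otimes> F\<close>
  (\<open>tensor_map_kernel\<close>).  The number of eliminations depends on the element, the factor does not.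
  Together with right exactness up to a factor (\<open>tensor_map_right_exact\<close>) this gives uniform
  flatness.  Applied to the inclusion of the first syzygies of \<open>M\<close> into the free module on \<open>M\<close>, it shows that
  \<open>v\<close> kills every \<open>Tor\<^sub>1(M, N)\<close> (\<open>Tor1_annihilated\<close>).

  Conversely, \<open>Tor\<^sub>1(R/a, R/a) = (a)/(a\<^sup>2)\<close>.  What carries over to other modules is a pairing
  with values in \<open>R/(a\<^sup>2)\<close> (\<open>square_pairing\<close>) that detects the class of the relation \<open>a \<cdot> 1 = 0\<close> tensored
  with \<open>1\<close>.  An annihilator of that class therefore satisfies \<open>s a \<in> (a\<^sup>2)\<close>.  The conditions in which
  \<open>s\<close> may depend on the modules are tested on a single sequence that contains all \<open>0 \<rightarrow> (a) \<rightarrow> R \<rightarrow> R/a \<rightarrow> 0\<close>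
  simultaneously, namely their direct sum (\<open>square_test_sequence_exists\<close>).
\<close>

section \<open>Submodules and homomorphisms\<close>

lemma (in abelian_group) minus_right_zero: "x \<in> carrier G \<Longrightarrow> x \<ominus> \<zero> = x"
  using add.inv_one by (simp add: a_minus_def)

lemma (in abelian_group) minus_eq_zero_iff:
  "x \<in> carrier G \<Longrightarrow> y \<in> carrier G \<Longrightarrow> x \<ominus> y = \<zero> \<longleftrightarrow> x = y"
  using add.inv_equality[of x "\<ominus> y"] by (auto simp: a_minus_def r_neg)

lemma (in module) submodule_iff:
  "submodule N R M \<longleftrightarrow> N \<subseteq> carrier M \<and> \<zero>\<^bsub>M\<^esub> \<in> N \<and>
     (\<forall>x\<in>N. \<forall>y\<in>N. x \<oplus>\<^bsub>M\<^esub> y \<in> N) \<and> (\<forall>r\<in>carrier R. \<forall>x\<in>N. r \<odot>\<^bsub>M\<^esub> x \<in> N)"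
  (is "_ \<longleftrightarrow> ?P")
proof
  assume N: "submodule N R M"
  have "\<zero>\<^bsub>M\<^esub> \<in> N"
    using subgroup.one_closed[OF submodule.axioms(1)[OF N]] by simp
  then show ?P using submoduleE[OF N] by blast
next
  assume P: ?P
  show "submodule N R M"
  proof (rule submoduleI)
    fix x assume "x \<in> N"
    then have "(\<ominus>\<^bsub>R\<^esub> \<one>\<^bsub>R\<^esub>) \<odot>\<^bsub>M\<^esub> x \<in> N" "x \<in> carrier M" using P by auto
    then show "\<ominus>\<^bsub>M\<^esub> x \<in> N" by (simp add: smult_l_minus)
  qed (use P in auto)
qed

lemma mod_span_submodule:
  assumes "module R M" "X \<subseteq> carrier M"
  shows "submodule (mod_span R M X) R M"
proof -
  interpret M: module R M by fact
  show ?thesis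
    using assms(2) M.carrier_is_submodule unfolding mod_span_def M.submodule_iff by auto
qed

lemma mod_span_incl: "X \<subseteq> mod_span R M X"
  unfolding mod_span_def by blast

lemma mod_span_least: "submodule N R M \<Longrightarrow> X \<subseteq> N \<Longrightarrow> mod_span R M X \<subseteq> N"
  unfolding mod_span_def by blast

lemma (in module) submodule_minus:
  assumes "submodule N R M" "x \<in> N" "y \<in> N"
  shows "x \<ominus>\<^bsub>M\<^esub> y \<in> N"
  using assms submoduleE[OF assms(1)] by (simp add: a_minus_def)

lemma sub_mod_module: "module R M \<Longrightarrow> submodule N R M \<Longrightarrow> module R (sub_mod M N)"
  by (rule submodule.submodule_is_module)

lemma mem_a_kernel: "x \<in> a_kernel M N f \<longleftrightarrow> x \<in> carrier M \<and> f x = \<zero>\<^bsub>N\<^esub>"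
  by (simp add: a_kernel_def')

lemma mod_homI:
  assumes "\<And>x. x \<in> carrier M \<Longrightarrow> f x \<in> carrier N"
    and "\<And>x y. x \<in> carrier M \<Longrightarrow> y \<in> carrier M \<Longrightarrow> f (x \<oplus>\<^bsub>M\<^esub> y) = f x \<oplus>\<^bsub>N\<^esub> f y"
    and "\<And>r x. r \<in> carrier R \<Longrightarrow> x \<in> carrier M \<Longrightarrow> f (r \<odot>\<^bsub>M\<^esub> x) = r \<odot>\<^bsub>N\<^esub> f x"
  shows "f \<in> mod_hom R M N"
  using assms unfolding mod_hom_def by auto

lemma mod_homD:
  assumes "f \<in> mod_hom R M N"
  shows "x \<in> carrier M \<Longrightarrow> f x \<in> carrier N"
    and "x \<in> carrier M \<Longrightarrow> y \<in> carrier M \<Longrightarrow> f (x \<oplus>\<^bsub>M\<^esub> y) = f x \<oplus>\<^bsub>N\<^esub> f y"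
    and "r \<in> carrier R \<Longrightarrow> x \<in> carrier M \<Longrightarrow> f (r \<odot>\<^bsub>M\<^esub> x) = r \<odot>\<^bsub>N\<^esub> f x"
  using assms unfolding mod_hom_def by auto

lemma mod_hom_zero:
  assumes "module R M" "module R N" and f: "f \<in> mod_hom R M N"
  shows "f \<zero>\<^bsub>M\<^esub> = \<zero>\<^bsub>N\<^esub>"
proof -
  interpret M: module R M by fact
  interpret N: module R N by fact
  have "f (\<zero>\<^bsub>R\<^esub> \<odot>\<^bsub>M\<^esub> \<zero>\<^bsub>M\<^esub>) = \<zero>\<^bsub>R\<^esub> \<odot>\<^bsub>N\<^esub> f \<zero>\<^bsub>M\<^esub>" by (rule mod_homD(3)[OF f]) auto
  then show ?thesis using mod_homD(1)[OF f, of "\<zero>\<^bsub>M\<^esub>"] by simp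
qed

lemma mod_hom_minus:
  assumes "module R M" "module R N" and f: "f \<in> mod_hom R M N"
    and "x \<in> carrier M" "y \<in> carrier M"
  shows "f (x \<ominus>\<^bsub>M\<^esub> y) = f x \<ominus>\<^bsub>N\<^esub> f y"
proof -
  interpret M: module R M by fact
  interpret N: module R N by fact
  have "f (\<ominus>\<^bsub>M\<^esub> y) = \<ominus>\<^bsub>N\<^esub> f y"
    using mod_homD(3)[OF f, of "\<ominus>\<^bsub>R\<^esub> \<one>\<^bsub>R\<^esub>" y] assms(5) mod_homD(1)[OF f, of y]
    by (simp add: M.smult_l_minus N.smult_l_minus)
  then show ?thesis using mod_homD(2)[OF f] assms by (simp add: a_minus_def)
qed

lemma mod_hom_comp:
  assumes "f \<in> mod_hom R M N" "g \<in> mod_hom R N P"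
  shows "(\<lambda>x. g (f x)) \<in> mod_hom R M P"
  using mod_homD[OF assms(1)] mod_homD[OF assms(2)] by (intro mod_homI) auto

lemma mod_hom_kernel_submodule:
  assumes "module R M" "module R N" and f: "f \<in> mod_hom R M N"
  shows "submodule (a_kernel M N f) R M"
proof -
  interpret M: module R M by fact
  interpret N: module R N by fact
  show ?thesis
    unfolding M.submodule_iff
    using mod_homD[OF f] mod_hom_zero[OF assms] by (auto simp: mem_a_kernel)
qed

lemma mod_hom_image_submodule:
  assumes "module R M" "module R N" and f: "f \<in> mod_hom R M N"
  shows "submodule (f ` carrier M) R N"
proof -
  interpret M: module R M by fact
  interpret N: module R N by fact
  have "\<zero>\<^bsub>N\<^esub> \<in> f ` carrier M"
    using mod_hom_zero[OF assms] by (metis M.zero_closed image_eqI)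
  moreover have "f x \<oplus>\<^bsub>N\<^esub> f y \<in> f ` carrier M" if "x \<in> carrier M" "y \<in> carrier M" for x y
    using that mod_homD(2)[OF f that] by (metis M.a_closed image_eqI)
  moreover have "r \<odot>\<^bsub>N\<^esub> f x \<in> f ` carrier M" if "r \<in> carrier R" "x \<in> carrier M" for r x
    using that mod_homD(3)[OF f that] by (metis M.smult_closed image_eqI)
  ultimately show ?thesis
    unfolding N.submodule_iff using mod_homD(1)[OF f] by auto
qed

lemma mod_hom_finsum:
  assumes "module R M" "module R N" and f: "f \<in> mod_hom R M N"
    and "finite Y" "\<And>y. y \<in> Y \<Longrightarrow> g y \<in> carrier M"
  shows "f (\<Oplus>\<^bsub>M\<^esub>y\<in>Y. g y) = (\<Oplus>\<^bsub>N\<^esub>y\<in>Y. f (g y))"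
proof -
  interpret M: module R M by fact
  interpret N: module R N by fact
  show ?thesis using assms(4,5)
  proof (induction)
    case empty
    then show ?case using mod_hom_zero[OF assms(1-3)] by simp
  next
    case (insert y Y)
    then show ?case
      using mod_homD[OF f] by (simp add: M.finsum_closed Pi_def)
  qed
qed

section \<open>Quotient modules\<close>

lemma (in module) submodule_abelian_subgroup:
  assumes "submodule D R M" shows "abelian_subgroup D M"
  using assms by (intro abelian_subgroupI3)
    (auto intro: additive_subgroup.intro submodule.axioms(1) M.abelian_group_axioms)

lemma (in module) coset_eq_iff:
  assumes D: "submodule D R M" and x: "x \<in> carrier M" and y: "y \<in> carrier M"
  shows "D +>\<^bsub>M\<^esub> x = D +>\<^bsub>M\<^esub> y \<longleftrightarrow> x \<ominus>\<^bsub>M\<^esub> y \<in> D"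
proof -
  interpret D: abelian_subgroup D M by (rule submodule_abelian_subgroup[OF D])
  have "x \<ominus>\<^bsub>M\<^esub> y \<in> D \<longleftrightarrow> x \<in> D +>\<^bsub>M\<^esub> y"
    using D.a_rcos_module[OF y x] by (simp add: a_minus_def)
  moreover have "D +>\<^bsub>M\<^esub> x = D +>\<^bsub>M\<^esub> y" if "x \<in> D +>\<^bsub>M\<^esub> y"
    using D.a_repr_independence'[OF that y] by simp
  moreover have "x \<in> D +>\<^bsub>M\<^esub> y" if "D +>\<^bsub>M\<^esub> x = D +>\<^bsub>M\<^esub> y"
    using D.a_rcos_self[OF x] that by simp
  ultimately show ?thesis by blast
qed

lemma (in module) coset_self:
  assumes "submodule D R M" and "x \<in> carrier M"
  shows "x \<in> D +>\<^bsub>M\<^esub> x"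
  using abelian_subgroup.a_rcos_self[OF submodule_abelian_subgroup] assms by blast

lemma (in module) coset_memD:
  assumes D: "submodule D R M" and x: "x \<in> carrier M" and y: "y \<in> D +>\<^bsub>M\<^esub> x"
  shows "y \<in> carrier M" "y \<ominus>\<^bsub>M\<^esub> x \<in> D" "D +>\<^bsub>M\<^esub> y = D +>\<^bsub>M\<^esub> x"
proof -
  interpret D: abelian_subgroup D M by (rule submodule_abelian_subgroup[OF D])
  show "D +>\<^bsub>M\<^esub> y = D +>\<^bsub>M\<^esub> x" using D.a_repr_independence'[OF y x] by simp
  show "y \<in> carrier M" using D.a_elemrcos_carrier[OF x y] .
  then show "y \<ominus>\<^bsub>M\<^esub> x \<in> D" using coset_eq_iff[OF D _ x] \<open>D +>\<^bsub>M\<^esub> y = D +>\<^bsub>M\<^esub> x\<close> by blast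
qed

lemma quot_mod_carrier: "carrier (quot_mod M D) = (\<lambda>x. D +>\<^bsub>M\<^esub> x) ` carrier M"
  unfolding quot_mod_def by (auto simp: A_RCOSETS_def')

lemma quot_mod_zero: "\<zero>\<^bsub>quot_mod M D\<^esub> = D"
  unfolding quot_mod_def by simp

text \<open>Homomorphisms out of a quotient are given below as \<open>\<lambda>C. the_elem (f ` C)\<close>, because this is the form in
  which the maps induced on tensor products are defined.\<close>

context
  fixes R :: "('a, 'r) ring_scheme" (structure) and M :: "('a, 'm) module" and D
  assumes M: "module R M" and D: "submodule D R M"
begin

interpretation M: module R M by (rule M)
interpretation D: abelian_subgroup D M by (rule M.submodule_abelian_subgroup[OF D])

lemma coset_zero: "D +>\<^bsub>M\<^esub> \<zero>\<^bsub>M\<^esub> = D"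
  using D.a_subset by simp

lemma coset_add:
  assumes "x \<in> carrier M" "y \<in> carrier M"
  shows "(D +>\<^bsub>M\<^esub> x) \<oplus>\<^bsub>quot_mod M D\<^esub> (D +>\<^bsub>M\<^esub> y) = D +>\<^bsub>M\<^esub> (x \<oplus>\<^bsub>M\<^esub> y)"
  unfolding quot_mod_def using D.a_rcos_sum[OF assms] by simp

lemma coset_smult:
  assumes r: "r \<in> carrier R" and x: "x \<in> carrier M"
  shows "r \<odot>\<^bsub>quot_mod M D\<^esub> (D +>\<^bsub>M\<^esub> x) = D +>\<^bsub>M\<^esub> (r \<odot>\<^bsub>M\<^esub> x)"
proof -
  have "D +>\<^bsub>M\<^esub> (r \<odot>\<^bsub>M\<^esub> y) = D +>\<^bsub>M\<^esub> (r \<odot>\<^bsub>M\<^esub> x)" if y: "y \<in> D +>\<^bsub>M\<^esub> x" for y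
  proof -
    note Y = M.coset_memD[OF D x y]
    have "r \<odot>\<^bsub>M\<^esub> y \<ominus>\<^bsub>M\<^esub> r \<odot>\<^bsub>M\<^esub> x = r \<odot>\<^bsub>M\<^esub> (y \<ominus>\<^bsub>M\<^esub> x)"
      using Y(1) x r by (simp add: a_minus_def M.smult_r_distr M.smult_r_minus)
    then show ?thesis
      using M.coset_eq_iff[OF D] Y x r submodule.smult_closed[OF D] by simp
  qed
  then have "(\<Union>y\<in>D +>\<^bsub>M\<^esub> x. D +>\<^bsub>M\<^esub> (r \<odot>\<^bsub>M\<^esub> y)) = (\<Union>y\<in>D +>\<^bsub>M\<^esub> x. D +>\<^bsub>M\<^esub> (r \<odot>\<^bsub>M\<^esub> x))"
    by (intro SUP_cong refl)
  then show ?thesis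
    unfolding quot_mod_def using M.coset_self[OF D x] by (simp add: UN_constant) blast
qed

lemma quot_mod_module: "module R (quot_mod M D)"
proof (rule moduleI)
  show "abelian_group (quot_mod M D)"
  proof (rule abelian_groupI)
    fix C assume "C \<in> carrier (quot_mod M D)"
    then obtain x where x: "x \<in> carrier M" "C = D +>\<^bsub>M\<^esub> x" by (auto simp: quot_mod_carrier)
    show "\<exists>C'\<in>carrier (quot_mod M D). C' \<oplus>\<^bsub>quot_mod M D\<^esub> C = \<zero>\<^bsub>quot_mod M D\<^esub>"
    proof (rule bexI)
      show "(D +>\<^bsub>M\<^esub> (\<ominus>\<^bsub>M\<^esub> x)) \<oplus>\<^bsub>quot_mod M D\<^esub> C = \<zero>\<^bsub>quot_mod M D\<^esub>"
        using x by (simp add: coset_add M.l_neg quot_mod_zero coset_zero)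
    qed (use x in \<open>auto simp: quot_mod_carrier\<close>)
    show "\<zero>\<^bsub>quot_mod M D\<^esub> \<oplus>\<^bsub>quot_mod M D\<^esub> C = C"
      using x coset_add[OF M.zero_closed x(1)] by (simp add: quot_mod_zero coset_zero)
  next
    show "\<zero>\<^bsub>quot_mod M D\<^esub> \<in> carrier (quot_mod M D)"
      unfolding quot_mod_zero quot_mod_carrier using coset_zero by blast
  qed (auto simp: quot_mod_carrier coset_add M.a_ac)
qed (auto simp: quot_mod_carrier coset_add coset_smult M.smult_l_distr M.smult_r_distr
      M.smult_assoc1 M.R.is_cring)

lemma coset_hom: "(\<lambda>x. D +>\<^bsub>M\<^esub> x) \<in> mod_hom R M (quot_mod M D)"
  by (rule mod_homI) (auto simp: quot_mod_carrier coset_add coset_smult)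

lemma coset_eq_zero_iff:
  assumes "x \<in> carrier M"
  shows "D +>\<^bsub>M\<^esub> x = \<zero>\<^bsub>quot_mod M D\<^esub> \<longleftrightarrow> x \<in> D"
  using M.coset_eq_iff[OF D assms M.zero_closed] assms
  by (simp add: quot_mod_zero coset_zero M.minus_right_zero)

lemma annihilates_quot_mod:
  assumes "s \<in> carrier R"
  shows "annihilates s (quot_mod M D) \<longleftrightarrow> (\<forall>x\<in>carrier M. s \<odot>\<^bsub>M\<^esub> x \<in> D)"
  unfolding annihilates_def quot_mod_carrier
  using assms by (auto simp: coset_smult coset_eq_zero_iff)

lemma quot_lift:
  fixes P :: "('a, 'p) module"
  assumes P: "module R P" and f: "f \<in> mod_hom R M P" and fD: "\<And>x. x \<in> D \<Longrightarrow> f x = \<zero>\<^bsub>P\<^esub>"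
  shows "(\<lambda>C. the_elem (f ` C)) \<in> mod_hom R (quot_mod M D) P" (is "?F \<in> _")
    and "x \<in> carrier M \<Longrightarrow> the_elem (f ` (D +>\<^bsub>M\<^esub> x)) = f x"
proof -
  interpret P: module R P by (rule P)
  have F: "?F (D +>\<^bsub>M\<^esub> x) = f x" if x: "x \<in> carrier M" for x
  proof -
    have "f y = f x" if y: "y \<in> D +>\<^bsub>M\<^esub> x" for y
    proof -
      note Y = M.coset_memD[OF D x y]
      have "f y \<ominus>\<^bsub>P\<^esub> f x = \<zero>\<^bsub>P\<^esub>"
        using fD[OF Y(2)] mod_hom_minus[OF M P f Y(1) x] by simp
      then show ?thesis using mod_homD(1)[OF f] Y(1) x by (simp add: P.minus_eq_zero_iff)
    qed
    then have "f ` (D +>\<^bsub>M\<^esub> x) = (\<lambda>_. f x) ` (D +>\<^bsub>M\<^esub> x)" by (intro image_cong refl)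
    also have "\<dots> = {f x}" using M.coset_self[OF D x] by blast
    finally show ?thesis by simp
  qed
  then show "x \<in> carrier M \<Longrightarrow> the_elem (f ` (D +>\<^bsub>M\<^esub> x)) = f x" .
  show "?F \<in> mod_hom R (quot_mod M D) P"
    by (rule mod_homI)
      (auto simp: quot_mod_carrier coset_add coset_smult F mod_homD[OF f])
qed

end

section \<open>Free modules\<close>

context
  fixes R :: "('a, 'r) ring_scheme" (structure)
  assumes R: "cring R"
begin

interpretation R: cring R by (rule R)

lemma free_mod_carrier:
  "h \<in> carrier (free_mod R X) \<longleftrightarrow>
     (\<forall>x\<in>X. h x \<in> carrier R) \<and> (\<forall>x. x \<notin> X \<longrightarrow> h x = \<zero>) \<and> finite {x. h x \<noteq> \<zero>}"
  by (simp add: free_mod_def)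

lemma free_mod_ops:
  "\<zero>\<^bsub>free_mod R X\<^esub> = (\<lambda>_. \<zero>)"
  "h \<oplus>\<^bsub>free_mod R X\<^esub> k = (\<lambda>x. h x \<oplus> k x)"
  "r \<odot>\<^bsub>free_mod R X\<^esub> h = (\<lambda>x. r \<otimes> h x)"
  by (simp_all add: free_mod_def)

lemma free_mod_coeff: "h \<in> carrier (free_mod R X) \<Longrightarrow> h x \<in> carrier R"
  unfolding free_mod_carrier by (cases "x \<in> X") auto

lemma free_mod_supp:
  assumes "h \<in> carrier (free_mod R X)"
  shows "finite {x. h x \<noteq> \<zero>}" "{x. h x \<noteq> \<zero>} \<subseteq> X"
  using assms unfolding free_mod_carrier by blast+

lemma free_mod_module: "module R (free_mod R X)" (is "module R ?F")
proof -
  have add: "h \<oplus>\<^bsub>?F\<^esub> k \<in> carrier ?F" if "h \<in> carrier ?F" "k \<in> carrier ?F" for h k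
  proof -
    have "{x. h x \<oplus> k x \<noteq> \<zero>} \<subseteq> {x. h x \<noteq> \<zero>} \<union> {x. k x \<noteq> \<zero>}" by auto
    then show ?thesis
      using that unfolding free_mod_carrier free_mod_ops
      by (auto elim!: finite_subset)
  qed
  have smult: "r \<odot>\<^bsub>?F\<^esub> h \<in> carrier ?F" if "r \<in> carrier R" "h \<in> carrier ?F" for r h
  proof -
    have "{x. r \<otimes> h x \<noteq> \<zero>} \<subseteq> {x. h x \<noteq> \<zero>}" using that(1) by auto
    then show ?thesis
      using that unfolding free_mod_carrier free_mod_ops
      by (auto elim!: finite_subset)
  qed
  note coeff = free_mod_coeff
  show ?thesis
  proof (rule moduleI)
    show "abelian_group ?F"
    proof (rule abelian_groupI)
      fix h assume h: "h \<in> carrier ?F"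
      have "(\<ominus> \<one>) \<odot>\<^bsub>?F\<^esub> h \<in> carrier ?F" using smult h by simp
      moreover have "((\<ominus> \<one>) \<odot>\<^bsub>?F\<^esub> h) \<oplus>\<^bsub>?F\<^esub> h = \<zero>\<^bsub>?F\<^esub>"
        unfolding free_mod_ops using coeff[OF h] by (auto simp: R.l_minus R.l_neg)
      ultimately show "\<exists>k\<in>carrier ?F. k \<oplus>\<^bsub>?F\<^esub> h = \<zero>\<^bsub>?F\<^esub>" by blast
    next
      show "\<zero>\<^bsub>?F\<^esub> \<in> carrier ?F" by (auto simp: free_mod_carrier free_mod_ops)
    qed (auto simp: add, auto simp: free_mod_ops coeff R.a_ac fun_eq_iff)
  qed (auto simp: smult R, auto simp: free_mod_ops coeff R.l_distr R.r_distr R.m_assoc fun_eq_iff)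
qed

lemma free_basis_closed: "x \<in> X \<Longrightarrow> free_basis R x \<in> carrier (free_mod R X)"
  by (auto simp: free_mod_carrier free_basis_def)

text \<open>Every element of a free module is reached from zero by adding multiples of basis elements; this
  replaces computations with finite sums in most of the arguments about free modules and tensors.\<close>

lemma free_mod_induct [consumes 1, case_names zero add]:
  assumes h: "h \<in> carrier (free_mod R X)"
    and zero: "P \<zero>\<^bsub>free_mod R X\<^esub>"
    and add: "\<And>k r x. k \<in> carrier (free_mod R X) \<Longrightarrow> r \<in> carrier R \<Longrightarrow> x \<in> X \<Longrightarrow> P k \<Longrightarrow>
       P (k \<oplus>\<^bsub>free_mod R X\<^esub> r \<odot>\<^bsub>free_mod R X\<^esub> free_basis R x)"
  shows "P h"
  using h
proof (induction "card {x. h x \<noteq> \<zero>}" arbitrary: h)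
  case 0
  then have "h = \<zero>\<^bsub>free_mod R X\<^esub>" by (auto simp: free_mod_carrier free_mod_ops)
  then show ?case using zero by simp
next
  case (Suc n)
  have fin: "finite {x. h x \<noteq> \<zero>}" using Suc.prems by (simp add: free_mod_carrier)
  have "{x. h x \<noteq> \<zero>} \<noteq> {}"
  proof
    assume "{x. h x \<noteq> \<zero>} = {}"
    then show False using Suc.hyps(2) by (simp only: card.empty)
  qed
  then obtain x where x: "h x \<noteq> \<zero>" by blast
  have xX: "x \<in> X" using x free_mod_supp(2)[OF Suc.prems] by blast
  let ?k = "h(x := \<zero>)"
  have supp: "{y. ?k y \<noteq> \<zero>} = {y. h y \<noteq> \<zero>} - {x}" by (simp add: set_eq_iff)
  have k: "?k \<in> carrier (free_mod R X)"
    unfolding free_mod_carrier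
  proof (intro conjI ballI allI impI)
    show "finite {y. ?k y \<noteq> \<zero>}" unfolding supp using fin by simp
  qed (use Suc.prems in \<open>simp_all add: free_mod_carrier\<close>)
  have "n = card {y. ?k y \<noteq> \<zero>}" unfolding supp using Suc.hyps(2) fin x by simp
  then have "P ?k" using Suc.hyps(1) k by blast
  then have "P (?k \<oplus>\<^bsub>free_mod R X\<^esub> h x \<odot>\<^bsub>free_mod R X\<^esub> free_basis R x)"
    using add k xX free_mod_coeff[OF Suc.prems] by blast
  also have "?k \<oplus>\<^bsub>free_mod R X\<^esub> h x \<odot>\<^bsub>free_mod R X\<^esub> free_basis R x = h"
    unfolding free_mod_ops free_basis_def using free_mod_coeff[OF Suc.prems] by auto
  finally show ?case .
qed

lemma free_hom_ext:
  assumes P: "module R P" and f: "f \<in> mod_hom R (free_mod R X) P" and g: "g \<in> mod_hom R (free_mod R X) P"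
    and eq: "\<And>x. x \<in> X \<Longrightarrow> f (free_basis R x) = g (free_basis R x)"
    and h: "h \<in> carrier (free_mod R X)"
  shows "f h = g h"
  using h
proof (induction rule: free_mod_induct)
  case zero
  then show ?case using mod_hom_zero[OF free_mod_module P f] mod_hom_zero[OF free_mod_module P g] by simp
next
  case (add k r x)
  interpret F: module R "free_mod R X" by (rule free_mod_module)
  show ?case
    using add free_basis_closed[OF add(3)] by (simp add: mod_homD[OF f] mod_homD[OF g] eq)
qed

text \<open>The sum defining the linear extension may be taken over any finite set of basis elements
  that contains the support, so that two supports can be compared.\<close>

lemma free_lift_superset:
  assumes P: "module R P" and \<phi>: "\<And>x. x \<in> X \<Longrightarrow> \<phi> x \<in> carrier P"
    and h: "h \<in> carrier (free_mod R X)" and Y: "finite Y" "{x. h x \<noteq> \<zero>} \<subseteq> Y" "Y \<subseteq> X"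
  shows "free_lift R P \<phi> h = (\<Oplus>\<^bsub>P\<^esub>x\<in>Y. h x \<odot>\<^bsub>P\<^esub> \<phi> x)"
proof -
  interpret P: module R P by (rule P)
  show ?thesis
    unfolding free_lift_def
    using Y \<phi> free_mod_coeff[OF h]
    by (intro P.add.finprod_mono_neutral_cong_left) (auto simp: subset_iff)
qed

lemma free_lift_hom:
  assumes P: "module R P" and \<phi>: "\<And>x. x \<in> X \<Longrightarrow> \<phi> x \<in> carrier P"
  shows "free_lift R P \<phi> \<in> mod_hom R (free_mod R X) P"
proof -
  interpret P: module R P by (rule P)
  interpret F: module R "free_mod R X" by (rule free_mod_module)
  have supp: "finite {x. h x \<noteq> \<zero>}" "{x. h x \<noteq> \<zero>} \<subseteq> X" if "h \<in> carrier (free_mod R X)" for h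
    using free_mod_supp[OF that] by blast+
  have cl: "h x \<odot>\<^bsub>P\<^esub> \<phi> x \<in> carrier P" if "h \<in> carrier (free_mod R X)" "x \<in> X" for h x
    using free_mod_coeff[OF that(1)] \<phi>[OF that(2)] by simp
  show ?thesis
  proof (rule mod_homI)
    fix h assume h: "h \<in> carrier (free_mod R X)"
    then show "free_lift R P \<phi> h \<in> carrier P"
      unfolding free_lift_def using supp[OF h] cl[OF h] by (intro P.finsum_closed) auto
  next
    fix h k assume h: "h \<in> carrier (free_mod R X)" and k: "k \<in> carrier (free_mod R X)"
    let ?Y = "{x. h x \<noteq> \<zero>} \<union> {x. k x \<noteq> \<zero>}"
    have Y: "finite ?Y" "?Y \<subseteq> X" using supp[OF h] supp[OF k] by auto
    have hk: "{x. (h \<oplus>\<^bsub>free_mod R X\<^esub> k) x \<noteq> \<zero>} \<subseteq> ?Y" by (auto simp: free_mod_ops)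
    have "free_lift R P \<phi> (h \<oplus>\<^bsub>free_mod R X\<^esub> k) =
        (\<Oplus>\<^bsub>P\<^esub>x\<in>?Y. (h \<oplus>\<^bsub>free_mod R X\<^esub> k) x \<odot>\<^bsub>P\<^esub> \<phi> x)"
      by (rule free_lift_superset[OF P \<phi> _ Y(1) hk Y(2)]) (use h k in auto)
    also have "\<dots> = (\<Oplus>\<^bsub>P\<^esub>x\<in>?Y. h x \<odot>\<^bsub>P\<^esub> \<phi> x \<oplus>\<^bsub>P\<^esub> k x \<odot>\<^bsub>P\<^esub> \<phi> x)"
      unfolding free_mod_ops
      using Y cl[OF h] cl[OF k] free_mod_coeff[OF h] free_mod_coeff[OF k] \<phi>
      by (intro P.finsum_cong') (auto simp: P.smult_l_distr subset_iff)
    also have "\<dots> = (\<Oplus>\<^bsub>P\<^esub>x\<in>?Y. h x \<odot>\<^bsub>P\<^esub> \<phi> x) \<oplus>\<^bsub>P\<^esub> (\<Oplus>\<^bsub>P\<^esub>x\<in>?Y. k x \<odot>\<^bsub>P\<^esub> \<phi> x)"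
      using Y cl[OF h] cl[OF k] by (intro P.finsum_addf) auto
    also have "\<dots> = free_lift R P \<phi> h \<oplus>\<^bsub>P\<^esub> free_lift R P \<phi> k"
      using free_lift_superset[OF P \<phi> h Y(1) _ Y(2)] free_lift_superset[OF P \<phi> k Y(1) _ Y(2)] by auto
    finally show "free_lift R P \<phi> (h \<oplus>\<^bsub>free_mod R X\<^esub> k) = free_lift R P \<phi> h \<oplus>\<^bsub>P\<^esub> free_lift R P \<phi> k" .
  next
    fix r h assume r: "r \<in> carrier R" and h: "h \<in> carrier (free_mod R X)"
    let ?Y = "{x. h x \<noteq> \<zero>}"
    have rh: "{x. (r \<odot>\<^bsub>free_mod R X\<^esub> h) x \<noteq> \<zero>} \<subseteq> ?Y" using r by (auto simp: free_mod_ops)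
    have "free_lift R P \<phi> (r \<odot>\<^bsub>free_mod R X\<^esub> h) = (\<Oplus>\<^bsub>P\<^esub>x\<in>?Y. (r \<odot>\<^bsub>free_mod R X\<^esub> h) x \<odot>\<^bsub>P\<^esub> \<phi> x)"
      by (rule free_lift_superset[OF P \<phi> _ supp(1)[OF h] rh supp(2)[OF h]]) (use r h in auto)
    also have "\<dots> = (\<Oplus>\<^bsub>P\<^esub>x\<in>?Y. r \<odot>\<^bsub>P\<^esub> (h x \<odot>\<^bsub>P\<^esub> \<phi> x))"
      unfolding free_mod_ops
      using supp[OF h] cl[OF h] free_mod_coeff[OF h] \<phi> r
      by (intro P.finsum_cong') (auto simp: P.smult_assoc1 subset_iff)
    also have "\<dots> = r \<odot>\<^bsub>P\<^esub> free_lift R P \<phi> h"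
      unfolding free_lift_def using supp[OF h] cl[OF h] r by (subst P.finsum_smult_ldistr) auto
    finally show "free_lift R P \<phi> (r \<odot>\<^bsub>free_mod R X\<^esub> h) = r \<odot>\<^bsub>P\<^esub> free_lift R P \<phi> h" .
  qed
qed

lemma free_lift_basis:
  assumes P: "module R P" and x: "x \<in> X" "\<phi> x \<in> carrier P"
  shows "free_lift R P \<phi> (free_basis R x) = \<phi> x"
proof -
  interpret P: module R P by (rule P)
  have "free_lift R P \<phi> (free_basis R x) = (\<Oplus>\<^bsub>P\<^esub>y\<in>{x}. free_basis R x y \<odot>\<^bsub>P\<^esub> \<phi> y)"
    by (rule free_lift_superset[OF P, of "{x}"])
      (use x in \<open>auto simp: free_basis_def free_mod_carrier\<close>)
  then show ?thesis using x by (simp add: free_basis_def)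
qed

end

section \<open>Tensor products\<close>

abbreviation tensor_class :: "('a, 'r) ring_scheme \<Rightarrow> ('a, 'm) module \<Rightarrow> ('a, 'n) module
    \<Rightarrow> ('m \<times> 'n \<Rightarrow> 'a) \<Rightarrow> ('m \<times> 'n \<Rightarrow> 'a) set" where
  "tensor_class R M N h \<equiv> tensor_rel R M N +>\<^bsub>tensor_free R M N\<^esub> h"

definition bilinear_map :: "('a, 'r) ring_scheme \<Rightarrow> ('a, 'm) module \<Rightarrow> ('a, 'n) module
    \<Rightarrow> ('a, 'p) module \<Rightarrow> ('m \<Rightarrow> 'n \<Rightarrow> 'p) \<Rightarrow> bool" where
  "bilinear_map R M N P \<phi> \<longleftrightarrow>
     (\<forall>y\<in>carrier N. (\<lambda>x. \<phi> x y) \<in> mod_hom R M P) \<and> (\<forall>x\<in>carrier M. \<phi> x \<in> mod_hom R N P)"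

context
  fixes R :: "('a, 'r) ring_scheme" (structure) and M :: "('a, 'm) module" and N :: "('a, 'n) module"
  assumes M: "module R M" and N: "module R N"
begin

interpretation M: module R M by (rule M)
interpretation N: module R N by (rule N)
interpretation F: module R "tensor_free R M N"
  unfolding tensor_free_def by (rule free_mod_module[OF M.R.is_cring])

lemma tensor_basis_closed:
  "x \<in> carrier M \<Longrightarrow> y \<in> carrier N \<Longrightarrow> free_basis R (x, y) \<in> carrier (tensor_free R M N)"
  unfolding tensor_free_def by (rule free_basis_closed[OF M.R.is_cring]) simp

lemma tensor_rel_submodule: "submodule (tensor_rel R M N) R (tensor_free R M N)"
  unfolding tensor_rel_def Let_def
  by (rule mod_span_submodule[OF F.module_axioms])
    (auto intro!: F.minus_closed F.a_closed F.smult_closed tensor_basis_closed)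

lemma tensor_rel_gens:
  fixes F e defines "F \<equiv> tensor_free R M N" and "e \<equiv> free_basis R"
  shows
  "x \<in> carrier M \<Longrightarrow> x' \<in> carrier M \<Longrightarrow> y \<in> carrier N \<Longrightarrow>
     e (x \<oplus>\<^bsub>M\<^esub> x', y) \<ominus>\<^bsub>F\<^esub> (e (x, y) \<oplus>\<^bsub>F\<^esub> e (x', y)) \<in> tensor_rel R M N"
  "x \<in> carrier M \<Longrightarrow> y \<in> carrier N \<Longrightarrow> y' \<in> carrier N \<Longrightarrow>
     e (x, y \<oplus>\<^bsub>N\<^esub> y') \<ominus>\<^bsub>F\<^esub> (e (x, y) \<oplus>\<^bsub>F\<^esub> e (x, y')) \<in> tensor_rel R M N"
  "r \<in> carrier R \<Longrightarrow> x \<in> carrier M \<Longrightarrow> y \<in> carrier N \<Longrightarrow>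
     e (r \<odot>\<^bsub>M\<^esub> x, y) \<ominus>\<^bsub>F\<^esub> (r \<odot>\<^bsub>F\<^esub> e (x, y)) \<in> tensor_rel R M N"
  "r \<in> carrier R \<Longrightarrow> x \<in> carrier M \<Longrightarrow> y \<in> carrier N \<Longrightarrow>
     e (x, r \<odot>\<^bsub>N\<^esub> y) \<ominus>\<^bsub>F\<^esub> (r \<odot>\<^bsub>F\<^esub> e (x, y)) \<in> tensor_rel R M N"
  unfolding tensor_rel_def Let_def F_def e_def
  by (rule subsetD[OF mod_span_incl]; blast)+

lemma tensor_rel_induct:
  fixes F e defines "F \<equiv> tensor_free R M N" and "e \<equiv> free_basis R"
  assumes h: "h \<in> tensor_rel R M N" and D: "submodule D R F"
    and "\<And>x x' y. x \<in> carrier M \<Longrightarrow> x' \<in> carrier M \<Longrightarrow> y \<in> carrier N \<Longrightarrow>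
       e (x \<oplus>\<^bsub>M\<^esub> x', y) \<ominus>\<^bsub>F\<^esub> (e (x, y) \<oplus>\<^bsub>F\<^esub> e (x', y)) \<in> D"
    and "\<And>x y y'. x \<in> carrier M \<Longrightarrow> y \<in> carrier N \<Longrightarrow> y' \<in> carrier N \<Longrightarrow>
       e (x, y \<oplus>\<^bsub>N\<^esub> y') \<ominus>\<^bsub>F\<^esub> (e (x, y) \<oplus>\<^bsub>F\<^esub> e (x, y')) \<in> D"
    and "\<And>r x y. r \<in> carrier R \<Longrightarrow> x \<in> carrier M \<Longrightarrow> y \<in> carrier N \<Longrightarrow>
       e (r \<odot>\<^bsub>M\<^esub> x, y) \<ominus>\<^bsub>F\<^esub> (r \<odot>\<^bsub>F\<^esub> e (x, y)) \<in> D"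
    and "\<And>r x y. r \<in> carrier R \<Longrightarrow> x \<in> carrier M \<Longrightarrow> y \<in> carrier N \<Longrightarrow>
       e (x, r \<odot>\<^bsub>N\<^esub> y) \<ominus>\<^bsub>F\<^esub> (r \<odot>\<^bsub>F\<^esub> e (x, y)) \<in> D"
  shows "h \<in> D"
proof -
  have "tensor_rel R M N \<subseteq> D"
    unfolding tensor_rel_def Let_def
    by (rule mod_span_least) (use assms(4-) in \<open>auto simp: F_def e_def\<close>)
  then show ?thesis using h by blast
qed

lemma tensor_module: "module R (tensor R M N)"
  unfolding tensor_def by (rule quot_mod_module[OF F.module_axioms tensor_rel_submodule])

interpretation T: module R "tensor R M N" by (rule tensor_module)

lemma tensor_cls_hom:
  "tensor_class R M N \<in> mod_hom R (tensor_free R M N) (tensor R M N)"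
  unfolding tensor_def by (rule coset_hom[OF F.module_axioms tensor_rel_submodule])

lemma tensor_cls_zero_iff:
  "h \<in> carrier (tensor_free R M N) \<Longrightarrow>
     tensor_class R M N h = \<zero>\<^bsub>tensor R M N\<^esub> \<longleftrightarrow> h \<in> tensor_rel R M N"
  unfolding tensor_def by (rule coset_eq_zero_iff[OF F.module_axioms tensor_rel_submodule])

lemma tensor_carrierE:
  assumes "z \<in> carrier (tensor R M N)"
  obtains h where "h \<in> carrier (tensor_free R M N)" "z = tensor_class R M N h"
  using assms unfolding tensor_def quot_mod_carrier by blast

lemma pure_tensor_closed [intro]: "x \<in> carrier M \<Longrightarrow> y \<in> carrier N \<Longrightarrow> pure_tensor R M N x y \<in> carrier (tensor R M N)"
  unfolding pure_tensor_def using mod_homD(1)[OF tensor_cls_hom] tensor_basis_closed by blast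

lemma pure_tensor_eqs:
  "x \<in> carrier M \<Longrightarrow> x' \<in> carrier M \<Longrightarrow> y \<in> carrier N \<Longrightarrow> pure_tensor R M N (x \<oplus>\<^bsub>M\<^esub> x') y = pure_tensor R M N x y \<oplus>\<^bsub>tensor R M N\<^esub> pure_tensor R M N x' y"
  "x \<in> carrier M \<Longrightarrow> y \<in> carrier N \<Longrightarrow> y' \<in> carrier N \<Longrightarrow> pure_tensor R M N x (y \<oplus>\<^bsub>N\<^esub> y') = pure_tensor R M N x y \<oplus>\<^bsub>tensor R M N\<^esub> pure_tensor R M N x y'"
  "r \<in> carrier R \<Longrightarrow> x \<in> carrier M \<Longrightarrow> y \<in> carrier N \<Longrightarrow> pure_tensor R M N (r \<odot>\<^bsub>M\<^esub> x) y = r \<odot>\<^bsub>tensor R M N\<^esub> pure_tensor R M N x y"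
  "r \<in> carrier R \<Longrightarrow> x \<in> carrier M \<Longrightarrow> y \<in> carrier N \<Longrightarrow> pure_tensor R M N x (r \<odot>\<^bsub>N\<^esub> y) = r \<odot>\<^bsub>tensor R M N\<^esub> pure_tensor R M N x y"
proof -
  note eq = F.coset_eq_iff[OF tensor_rel_submodule, THEN iffD2]
  note hom = mod_homD(2,3)[OF tensor_cls_hom, symmetric]
  note [simp] = tensor_basis_closed
  show "pure_tensor R M N (x \<oplus>\<^bsub>M\<^esub> x') y = pure_tensor R M N x y \<oplus>\<^bsub>tensor R M N\<^esub> pure_tensor R M N x' y"
    if "x \<in> carrier M" "x' \<in> carrier M" "y \<in> carrier N"
    unfolding pure_tensor_def
    by (subst hom) (use that tensor_rel_gens(1)[OF that] in \<open>simp_all add: eq\<close>)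
  show "pure_tensor R M N x (y \<oplus>\<^bsub>N\<^esub> y') = pure_tensor R M N x y \<oplus>\<^bsub>tensor R M N\<^esub> pure_tensor R M N x y'"
    if "x \<in> carrier M" "y \<in> carrier N" "y' \<in> carrier N"
    unfolding pure_tensor_def
    by (subst hom) (use that tensor_rel_gens(2)[OF that] in \<open>simp_all add: eq\<close>)
  show "pure_tensor R M N (r \<odot>\<^bsub>M\<^esub> x) y = r \<odot>\<^bsub>tensor R M N\<^esub> pure_tensor R M N x y"
    if "r \<in> carrier R" "x \<in> carrier M" "y \<in> carrier N"
    unfolding pure_tensor_def
    by (subst hom) (use that tensor_rel_gens(3)[OF that] in \<open>simp_all add: eq\<close>)
  show "pure_tensor R M N x (r \<odot>\<^bsub>N\<^esub> y) = r \<odot>\<^bsub>tensor R M N\<^esub> pure_tensor R M N x y"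
    if "r \<in> carrier R" "x \<in> carrier M" "y \<in> carrier N"
    unfolding pure_tensor_def
    by (subst hom) (use that tensor_rel_gens(4)[OF that] in \<open>simp_all add: eq\<close>)
qed

lemma pure_tensor_zero:
  "y \<in> carrier N \<Longrightarrow> pure_tensor R M N \<zero>\<^bsub>M\<^esub> y = \<zero>\<^bsub>tensor R M N\<^esub>"
  "x \<in> carrier M \<Longrightarrow> pure_tensor R M N x \<zero>\<^bsub>N\<^esub> = \<zero>\<^bsub>tensor R M N\<^esub>"
  using pure_tensor_eqs(3)[of "\<zero>\<^bsub>R\<^esub>" "\<zero>\<^bsub>M\<^esub>" y] pure_tensor_eqs(4)[of "\<zero>\<^bsub>R\<^esub>" x "\<zero>\<^bsub>N\<^esub>"]
    pure_tensor_closed[of "\<zero>\<^bsub>M\<^esub>" y] pure_tensor_closed[of x "\<zero>\<^bsub>N\<^esub>"] by simp_all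

lemma pure_tensor_bilinear: "bilinear_map R M N (tensor R M N) (pure_tensor R M N)"
  unfolding bilinear_map_def by (auto intro!: mod_homI simp: pure_tensor_eqs)

lemma tensor_induct [consumes 1, case_names zero add]:
  assumes z: "z \<in> carrier (tensor R M N)" and base: "P \<zero>\<^bsub>tensor R M N\<^esub>"
    and step: "\<And>z x y. z \<in> carrier (tensor R M N) \<Longrightarrow> x \<in> carrier M \<Longrightarrow> y \<in> carrier N \<Longrightarrow> P z \<Longrightarrow>
       P (z \<oplus>\<^bsub>tensor R M N\<^esub> pure_tensor R M N x y)"
  shows "P z"
proof -
  let ?cls = "tensor_class R M N"
  have "P (?cls h)" if "h \<in> carrier (tensor_free R M N)" for h
    using that unfolding tensor_free_def
  proof (induction rule: free_mod_induct[OF M.R.is_cring, consumes 1, case_names zero add])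
    case zero
    then show ?case
      using mod_hom_zero[OF F.module_axioms tensor_module tensor_cls_hom] base
      by (simp add: tensor_free_def)
  next
    case (add k r p)
    obtain x y where p: "p = (x, y)" and xy: "x \<in> carrier M" "y \<in> carrier N" using add.hyps(3) by blast
    have k: "k \<in> carrier (tensor_free R M N)" using add.hyps(1) by (simp add: tensor_free_def)
    have "?cls (k \<oplus>\<^bsub>tensor_free R M N\<^esub> r \<odot>\<^bsub>tensor_free R M N\<^esub> free_basis R p)
        = ?cls k \<oplus>\<^bsub>tensor R M N\<^esub> pure_tensor R M N (r \<odot>\<^bsub>M\<^esub> x) y"
      using k add.hyps(2) xy tensor_basis_closed[OF xy]
      by (simp add: p mod_homD[OF tensor_cls_hom] pure_tensor_eqs) (simp add: pure_tensor_def)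
    then show ?case
      using step[OF mod_homD(1)[OF tensor_cls_hom k], of "r \<odot>\<^bsub>M\<^esub> x" y] add.hyps(2) add.IH xy
      by (simp add: tensor_free_def)
  qed
  then show ?thesis using z by (elim tensor_carrierE) simp
qed

lemma tensor_hom_ext:
  fixes P :: "('a, 'p) module"
  assumes P: "module R P" and f: "f \<in> mod_hom R (tensor R M N) P" and g: "g \<in> mod_hom R (tensor R M N) P"
    and eq: "\<And>x y. x \<in> carrier M \<Longrightarrow> y \<in> carrier N \<Longrightarrow> f (pure_tensor R M N x y) = g (pure_tensor R M N x y)"
    and z: "z \<in> carrier (tensor R M N)"
  shows "f z = g z"
  using z
proof (induction rule: tensor_induct)
  case zero
  then show ?case using mod_hom_zero[OF tensor_module P f] mod_hom_zero[OF tensor_module P g] by simp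
next
  case (add z x y)
  then show ?case by (simp add: mod_homD[OF f] mod_homD[OF g] pure_tensor_closed eq)
qed

text \<open>The universal property.  The linear extension of a bilinear map to the free module on pairs vanishes
  on the four kinds of tensor relations, so it factors through the quotient.\<close>

lemma tensor_lift:
  fixes P :: "('a, 'p) module" and \<phi>
  defines "G \<equiv> free_lift R P (\<lambda>(x, y). \<phi> x y)"
  assumes P: "module R P" and \<phi>: "bilinear_map R M N P \<phi>"
  shows "(\<lambda>C. the_elem (G ` C)) \<in> mod_hom R (tensor R M N) P"
    and "x \<in> carrier M \<Longrightarrow> y \<in> carrier N \<Longrightarrow> the_elem (G ` pure_tensor R M N x y) = \<phi> x y"
proof -
  interpret P: module R P by (rule P)
  have 1: "(\<lambda>x. \<phi> x y) \<in> mod_hom R M P" if "y \<in> carrier N" for y using \<phi> that by (auto simp: bilinear_map_def)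
  have 2: "\<phi> x \<in> mod_hom R N P" if "x \<in> carrier M" for x using \<phi> that by (auto simp: bilinear_map_def)
  have cl: "\<phi> x y \<in> carrier P" if "x \<in> carrier M" "y \<in> carrier N" for x y
    using mod_homD(1)[OF 2] that by blast
  have G: "G \<in> mod_hom R (tensor_free R M N) P"
    unfolding G_def tensor_free_def by (rule free_lift_hom[OF M.R.is_cring P]) (use cl in auto)
  have Gb: "G (free_basis R (x, y)) = \<phi> x y" if "x \<in> carrier M" "y \<in> carrier N" for x y
    unfolding G_def using that cl
    by (subst free_lift_basis[OF M.R.is_cring P, of _ "carrier M \<times> carrier N"]) auto
  have ker: "submodule (a_kernel (tensor_free R M N) P G) R (tensor_free R M N)"
    by (rule mod_hom_kernel_submodule[OF F.module_axioms P G])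
  have rel: "G h = \<zero>\<^bsub>P\<^esub>" if h: "h \<in> tensor_rel R M N" for h
  proof -
    note [simp] = tensor_basis_closed cl Gb mod_homD[OF G] mod_hom_minus[OF F.module_axioms P G]
       P.minus_eq_zero_iff
    have "h \<in> a_kernel (tensor_free R M N) P G"
      by (rule tensor_rel_induct[OF h ker])
        (simp_all add: mem_a_kernel mod_homD(2,3)[OF 1] mod_homD(2,3)[OF 2])
    then show ?thesis by (simp add: mem_a_kernel)
  qed
  note L = quot_lift[OF F.module_axioms tensor_rel_submodule P G rel]
  show "(\<lambda>C. the_elem (G ` C)) \<in> mod_hom R (tensor R M N) P" unfolding tensor_def by (rule L(1)) auto
  have cls: "the_elem (G ` (tensor_class R M N h)) = G h"
    if "h \<in> carrier (tensor_free R M N)" for h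
    by (rule L(2)) (use that in auto)
  show "the_elem (G ` pure_tensor R M N x y) = \<phi> x y" if "x \<in> carrier M" "y \<in> carrier N"
    unfolding pure_tensor_def using cls[OF tensor_basis_closed[OF that]] Gb[OF that] by simp
qed

end

context
  fixes R :: "('a, 'r) ring_scheme" (structure) and M :: "('a, 'm) module"
    and M' :: "('a, 'k) module" and N :: "('a, 'n) module" and f
  assumes M: "module R M" and M': "module R M'" and N: "module R N" and f: "f \<in> mod_hom R M M'"
begin

lemma tensor_map_bilinear: "bilinear_map R M N (tensor R M' N) (\<lambda>x y. pure_tensor R M' N (f x) y)"
  unfolding bilinear_map_def
  by (auto intro!: mod_homI simp: pure_tensor_eqs[OF M' N] mod_homD[OF f] pure_tensor_closed[OF M' N])

lemma tensor_map_hom: "tensor_map R M M' N f \<in> mod_hom R (tensor R M N) (tensor R M' N)"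
  using tensor_lift(1)[OF M N tensor_module[OF M' N] tensor_map_bilinear]
  unfolding tensor_map_def .

lemma tensor_map_pure:
  "x \<in> carrier M \<Longrightarrow> y \<in> carrier N \<Longrightarrow>
     tensor_map R M M' N f (pure_tensor R M N x y) = pure_tensor R M' N (f x) y"
  using tensor_lift(2)[OF M N tensor_module[OF M' N] tensor_map_bilinear]
  unfolding tensor_map_def .

end

section \<open>The ring as a module over itself\<close>

lemma reg_mod_simps [simp]:
  "carrier (reg_mod R) = carrier R" "zero (reg_mod R) = zero R" "add (reg_mod R) = add R"
  "smult (reg_mod R) = mult R"
  by (simp_all add: reg_mod_def)

lemma reg_mod_module: assumes "cring R" shows "module R (reg_mod R)"
proof -
  interpret cring R by fact
  have "abelian_group (reg_mod R)"
    by (rule abelian_groupI) (auto simp: a_ac intro: bexI[of _ "a_inv R _"] l_neg)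
  then show ?thesis
    by (rule moduleI[OF is_cring]) (auto simp: l_distr r_distr m_assoc)
qed

lemma reg_mod_minus:
  assumes "cring R" "x \<in> carrier R" "y \<in> carrier R"
  shows "x \<ominus>\<^bsub>reg_mod R\<^esub> y = x \<ominus>\<^bsub>R\<^esub> y"
proof -
  interpret cring R by fact
  interpret G: module R "reg_mod R" by (rule reg_mod_module) fact
  have "\<ominus>\<^bsub>reg_mod R\<^esub> y = \<ominus>\<^bsub>R\<^esub> y"
    using G.minus_equality[of "\<ominus>\<^bsub>R\<^esub> y" y] assms by (simp add: l_neg)
  then show ?thesis by (simp add: a_minus_def)
qed

lemma scalar_hom:
  assumes "module R M" "x \<in> carrier M"
  shows "(\<lambda>r. r \<odot>\<^bsub>M\<^esub> x) \<in> mod_hom R (reg_mod R) M"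
proof -
  interpret module R M by fact
  show ?thesis using assms(2) by (intro mod_homI) (auto simp: smult_l_distr smult_assoc1)
qed

lemma smult_hom:
  assumes "module R M" "r \<in> carrier R"
  shows "(\<lambda>x. r \<odot>\<^bsub>M\<^esub> x) \<in> mod_hom R M M"
proof -
  interpret module R M by fact
  show ?thesis
    using assms(2) by (intro mod_homI) (auto simp: smult_r_distr smult_assoc1[symmetric] R.m_comm)
qed

lemma coeff_hom:
  assumes "cring R"
  shows "(\<lambda>h. h x) \<in> mod_hom R (free_mod R X) (reg_mod R)"
  by (rule mod_homI) (auto simp: free_mod_coeff[OF assms] free_mod_ops[OF assms])

section \<open>Idempotents in a uniformly von Neumann regular ring\<close>

text \<open>For fixed \<open>Y\<close> and \<open>c\<close> this is a linear functional of \<open>h\<close> that makes sense for vectors with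
  entries in any module, and homomorphisms commute with it.\<close>

definition lin_comb :: "('a, 'm) module \<Rightarrow> 'x set \<Rightarrow> ('x \<Rightarrow> 'a) \<Rightarrow> ('x \<Rightarrow> 'm) \<Rightarrow> 'm" where
  "lin_comb M Y c h = (\<Oplus>\<^bsub>M\<^esub>y\<in>Y. c y \<odot>\<^bsub>M\<^esub> h y)"

text \<open>The coefficients \<open>c\<close> are recorded, and not only the idempotent \<open>g\<close>, because the same functional
  is later applied to vectors with entries in modules.  The type argument fixes the index type of the
  families, over which a formula cannot quantify.\<close>

definition idempotent_absorbing :: "('a, 'r) ring_scheme \<Rightarrow> 'a \<Rightarrow> 'x itself \<Rightarrow> bool" where
  "idempotent_absorbing R v (_ :: 'x itself) \<longleftrightarrow>
     (\<forall>(Y :: 'x set) k. finite Y \<longrightarrow> k \<in> Y \<rightarrow> carrier R \<longrightarrow>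
       (\<exists>c\<in>Y \<rightarrow> carrier R. let g = lin_comb (reg_mod R) Y c k in
          g \<otimes>\<^bsub>R\<^esub> g = g \<and> (\<forall>y\<in>Y. v \<otimes>\<^bsub>R\<^esub> (g \<otimes>\<^bsub>R\<^esub> k y) = v \<otimes>\<^bsub>R\<^esub> k y)))"

context cring begin

lemma add_complement: "e \<in> carrier R \<Longrightarrow> e \<oplus> (\<one> \<ominus> e) = \<one>"
proof -
  assume e: "e \<in> carrier R"
  then have "e \<oplus> (\<one> \<ominus> e) = (e \<oplus> \<ominus> e) \<oplus> \<one>" by (simp only: a_minus_def a_ac one_closed a_inv_closed)
  then show ?thesis using e by (simp add: r_neg)
qed

text \<open>If \<open>s\<close> were invertible, \<open>s\<inverse> r a\<close> would be an idempotent generator of \<open>(a)\<close>.  In general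
  \<open>\<epsilon> = (q s)\<^sup>3\<close> is an idempotent fixing \<open>s\<^sup>3\<close>, and \<open>q\<close> is an inverse of \<open>s\<close> on the factor \<open>\<epsilon> R\<close>;
  the generator becomes \<open>q \<epsilon> r a\<close>.\<close>

lemma principal_idempotent:
  assumes s: "s \<in> carrier R" and vnr: "\<And>a. a \<in> carrier R \<Longrightarrow> \<exists>r\<in>carrier R. s \<otimes> a = r \<otimes> (a \<otimes> a)"
    and a: "a \<in> carrier R"
  defines "v \<equiv> s \<otimes> s \<otimes> s"
  obtains c where "c \<in> carrier R" "(c \<otimes> a) \<otimes> (c \<otimes> a) = c \<otimes> a" "v \<otimes> ((c \<otimes> a) \<otimes> a) = v \<otimes> a"
proof -
  obtain r where r: "r \<in> carrier R" "s \<otimes> a = r \<otimes> (a \<otimes> a)" using vnr[OF a] by blast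
  \<comment> \<open>Regularity at \<open>s\<^sup>2\<close> reads \<open>s\<^sup>3 = q s\<^sup>4\<close>.\<close>
  obtain q where q: "q \<in> carrier R" "s \<otimes> (s \<otimes> s) = q \<otimes> ((s \<otimes> s) \<otimes> (s \<otimes> s))"
    using vnr[of "s \<otimes> s"] s by auto
  define w where "w = q \<otimes> s"
  define \<epsilon> where "\<epsilon> = w \<otimes> w \<otimes> w"
  have cl [simp]: "w \<in> carrier R" "v \<in> carrier R" "\<epsilon> \<in> carrier R"
    using q(1) s by (simp_all add: w_def v_def \<epsilon>_def)
  note [simp] = s a r(1) q(1)
  have wv: "w \<otimes> v = v" using q(2) by (simp add: w_def v_def m_ac)
  have \<epsilon>: "\<epsilon> = q \<otimes> q \<otimes> q \<otimes> v" by (simp add: \<epsilon>_def w_def v_def m_ac)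
  have w\<epsilon>: "w \<otimes> \<epsilon> = \<epsilon>"
  proof -
    have "w \<otimes> \<epsilon> = q \<otimes> q \<otimes> q \<otimes> (w \<otimes> v)" unfolding \<epsilon> by (simp add: m_ac)
    then show ?thesis by (simp add: wv \<epsilon>)
  qed
  have \<epsilon>v: "v \<otimes> \<epsilon> = v"
  proof -
    have "v \<otimes> \<epsilon> = w \<otimes> (w \<otimes> (w \<otimes> v))" unfolding \<epsilon>_def by (simp add: m_ac)
    then show ?thesis by (simp add: wv)
  qed
  have \<epsilon>\<epsilon>: "\<epsilon> \<otimes> \<epsilon> = \<epsilon>"
  proof -
    have "\<epsilon> \<otimes> \<epsilon> = w \<otimes> (w \<otimes> (w \<otimes> \<epsilon>))" by (subst \<epsilon>_def) (simp add: m_ac)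
    then show ?thesis by (simp add: w\<epsilon>)
  qed
  let ?c = "q \<otimes> \<epsilon> \<otimes> r"
  have ga: "?c \<otimes> a \<otimes> a = \<epsilon> \<otimes> a"
  proof -
    have "?c \<otimes> a \<otimes> a = q \<otimes> \<epsilon> \<otimes> (s \<otimes> a)" unfolding r(2) by (simp add: m_ac)
    also have "\<dots> = (w \<otimes> \<epsilon>) \<otimes> a" by (simp add: w_def m_ac)
    finally show ?thesis by (simp add: w\<epsilon>)
  qed
  show ?thesis
  proof (rule that[of ?c])
    have "(?c \<otimes> a) \<otimes> (?c \<otimes> a) = ?c \<otimes> (?c \<otimes> a \<otimes> a)" by (simp add: m_ac)
    also have "\<dots> = q \<otimes> r \<otimes> a \<otimes> (\<epsilon> \<otimes> \<epsilon>)" unfolding ga by (simp add: m_ac)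
    finally show "(?c \<otimes> a) \<otimes> (?c \<otimes> a) = ?c \<otimes> a" by (simp add: \<epsilon>\<epsilon> m_ac)
    have "v \<otimes> (?c \<otimes> a \<otimes> a) = (v \<otimes> \<epsilon>) \<otimes> a" unfolding ga by (simp add: m_ac)
    then show "v \<otimes> (?c \<otimes> a \<otimes> a) = v \<otimes> a" by (simp add: \<epsilon>v)
  qed simp
qed

text \<open>Idempotents \<open>e\<close> and \<open>g\<close> absorbing two families combine to \<open>e + (1 - e) g = 1 - (1 - e)(1 - g)\<close>,
  which absorbs both.  Absorption is an exact identity after multiplication by the fixed element \<open>v\<close>, so
  no further power of \<open>s\<close> is lost when the family grows.\<close>

lemma idempotent_absorbing_if_vnr:
  assumes s: "s \<in> carrier R" and vnr: "\<And>a. a \<in> carrier R \<Longrightarrow> \<exists>r\<in>carrier R. s \<otimes> a = r \<otimes> (a \<otimes> a)"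
  shows "idempotent_absorbing R (s \<otimes> s \<otimes> s) TYPE('x)"
proof -
  define v where "v = s \<otimes> s \<otimes> s"
  have v: "v \<in> carrier R" using s by (simp add: v_def)
  interpret G: module R "reg_mod R" by (rule reg_mod_module) (rule is_cring)
  have fin: "\<exists>c\<in>Y \<rightarrow> carrier R. lin_comb (reg_mod R) Y c k \<otimes> lin_comb (reg_mod R) Y c k = lin_comb (reg_mod R) Y c k \<and>
      (\<forall>y\<in>Y. v \<otimes> (lin_comb (reg_mod R) Y c k \<otimes> k y) = v \<otimes> k y)"
    if "finite Y" "k \<in> Y \<rightarrow> carrier R" for Y :: "'x set" and k
    using that
  proof (induction Y)
    case empty
    then show ?case by (auto simp: lin_comb_def)
  next
    case (insert x Y)
    then obtain c where c: "c \<in> Y \<rightarrow> carrier R"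
      and idem: "lin_comb (reg_mod R) Y c k \<otimes> lin_comb (reg_mod R) Y c k = lin_comb (reg_mod R) Y c k"
      and abs: "\<And>y. y \<in> Y \<Longrightarrow> v \<otimes> (lin_comb (reg_mod R) Y c k \<otimes> k y) = v \<otimes> k y" by auto
    have kx: "k x \<in> carrier R" and kY: "\<And>y. y \<in> Y \<Longrightarrow> k y \<in> carrier R" using insert.prems by auto
    from principal_idempotent[OF s vnr kx] obtain d where
      d: "d \<in> carrier R" "(d \<otimes> k x) \<otimes> (d \<otimes> k x) = d \<otimes> k x" "v \<otimes> ((d \<otimes> k x) \<otimes> k x) = v \<otimes> k x"
      unfolding v_def by blast
    define e where "e = d \<otimes> k x"
    define g where "g = lin_comb (reg_mod R) Y c k"
    have e: "e \<in> carrier R" "e \<otimes> e = e" "v \<otimes> (e \<otimes> k x) = v \<otimes> k x" using d kx by (simp_all add: e_def)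
    have "g \<in> carrier R"
      using G.finsum_closed[of "\<lambda>y. c y \<otimes> k y" Y] c kY unfolding g_def lin_comb_def by auto
    note g = this idem[folded g_def] abs[folded g_def]
    let ?c = "\<lambda>y. if y = x then d else (\<one> \<ominus> e) \<otimes> c y"
    have "lin_comb (reg_mod R) (insert x Y) ?c k = e \<oplus> (\<Oplus>\<^bsub>reg_mod R\<^esub>y\<in>Y. ?c y \<otimes> k y)"
      unfolding lin_comb_def using insert.hyps d(1) c kx kY e(1)
      by (subst G.finsum_insert) (auto simp: e_def[symmetric] Pi_iff)
    also have "(\<Oplus>\<^bsub>reg_mod R\<^esub>y\<in>Y. ?c y \<otimes> k y) = (\<Oplus>\<^bsub>reg_mod R\<^esub>y\<in>Y. (\<one> \<ominus> e) \<otimes> (c y \<otimes> k y))"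
      using insert.hyps(2) c kY e(1) by (intro G.finsum_cong') (auto simp: m_assoc Pi_iff)
    also have "\<dots> = (\<one> \<ominus> e) \<otimes> g"
      unfolding g_def lin_comb_def
      using G.finsum_smult_ldistr[OF insert.hyps(1), of "\<one> \<ominus> e" "\<lambda>y. c y \<otimes> k y"] e(1) c kY
      by (auto simp: Pi_iff)
    finally have G: "lin_comb (reg_mod R) (insert x Y) ?c k = e \<oplus> (\<one> \<ominus> e) \<otimes> g" .
    define f where "f = \<one> \<ominus> e"
    have f: "f \<in> carrier R" "e \<otimes> f = \<zero>" "f \<otimes> f = f" "e \<oplus> f = \<one>"
    proof -
      show fc: "f \<in> carrier R" using e by (simp add: f_def)
      show ef: "e \<otimes> f = \<zero>" using e by (simp add: f_def a_minus_def r_distr r_minus r_neg)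
      show sum: "e \<oplus> f = \<one>" using e by (simp add: f_def add_complement)
      have "f = (e \<oplus> f) \<otimes> f" using sum fc by simp
      then show "f \<otimes> f = f" using e fc ef by (simp add: l_distr)
    qed
    define h where "h = \<one> \<ominus> g"
    have h: "h \<in> carrier R" "g \<otimes> h = \<zero>" "g \<oplus> h = \<one>"
      using g by (simp_all add: h_def add_complement) (simp add: a_minus_def r_distr r_minus r_neg)
    have 1: "(e \<oplus> f \<otimes> g) \<otimes> (e \<oplus> f \<otimes> g) = e \<oplus> f \<otimes> g"
    proof -
      have "(e \<oplus> f \<otimes> g) \<otimes> (e \<oplus> f \<otimes> g)
          = e \<otimes> e \<oplus> (e \<otimes> f) \<otimes> g \<oplus> ((e \<otimes> f) \<otimes> g \<oplus> (f \<otimes> f) \<otimes> (g \<otimes> g))"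
        using e(1) f(1) g(1) by (simp add: l_distr r_distr m_ac a_ac)
      then show ?thesis using e f g by simp
    qed
    have 2: "v \<otimes> ((e \<oplus> f \<otimes> g) \<otimes> k x) = v \<otimes> k x"
    proof -
      have "v \<otimes> (f \<otimes> k x) = \<zero>"
      proof -
        have "v \<otimes> k x = v \<otimes> (e \<otimes> k x) \<oplus> v \<otimes> (f \<otimes> k x)"
          using e(1) f kx v by (metis l_distr l_one m_closed r_distr)
        then show ?thesis using e f kx v
          by (metis a_comm add.l_cancel_one m_closed)
      qed
      then have "(v \<otimes> (f \<otimes> k x)) \<otimes> g = \<zero>" using g(1) by simp
      moreover have "v \<otimes> ((e \<oplus> f \<otimes> g) \<otimes> k x) = v \<otimes> (e \<otimes> k x) \<oplus> (v \<otimes> (f \<otimes> k x)) \<otimes> g"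
        using e(1) f(1) g(1) kx v by (simp add: l_distr r_distr m_ac)
      ultimately show ?thesis using e kx v by simp
    qed
    have 3: "v \<otimes> ((e \<oplus> f \<otimes> g) \<otimes> k y) = v \<otimes> k y" if y: "y \<in> Y" for y
    proof -
      have "v \<otimes> ((e \<oplus> f \<otimes> g) \<otimes> k y) = e \<otimes> (v \<otimes> k y) \<oplus> f \<otimes> (v \<otimes> (g \<otimes> k y))"
        using e(1) f(1) g(1) kY[OF y] v by (simp add: l_distr r_distr m_ac)
      also have "\<dots> = (e \<oplus> f) \<otimes> (v \<otimes> k y)"
        using e(1) f(1) kY[OF y] v by (simp add: g(3)[OF y] l_distr)
      finally show ?thesis using f(4) kY[OF y] v by simp
    qed
    show ?case
      by (rule bexI[of _ ?c]) (use 1 2 3 c d e in \<open>auto simp: G f_def Pi_iff\<close>)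
  qed
  then show ?thesis unfolding idempotent_absorbing_def Let_def v_def by blast
qed

end

section \<open>Elimination of linear relations\<close>

text \<open>A list of pairs \<open>(b, k)\<close> with \<open>b\<close> in \<open>M\<close> and \<open>k\<close> in the free module on \<open>X\<close> stands for the vector
  \<open>\<Sum> k(\<cdot>) b\<close> with entries in \<open>M\<close>.\<close>

definition rel_sum :: "('a, 'm) module \<Rightarrow> ('m \<times> ('x \<Rightarrow> 'a)) list \<Rightarrow> 'x \<Rightarrow> 'm" where
  "rel_sum M ks x = foldr (\<lambda>(b, k) z. k x \<odot>\<^bsub>M\<^esub> b \<oplus>\<^bsub>M\<^esub> z) ks \<zero>\<^bsub>M\<^esub>"

lemma rel_sum_simps [simp]:
  "rel_sum M [] x = \<zero>\<^bsub>M\<^esub>"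
  "rel_sum M ((b, k) # ks) x = k x \<odot>\<^bsub>M\<^esub> b \<oplus>\<^bsub>M\<^esub> rel_sum M ks x"
  by (simp_all add: rel_sum_def)

context
  fixes R :: "('a, 'r) ring_scheme" (structure) and M :: "('a, 'm) module"
  assumes M: "module R M"
begin

interpretation M: module R M by (rule M)

lemma lin_comb_closed:
  "c \<in> Y \<rightarrow> carrier R \<Longrightarrow> h \<in> Y \<rightarrow> carrier M \<Longrightarrow> lin_comb M Y c h \<in> carrier M"
  unfolding lin_comb_def by (rule M.finsum_closed) auto

lemma lin_comb_add:
  assumes "c \<in> Y \<rightarrow> carrier R" "h \<in> Y \<rightarrow> carrier M" "k \<in> Y \<rightarrow> carrier M"
  shows "lin_comb M Y c (\<lambda>y. h y \<oplus>\<^bsub>M\<^esub> k y) = lin_comb M Y c h \<oplus>\<^bsub>M\<^esub> lin_comb M Y c k"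
proof -
  have "lin_comb M Y c (\<lambda>y. h y \<oplus>\<^bsub>M\<^esub> k y) = (\<Oplus>\<^bsub>M\<^esub>y\<in>Y. c y \<odot>\<^bsub>M\<^esub> h y \<oplus>\<^bsub>M\<^esub> c y \<odot>\<^bsub>M\<^esub> k y)"
    unfolding lin_comb_def
    using assms by (intro M.finsum_cong') (auto simp: M.smult_r_distr Pi_iff)
  also have "\<dots> = lin_comb M Y c h \<oplus>\<^bsub>M\<^esub> lin_comb M Y c k"
    unfolding lin_comb_def using assms by (intro M.finsum_addf) auto
  finally show ?thesis .
qed

lemma lin_comb_hom:
  fixes N :: "('a, 'n) module"
  assumes N: "module R N" and f: "f \<in> mod_hom R M N"
    and "finite Y" "c \<in> Y \<rightarrow> carrier R" "h \<in> Y \<rightarrow> carrier M"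
  shows "f (lin_comb M Y c h) = lin_comb N Y c (\<lambda>y. f (h y))"
proof -
  interpret N: module R N by (rule N)
  have "f (lin_comb M Y c h) = (\<Oplus>\<^bsub>N\<^esub>y\<in>Y. f (c y \<odot>\<^bsub>M\<^esub> h y))"
    unfolding lin_comb_def by (rule mod_hom_finsum[OF M N f]) (use assms in auto)
  also have "\<dots> = lin_comb N Y c (\<lambda>y. f (h y))"
    unfolding lin_comb_def
    by (rule N.finsum_cong') (use assms mod_homD[OF f] in \<open>auto simp: Pi_iff\<close>)
  finally show ?thesis .
qed

lemma lin_comb_cong:
  assumes "c \<in> Y \<rightarrow> carrier R" "k \<in> Y \<rightarrow> carrier M" "\<And>y. y \<in> Y \<Longrightarrow> h y = k y"
  shows "lin_comb M Y c h = lin_comb M Y c k"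
  unfolding lin_comb_def by (rule M.finsum_cong') (use assms in auto)

lemma rel_sum_closed:
  assumes "set ks \<subseteq> carrier M \<times> carrier (free_mod R X)"
  shows "rel_sum M ks x \<in> carrier M"
  using assms
proof (induction ks)
  case (Cons p ks)
  then show ?case by (cases p) (auto simp: free_mod_coeff[OF M.R.is_cring])
qed simp

lemma rel_sum_append:
  assumes "set ks \<union> set ls \<subseteq> carrier M \<times> carrier (free_mod R X)"
  shows "rel_sum M (ks @ ls) x = rel_sum M ks x \<oplus>\<^bsub>M\<^esub> rel_sum M ls x"
  using assms
proof (induction ks)
  case Nil
  then show ?case using rel_sum_closed[of ls X x] by simp
next
  case (Cons p ks)
  obtain b k where p: "p = (b, k)" by force
  have "k x \<in> carrier R" "b \<in> carrier M"
    using Cons.prems free_mod_coeff[OF M.R.is_cring, of k X x] by (auto simp: p)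
  then show ?case
    using Cons rel_sum_closed[of ls X x] rel_sum_closed[of ks X x] by (simp add: p M.a_assoc)
qed

lemma rel_sum_smult:
  assumes "set ks \<subseteq> carrier M \<times> carrier (free_mod R X)" and r: "r \<in> carrier R"
  shows "rel_sum M (map (\<lambda>(b, k). (r \<odot>\<^bsub>M\<^esub> b, k)) ks) x = r \<odot>\<^bsub>M\<^esub> rel_sum M ks x"
  using assms(1)
proof (induction ks)
  case (Cons p ks)
  obtain b k where p: "p = (b, k)" by force
  have bk: "k x \<in> carrier R" "b \<in> carrier M"
    using Cons.prems free_mod_coeff[OF M.R.is_cring, of k X x] by (auto simp: p)
  then have "k x \<odot>\<^bsub>M\<^esub> (r \<odot>\<^bsub>M\<^esub> b) = r \<odot>\<^bsub>M\<^esub> (k x \<odot>\<^bsub>M\<^esub> b)"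
    using r by (simp add: M.smult_assoc1[symmetric] M.R.m_comm)
  then show ?case
    using Cons rel_sum_closed[of ks X x] bk r by (simp add: p M.smult_r_distr)
qed (use r in simp)

lemma smult_minus:
  "r \<in> carrier R \<Longrightarrow> x \<in> carrier M \<Longrightarrow> y \<in> carrier M \<Longrightarrow> r \<odot>\<^bsub>M\<^esub> (x \<ominus>\<^bsub>M\<^esub> y) = r \<odot>\<^bsub>M\<^esub> x \<ominus>\<^bsub>M\<^esub> r \<odot>\<^bsub>M\<^esub> y"
  by (rule mod_hom_minus[OF M M smult_hom[OF M]])

lemma add_minus_cancel:
  assumes "x \<in> carrier M" "y \<in> carrier M" "z \<in> carrier M"
  shows "(x \<oplus>\<^bsub>M\<^esub> y) \<ominus>\<^bsub>M\<^esub> (x \<oplus>\<^bsub>M\<^esub> z) = y \<ominus>\<^bsub>M\<^esub> z"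
proof -
  have "(x \<oplus>\<^bsub>M\<^esub> y) \<ominus>\<^bsub>M\<^esub> (x \<oplus>\<^bsub>M\<^esub> z) = (x \<oplus>\<^bsub>M\<^esub> \<ominus>\<^bsub>M\<^esub> x) \<oplus>\<^bsub>M\<^esub> (y \<ominus>\<^bsub>M\<^esub> z)"
    using assms by (simp add: a_minus_def M.minus_add M.a_ac)
  then show ?thesis using assms by (simp add: M.r_neg)
qed

text \<open>Replacing every \<open>k\<close> by \<open>k - \<phi>(k) k\<^sub>0\<close>, where \<open>\<phi>\<close> is the functional given by \<open>c\<close>, amounts to
  applying \<open>h \<mapsto> h - \<phi>(h) k\<^sub>0\<close> to the vector that the list stands for.\<close>

lemma rel_sum_eliminate:
  assumes ks: "set ks \<subseteq> carrier M \<times> carrier (free_mod R X)"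
    and k0: "k0 \<in> carrier (free_mod R X)" and Y: "finite Y" and c: "c \<in> Y \<rightarrow> carrier R"
  shows "rel_sum M (map (\<lambda>(b, k). (b, k \<ominus>\<^bsub>free_mod R X\<^esub>
            lin_comb (reg_mod R) Y c k \<odot>\<^bsub>free_mod R X\<^esub> k0)) ks) x
       = rel_sum M ks x \<ominus>\<^bsub>M\<^esub> k0 x \<odot>\<^bsub>M\<^esub> lin_comb M Y c (rel_sum M ks)"
  using ks
proof (induction ks)
  case Nil
  have "lin_comb M Y c (\<lambda>y. rel_sum M [] y) = lin_comb M Y c (\<lambda>y. \<zero>\<^bsub>R\<^esub> \<odot>\<^bsub>M\<^esub> \<zero>\<^bsub>M\<^esub>)" by simp
  also have "\<dots> = \<zero>\<^bsub>M\<^esub>"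
    unfolding lin_comb_def by (rule M.add.finprod_one_eqI) (use c in \<open>auto simp: Pi_iff\<close>)
  finally have "lin_comb M Y c (\<lambda>y. rel_sum M [] y) = \<zero>\<^bsub>M\<^esub>" .
  then show ?case using free_mod_coeff[OF M.R.is_cring k0] by (simp add: M.minus_right_zero)
next
  case (Cons p ks)
  obtain b k where p: "p = (b, k)" by force
  interpret F: module R "free_mod R X" by (rule free_mod_module[OF M.R.is_cring])
  interpret G: module R "reg_mod R" by (rule reg_mod_module[OF M.R.is_cring])
  have bk: "b \<in> carrier M" "k \<in> carrier (free_mod R X)" and ks: "set ks \<subseteq> carrier M \<times> carrier (free_mod R X)"
    using Cons.prems by (auto simp: p)
  note co [simp] = free_mod_coeff[OF M.R.is_cring bk(2)] free_mod_coeff[OF M.R.is_cring k0]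
  define W where "W = lin_comb M Y c (rel_sum M ks)"
  define g where "g = lin_comb (reg_mod R) Y c k"
  note cl = rel_sum_closed[OF ks]
  have W: "W \<in> carrier M" unfolding W_def using c cl by (intro lin_comb_closed) auto
  have g: "g \<in> carrier R"
    unfolding g_def lin_comb_def using G.finsum_closed[of "\<lambda>y. c y \<otimes>\<^bsub>R\<^esub> k y" Y] c by (auto simp: Pi_iff)
  have ev: "(k \<ominus>\<^bsub>free_mod R X\<^esub> g \<odot>\<^bsub>free_mod R X\<^esub> k0) x \<odot>\<^bsub>M\<^esub> b
      = k x \<odot>\<^bsub>M\<^esub> b \<ominus>\<^bsub>M\<^esub> (g \<otimes>\<^bsub>R\<^esub> k0 x) \<odot>\<^bsub>M\<^esub> b"
    using mod_hom_minus[OF F.module_axioms M mod_hom_comp[OF coeff_hom[OF M.R.is_cring, of x X] scalar_hom[OF M bk(1)]] bk(2)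
      F.smult_closed[OF g k0]] by (simp add: free_mod_ops[OF M.R.is_cring])
  have IH: "rel_sum M (map (\<lambda>(b, k). (b, k \<ominus>\<^bsub>free_mod R X\<^esub>
            lin_comb (reg_mod R) Y c k \<odot>\<^bsub>free_mod R X\<^esub> k0)) ks) x
       = rel_sum M ks x \<ominus>\<^bsub>M\<^esub> k0 x \<odot>\<^bsub>M\<^esub> W"
    unfolding W_def by (rule Cons.IH[OF ks])
  have "lin_comb M Y c (rel_sum M (p # ks)) = lin_comb M Y c (\<lambda>y. k y \<odot>\<^bsub>M\<^esub> b \<oplus>\<^bsub>M\<^esub> rel_sum M ks y)"
    by (rule arg_cong[where f = "lin_comb M Y c"]) (simp add: p fun_eq_iff)
  also have "\<dots> = lin_comb M Y c (\<lambda>y. k y \<odot>\<^bsub>M\<^esub> b) \<oplus>\<^bsub>M\<^esub> W"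
    unfolding W_def using c cl bk by (subst lin_comb_add) auto
  also have "lin_comb M Y c (\<lambda>y. k y \<odot>\<^bsub>M\<^esub> b) = g \<odot>\<^bsub>M\<^esub> b"
    unfolding g_def lin_comb_def
    by (subst mod_hom_finsum[OF G.module_axioms M scalar_hom[OF M bk(1)] Y])
      (use c bk in \<open>auto simp: Pi_iff M.smult_assoc1 intro!: M.finsum_cong'\<close>)
  finally have L: "lin_comb M Y c (rel_sum M (p # ks)) = g \<odot>\<^bsub>M\<^esub> b \<oplus>\<^bsub>M\<^esub> W" .
  have "k0 x \<odot>\<^bsub>M\<^esub> (g \<odot>\<^bsub>M\<^esub> b \<oplus>\<^bsub>M\<^esub> W) = (g \<otimes>\<^bsub>R\<^esub> k0 x) \<odot>\<^bsub>M\<^esub> b \<oplus>\<^bsub>M\<^esub> k0 x \<odot>\<^bsub>M\<^esub> W"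
    using g W bk by (simp add: M.smult_r_distr M.smult_assoc1[symmetric] M.R.m_comm)
  moreover have "(a \<ominus>\<^bsub>M\<^esub> a') \<oplus>\<^bsub>M\<^esub> (d \<ominus>\<^bsub>M\<^esub> d') = (a \<oplus>\<^bsub>M\<^esub> d) \<ominus>\<^bsub>M\<^esub> (a' \<oplus>\<^bsub>M\<^esub> d')"
    if "a \<in> carrier M" "a' \<in> carrier M" "d \<in> carrier M" "d' \<in> carrier M" for a a' d d'
    using that by (simp add: a_minus_def M.minus_add M.a_ac)
  ultimately show ?case
    unfolding L using IH cl g W bk by (simp add: p ev g_def[symmetric])
qed

end

text \<open>Induction on the number of relations.  Write \<open>f(\<alpha>) = b k + U\<close> (up to \<open>v\<close>), where \<open>U\<close> collects the other
  relations, and let \<open>\<phi>\<close> be the functional for which \<open>\<phi>(k) = g\<close> is an idempotent absorbing the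
  entries of \<open>k\<close>.  Applying \<open>\<phi>\<close> gives \<open>g b = f(\<phi>(\<alpha>)) - \<phi>(U)\<close>, hence
  \<open>b k = g b k = f(\<phi>(\<alpha>)) k - \<phi>(U) k\<close>, again up to \<open>v\<close>.  So \<open>\<alpha> - \<phi>(\<alpha>) k\<close> is mapped to
  \<open>U - \<phi>(U) k\<close>, which involves one relation less and still only vectors from \<open>K\<close>.  When no relation
  is left, \<open>v \<alpha>\<close> has entries in the kernel of \<open>f\<close> and \<open>t\<close> kills it.\<close>

lemma eliminate_relations:
  fixes R :: "('a, 'r) ring_scheme" (structure)
    and A :: "('a, 'm) module" and B :: "('a, 'n) module" and X :: "'x set"
  assumes A: "module R A" and B: "module R B" and f: "f \<in> mod_hom R A B"
    and t: "t \<in> carrier R" "\<And>a. a \<in> carrier A \<Longrightarrow> f a = \<zero>\<^bsub>B\<^esub> \<Longrightarrow> t \<odot>\<^bsub>A\<^esub> a = \<zero>\<^bsub>A\<^esub>"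
    and v: "v \<in> carrier R" and abs: "idempotent_absorbing R v TYPE('x)"
    and K: "submodule K R (free_mod R X)"
    and "set ks \<subseteq> carrier B \<times> K" "\<And>x. x \<in> X \<Longrightarrow> \<alpha> x \<in> carrier A"
    and "\<And>x. x \<in> X \<Longrightarrow> v \<odot>\<^bsub>B\<^esub> f (\<alpha> x) = v \<odot>\<^bsub>B\<^esub> rel_sum B ks x"
  shows "\<exists>ls. set ls \<subseteq> carrier A \<times> K \<and>
    (\<forall>x\<in>X. (t \<otimes> v) \<odot>\<^bsub>A\<^esub> \<alpha> x = (t \<otimes> v) \<odot>\<^bsub>A\<^esub> rel_sum A ls x)"
  using assms(9-)
proof (induction "length ks" arbitrary: ks \<alpha>)
  case 0
  interpret A: module R A by (rule A)
  interpret B: module R B by (rule B)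
  have "(t \<otimes> v) \<odot>\<^bsub>A\<^esub> \<alpha> x = \<zero>\<^bsub>A\<^esub>" if x: "x \<in> X" for x
  proof -
    have "f (v \<odot>\<^bsub>A\<^esub> \<alpha> x) = \<zero>\<^bsub>B\<^esub>" using 0 x v by (simp add: mod_homD[OF f])
    then show ?thesis using t 0 x v by (simp add: A.smult_assoc1)
  qed
  then show ?case using t v by (intro exI[of _ "[]"]) auto
next
  case (Suc n)
  interpret A: module R A by (rule A)
  interpret B: module R B by (rule B)
  interpret F: module R "free_mod R X" by (rule free_mod_module[OF A.R.is_cring])
  interpret G: module R "reg_mod R" by (rule reg_mod_module[OF A.R.is_cring])
  obtain b k ks1 where ks: "ks = (b, k) # ks1" and n: "n = length ks1"
    using Suc.hyps(2) by (cases ks) auto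
  have KX: "K \<subseteq> carrier (free_mod R X)" using K[unfolded F.submodule_iff] by blast
  have b: "b \<in> carrier B" and k: "k \<in> K" and ks1: "set ks1 \<subseteq> carrier B \<times> K"
    using Suc.prems(1) by (auto simp: ks)
  have kF: "k \<in> carrier (free_mod R X)" and ks1F: "set ks1 \<subseteq> carrier B \<times> carrier (free_mod R X)"
    using k ks1 KX by auto
  note co [simp] = free_mod_coeff[OF A.R.is_cring kF]
  define Y where "Y = {x. k x \<noteq> \<zero>}"
  have Y: "finite Y" "Y \<subseteq> X" using free_mod_supp[OF A.R.is_cring kF] by (auto simp: Y_def)
  obtain c where c: "c \<in> Y \<rightarrow> carrier R"
    and cY: "\<And>y. y \<in> Y \<Longrightarrow> v \<otimes> (lin_comb (reg_mod R) Y c k \<otimes> k y) = v \<otimes> k y"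
    using abs[unfolded idempotent_absorbing_def Let_def, rule_format, of Y k] Y(1) by auto
  define g where "g = lin_comb (reg_mod R) Y c k"
  have g: "g \<in> carrier R"
    unfolding g_def using lin_comb_closed[OF G.module_axioms c, of k] by auto
  have gk: "v \<otimes> (g \<otimes> k x) = v \<otimes> k x" for x
    using cY[of x] g v by (cases "x \<in> Y") (auto simp: Y_def g_def)
  define a where "a = lin_comb A Y c \<alpha>"
  have \<alpha>Y: "\<alpha> \<in> Y \<rightarrow> carrier A" using Suc.prems(2) Y by auto
  have a: "a \<in> carrier A" unfolding a_def by (rule lin_comb_closed[OF A c \<alpha>Y])
  define U where "U = rel_sum B ks1"
  have U: "U x \<in> carrier B" for x unfolding U_def by (rule rel_sum_closed[OF B ks1F])
  define W where "W = lin_comb B Y c U"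
  have W: "W \<in> carrier B" unfolding W_def by (rule lin_comb_closed[OF B c]) (use U in auto)
  have vf: "v \<odot>\<^bsub>B\<^esub> f (\<alpha> x) = v \<odot>\<^bsub>B\<^esub> (k x \<odot>\<^bsub>B\<^esub> b \<oplus>\<^bsub>B\<^esub> U x)" if "x \<in> X" for x
    using Suc.prems(3)[OF that] by (simp add: ks U_def)
  have va: "v \<odot>\<^bsub>B\<^esub> f a = v \<odot>\<^bsub>B\<^esub> (g \<odot>\<^bsub>B\<^esub> b \<oplus>\<^bsub>B\<^esub> W)"
  proof -
    note L = lin_comb_hom[OF B B smult_hom[OF B v] Y(1) c]
    have fY: "(\<lambda>y. f (\<alpha> y)) \<in> Y \<rightarrow> carrier B" using \<alpha>Y mod_homD(1)[OF f] by auto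
    have "v \<odot>\<^bsub>B\<^esub> f a = lin_comb B Y c (\<lambda>y. v \<odot>\<^bsub>B\<^esub> f (\<alpha> y))"
      unfolding a_def lin_comb_hom[OF A B f Y(1) c \<alpha>Y] by (rule L[OF fY])
    also have "\<dots> = lin_comb B Y c (\<lambda>y. v \<odot>\<^bsub>B\<^esub> (k y \<odot>\<^bsub>B\<^esub> b \<oplus>\<^bsub>B\<^esub> U y))"
      by (rule lin_comb_cong[OF B c]) (use vf Y v b U in auto)
    also have "\<dots> = v \<odot>\<^bsub>B\<^esub> lin_comb B Y c (\<lambda>y. k y \<odot>\<^bsub>B\<^esub> b \<oplus>\<^bsub>B\<^esub> U y)"
      by (rule L[symmetric]) (use b U in auto)
    also have "lin_comb B Y c (\<lambda>y. k y \<odot>\<^bsub>B\<^esub> b \<oplus>\<^bsub>B\<^esub> U y) = lin_comb B Y c (\<lambda>y. k y \<odot>\<^bsub>B\<^esub> b) \<oplus>\<^bsub>B\<^esub> W"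
      unfolding W_def by (rule lin_comb_add[OF B c]) (use b U in auto)
    also have "lin_comb B Y c (\<lambda>y. k y \<odot>\<^bsub>B\<^esub> b) = g \<odot>\<^bsub>B\<^esub> b"
      unfolding g_def by (rule lin_comb_hom[OF G.module_axioms B scalar_hom[OF B b] Y(1) c, symmetric]) auto
    finally show ?thesis .
  qed
  \<comment> \<open>Subtracting \<open>k x \<odot> a\<close> removes the relation \<open>k\<close>, at the price of changing the others.\<close>
  let ?\<alpha> = "\<lambda>x. \<alpha> x \<ominus>\<^bsub>A\<^esub> k x \<odot>\<^bsub>A\<^esub> a"
  let ?ks = "map (\<lambda>(b, k'). (b, k' \<ominus>\<^bsub>free_mod R X\<^esub> lin_comb (reg_mod R) Y c k' \<odot>\<^bsub>free_mod R X\<^esub> k)) ks1"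
  have gcl: "lin_comb (reg_mod R) Y c k' \<in> carrier R" if "k' \<in> K" for k'
    using lin_comb_closed[OF G.module_axioms c, of k'] free_mod_coeff[OF A.R.is_cring, of k' X] KX that by auto
  have "\<exists>ls. set ls \<subseteq> carrier A \<times> K \<and>
    (\<forall>x\<in>X. (t \<otimes> v) \<odot>\<^bsub>A\<^esub> ?\<alpha> x = (t \<otimes> v) \<odot>\<^bsub>A\<^esub> rel_sum A ls x)"
  proof (rule Suc.hyps(1))
    show "n = length ?ks" by (simp add: n)
    have "k' \<ominus>\<^bsub>free_mod R X\<^esub> lin_comb (reg_mod R) Y c k' \<odot>\<^bsub>free_mod R X\<^esub> k \<in> K" if "k' \<in> K" for k'
      by (rule F.submodule_minus[OF K that]) (rule submodule.smult_closed[OF K gcl[OF that] k])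
    then show "set ?ks \<subseteq> carrier B \<times> K" using ks1 by auto
    show "?\<alpha> x \<in> carrier A" if "x \<in> X" for x using Suc.prems(2)[OF that] a by simp
    show "v \<odot>\<^bsub>B\<^esub> f (?\<alpha> x) = v \<odot>\<^bsub>B\<^esub> rel_sum B ?ks x" if x: "x \<in> X" for x
    proof -
      have fx: "f (\<alpha> x) \<in> carrier B" "f a \<in> carrier B"
        using Suc.prems(2)[OF x] a mod_homD(1)[OF f] by auto
      have "f (?\<alpha> x) = f (\<alpha> x) \<ominus>\<^bsub>B\<^esub> k x \<odot>\<^bsub>B\<^esub> f a"
        using mod_hom_minus[OF A B f Suc.prems(2)[OF x], of "k x \<odot>\<^bsub>A\<^esub> a"] a by (simp add: mod_homD[OF f])
      then have "v \<odot>\<^bsub>B\<^esub> f (?\<alpha> x) = v \<odot>\<^bsub>B\<^esub> f (\<alpha> x) \<ominus>\<^bsub>B\<^esub> v \<odot>\<^bsub>B\<^esub> (k x \<odot>\<^bsub>B\<^esub> f a)"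
        using fx v by (simp add: smult_minus[OF B])
      also have "v \<odot>\<^bsub>B\<^esub> (k x \<odot>\<^bsub>B\<^esub> f a) = k x \<odot>\<^bsub>B\<^esub> (v \<odot>\<^bsub>B\<^esub> f a)"
        using fx v by (simp add: B.smult_assoc1[symmetric] A.R.m_comm)
      also have "\<dots> = (v \<otimes> (g \<otimes> k x)) \<odot>\<^bsub>B\<^esub> b \<oplus>\<^bsub>B\<^esub> v \<odot>\<^bsub>B\<^esub> (k x \<odot>\<^bsub>B\<^esub> W)"
        unfolding va using g v b W
        by (simp add: B.smult_r_distr B.smult_assoc1[symmetric] A.R.m_ac)
      also have "\<dots> = v \<odot>\<^bsub>B\<^esub> (k x \<odot>\<^bsub>B\<^esub> b) \<oplus>\<^bsub>B\<^esub> v \<odot>\<^bsub>B\<^esub> (k x \<odot>\<^bsub>B\<^esub> W)"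
        unfolding gk using v b by (simp add: B.smult_assoc1)
      also have "v \<odot>\<^bsub>B\<^esub> f (\<alpha> x) = v \<odot>\<^bsub>B\<^esub> (k x \<odot>\<^bsub>B\<^esub> b) \<oplus>\<^bsub>B\<^esub> v \<odot>\<^bsub>B\<^esub> U x"
        unfolding vf[OF x] using v b U by (simp add: B.smult_r_distr)
      finally have "v \<odot>\<^bsub>B\<^esub> f (?\<alpha> x) = v \<odot>\<^bsub>B\<^esub> U x \<ominus>\<^bsub>B\<^esub> v \<odot>\<^bsub>B\<^esub> (k x \<odot>\<^bsub>B\<^esub> W)"
        using v b U W by (simp add: add_minus_cancel[OF B])
      also have "\<dots> = v \<odot>\<^bsub>B\<^esub> (U x \<ominus>\<^bsub>B\<^esub> k x \<odot>\<^bsub>B\<^esub> W)"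
        using v U W by (simp add: smult_minus[OF B])
      also have "U x \<ominus>\<^bsub>B\<^esub> k x \<odot>\<^bsub>B\<^esub> W = rel_sum B ?ks x"
        unfolding U_def W_def by (rule rel_sum_eliminate[OF B ks1F kF Y(1) c, symmetric])
      finally show ?thesis .
    qed
  qed
  then obtain ls where ls: "set ls \<subseteq> carrier A \<times> K"
    and lsx: "\<And>x. x \<in> X \<Longrightarrow> (t \<otimes> v) \<odot>\<^bsub>A\<^esub> ?\<alpha> x = (t \<otimes> v) \<odot>\<^bsub>A\<^esub> rel_sum A ls x" by blast
  have "(t \<otimes> v) \<odot>\<^bsub>A\<^esub> \<alpha> x = (t \<otimes> v) \<odot>\<^bsub>A\<^esub> rel_sum A ((a, k) # ls) x" if x: "x \<in> X" for x
  proof -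
    have l: "rel_sum A ls x \<in> carrier A" by (rule rel_sum_closed[OF A, of _ X]) (use ls KX in auto)
    have "\<alpha> x = k x \<odot>\<^bsub>A\<^esub> a \<oplus>\<^bsub>A\<^esub> ?\<alpha> x"
      using Suc.prems(2)[OF x] a by (simp add: a_minus_def A.a_lcomm A.r_neg)
    then have "(t \<otimes> v) \<odot>\<^bsub>A\<^esub> \<alpha> x = (t \<otimes> v) \<odot>\<^bsub>A\<^esub> (k x \<odot>\<^bsub>A\<^esub> a) \<oplus>\<^bsub>A\<^esub> (t \<otimes> v) \<odot>\<^bsub>A\<^esub> ?\<alpha> x"
      using A.smult_r_distr[of "t \<otimes> v" "k x \<odot>\<^bsub>A\<^esub> a" "?\<alpha> x"] Suc.prems(2)[OF x] a t v by simp
    also have "\<dots> = (t \<otimes> v) \<odot>\<^bsub>A\<^esub> (k x \<odot>\<^bsub>A\<^esub> a \<oplus>\<^bsub>A\<^esub> rel_sum A ls x)"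
      unfolding lsx[OF x] using l a t v by (simp add: A.smult_r_distr)
    finally show ?thesis by simp
  qed
  then show ?case using ls a k by (intro exI[of _ "(a, k) # ls"]) auto
qed

section \<open>Kernels of tensored homomorphisms\<close>

text \<open>The coordinate at \<open>y\<close> of a representative of a tensor, under the identification of \<open>M \<otimes> F\<close>, for \<open>F\<close>
  free on the elements of \<open>N\<close>, with the finitely supported vectors with entries in \<open>M\<close>.\<close>

definition tensor_coord :: "('a, 'r) ring_scheme \<Rightarrow> ('a, 'm) module \<Rightarrow> 'n \<Rightarrow> ('m \<times> 'n \<Rightarrow> 'a) \<Rightarrow> 'm" where
  "tensor_coord R M y = free_lift R M (\<lambda>(x, y'). if y' = y then x else \<zero>\<^bsub>M\<^esub>)"

context
  fixes R :: "('a, 'r) ring_scheme" (structure) and M :: "('a, 'm) module" and N :: "('a, 'n) module"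
  assumes M: "module R M" and N: "module R N"
begin

interpretation M: module R M by (rule M)
interpretation N: module R N by (rule N)
interpretation F: module R "tensor_free R M N"
  unfolding tensor_free_def by (rule free_mod_module[OF M.R.is_cring])
interpretation F0: module R "res_F0 R N"
  unfolding res_F0_def by (rule free_mod_module[OF M.R.is_cring])
interpretation T: module R "tensor R M N" by (rule tensor_module[OF M N])

lemma tensor_coord_hom: "tensor_coord R M y \<in> mod_hom R (tensor_free R M N) M"
  unfolding tensor_coord_def tensor_free_def
  by (rule free_lift_hom[OF M.R.is_cring M]) auto

lemma tensor_coord_basis:
  assumes "x \<in> carrier M" "y' \<in> carrier N"
  shows "tensor_coord R M y (free_basis R (x, y')) = (if y' = y then x else \<zero>\<^bsub>M\<^esub>)"
  unfolding tensor_coord_def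
  using free_lift_basis[OF M.R.is_cring M, of "(x, y')" "carrier M \<times> carrier N"] assms by auto

lemma res_K0_iff:
  "k \<in> res_K0 R N \<longleftrightarrow> k \<in> carrier (free_mod R (carrier N)) \<and> free_lift R N (\<lambda>y. y) k = \<zero>\<^bsub>N\<^esub>"
  by (simp add: res_K0_def mem_a_kernel res_F0_def)

lemma res_aug_hom: "free_lift R N (\<lambda>y. y) \<in> mod_hom R (res_F0 R N) N"
  unfolding res_F0_def by (rule free_lift_hom[OF M.R.is_cring N])

lemma res_aug_basis: "y \<in> carrier N \<Longrightarrow> free_lift R N (\<lambda>y. y) (free_basis R y) = y"
  by (rule free_lift_basis[OF M.R.is_cring N])

lemma res_basis_closed: "y \<in> carrier N \<Longrightarrow> free_basis R y \<in> carrier (res_F0 R N)"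
  unfolding res_F0_def by (rule free_basis_closed[OF M.R.is_cring])

lemma res_K0_submodule: "submodule (res_K0 R N) R (res_F0 R N)"
  unfolding res_K0_def by (rule mod_hom_kernel_submodule[OF F0.module_axioms N res_aug_hom])

text \<open>Presenting \<open>N\<close> by the free module on its elements, \<open>M \<otimes> N\<close> becomes the module of vectors modulo
  \<open>M\<close>-combinations of relations of \<open>N\<close>.  Of the tensor relations, those in the first variable have zero coordinates,
  and those in the second variable give one relation of \<open>N\<close> each.\<close>

lemma tensor_rel_coords:
  assumes h: "h \<in> tensor_rel R M N"
  shows "\<exists>ks. set ks \<subseteq> carrier M \<times> res_K0 R N \<and>
    (\<forall>y\<in>carrier N. tensor_coord R M y h = rel_sum M ks y)"
proof -
  let ?P = "\<lambda>h. \<exists>ks. set ks \<subseteq> carrier M \<times> res_K0 R N \<and>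
    (\<forall>y\<in>carrier N. tensor_coord R M y h = rel_sum M ks y)"
  let ?F = "tensor_free R M N" and ?E = "res_F0 R N"
  note C = mod_homD[OF tensor_coord_hom]
  note Cm = mod_hom_minus[OF F.module_axioms M tensor_coord_hom]
  have KF: "res_K0 R N \<subseteq> carrier (free_mod R (carrier N))" by (auto simp: res_K0_iff)
  have D: "submodule {h \<in> carrier ?F. ?P h} R ?F"
    unfolding F.submodule_iff
  proof (intro conjI ballI)
    have "?P \<zero>\<^bsub>?F\<^esub>"
      using mod_hom_zero[OF F.module_axioms M tensor_coord_hom] by (intro exI[of _ "[]"]) auto
    then show "\<zero>\<^bsub>?F\<^esub> \<in> {h \<in> carrier ?F. ?P h}" by blast
  next
    fix h h' assume h: "h \<in> {h \<in> carrier ?F. ?P h}" and h': "h' \<in> {h \<in> carrier ?F. ?P h}"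
    then obtain ks ks' where ks: "set ks \<subseteq> carrier M \<times> res_K0 R N"
        "\<And>y. y \<in> carrier N \<Longrightarrow> tensor_coord R M y h = rel_sum M ks y"
      and ks': "set ks' \<subseteq> carrier M \<times> res_K0 R N"
        "\<And>y. y \<in> carrier N \<Longrightarrow> tensor_coord R M y h' = rel_sum M ks' y" by blast
    have "set ks \<union> set ks' \<subseteq> carrier M \<times> carrier (free_mod R (carrier N))" using ks(1) ks'(1) KF by blast
    then have "?P (h \<oplus>\<^bsub>?F\<^esub> h')"
      using h h' ks ks' by (intro exI[of _ "ks @ ks'"]) (auto simp: C rel_sum_append[OF M])
    then show "h \<oplus>\<^bsub>?F\<^esub> h' \<in> {h \<in> carrier ?F. ?P h}" using h h' by auto
  next
    fix r h assume r: "r \<in> carrier R" and h: "h \<in> {h \<in> carrier ?F. ?P h}"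
    then obtain ks where ks: "set ks \<subseteq> carrier M \<times> res_K0 R N"
        "\<And>y. y \<in> carrier N \<Longrightarrow> tensor_coord R M y h = rel_sum M ks y" by blast
    have "set ks \<subseteq> carrier M \<times> carrier (free_mod R (carrier N))" using ks(1) KF by blast
    then have "?P (r \<odot>\<^bsub>?F\<^esub> h)"
      using h ks r
      by (intro exI[of _ "map (\<lambda>(b, k). (r \<odot>\<^bsub>M\<^esub> b, k)) ks"])
        (auto simp: C rel_sum_smult[OF M, OF _ r])
    then show "r \<odot>\<^bsub>?F\<^esub> h \<in> {h \<in> carrier ?F. ?P h}" using h r by auto
  qed auto
  note [simp] = tensor_basis_closed[OF M N] C Cm tensor_coord_basis M.minus_eq_zero_iff
    M.minus_right_zero res_basis_closed
  have ev: "(\<lambda>k. k y \<odot>\<^bsub>M\<^esub> x) \<in> mod_hom R ?E M" if "x \<in> carrier M" for x y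
    unfolding res_F0_def
    using mod_hom_comp[OF coeff_hom[OF M.R.is_cring] scalar_hom[OF M that]] .
  have eb: "free_basis R y' y \<odot>\<^bsub>M\<^esub> x = (if y' = y then x else \<zero>\<^bsub>M\<^esub>)" if "x \<in> carrier M" for x y y'
    using that by (simp add: free_basis_def)
  note E = mod_homD[OF ev] mod_hom_minus[OF F0.module_axioms M ev]
  note Kmin = mod_hom_minus[OF F0.module_axioms N res_aug_hom]
  have K: "k \<in> res_K0 R N" if "k \<in> carrier ?E" "free_lift R N (\<lambda>y. y) k = \<zero>\<^bsub>N\<^esub>" for k
    using that by (simp add: res_K0_iff res_F0_def)
  have single: "?P h" if "x \<in> carrier M" "k \<in> res_K0 R N"
      "\<And>y. y \<in> carrier N \<Longrightarrow> tensor_coord R M y h = k y \<odot>\<^bsub>M\<^esub> x" for h x k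
    using that KF free_mod_coeff[OF M.R.is_cring, of k "carrier N"]
    by (intro exI[of _ "[(x, k)]"]) auto
  have "h \<in> {h \<in> carrier ?F. ?P h}"
  proof (rule tensor_rel_induct[OF M N h D])
    fix x x' y assume "x \<in> carrier M" "x' \<in> carrier M" "y \<in> carrier N"
    then show "free_basis R (x \<oplus>\<^bsub>M\<^esub> x', y) \<ominus>\<^bsub>?F\<^esub> (free_basis R (x, y) \<oplus>\<^bsub>?F\<^esub> free_basis R (x', y))
       \<in> {h \<in> carrier ?F. ?P h}"
      by (auto intro!: exI[of _ "[]"])
  next
    fix x y y' assume a: "x \<in> carrier M" "y \<in> carrier N" "y' \<in> carrier N"
    have "?P (free_basis R (x, y \<oplus>\<^bsub>N\<^esub> y') \<ominus>\<^bsub>?F\<^esub> (free_basis R (x, y) \<oplus>\<^bsub>?F\<^esub> free_basis R (x, y')))"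
    proof (rule single[OF a(1)])
      show "free_basis R (y \<oplus>\<^bsub>N\<^esub> y') \<ominus>\<^bsub>?E\<^esub> (free_basis R y \<oplus>\<^bsub>?E\<^esub> free_basis R y') \<in> res_K0 R N"
        by (rule K) (use a in \<open>simp_all add: Kmin mod_homD[OF res_aug_hom] res_aug_basis N.minus_eq_zero_iff\<close>)
    qed (use a in \<open>simp add: E eb\<close>)
    then show "free_basis R (x, y \<oplus>\<^bsub>N\<^esub> y') \<ominus>\<^bsub>?F\<^esub> (free_basis R (x, y) \<oplus>\<^bsub>?F\<^esub> free_basis R (x, y'))
       \<in> {h \<in> carrier ?F. ?P h}"
      using a by simp
  next
    fix r x y assume "r \<in> carrier R" "x \<in> carrier M" "y \<in> carrier N"
    then show "free_basis R (r \<odot>\<^bsub>M\<^esub> x, y) \<ominus>\<^bsub>?F\<^esub> (r \<odot>\<^bsub>?F\<^esub> free_basis R (x, y)) \<in> {h \<in> carrier ?F. ?P h}"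
      by (auto intro!: exI[of _ "[]"])
  next
    fix r x y assume a: "r \<in> carrier R" "x \<in> carrier M" "y \<in> carrier N"
    have "?P (free_basis R (x, r \<odot>\<^bsub>N\<^esub> y) \<ominus>\<^bsub>?F\<^esub> (r \<odot>\<^bsub>?F\<^esub> free_basis R (x, y)))"
    proof (rule single[OF a(2)])
      show "free_basis R (r \<odot>\<^bsub>N\<^esub> y) \<ominus>\<^bsub>?E\<^esub> (r \<odot>\<^bsub>?E\<^esub> free_basis R y) \<in> res_K0 R N"
        by (rule K) (use a in \<open>simp_all add: Kmin mod_homD[OF res_aug_hom] res_aug_basis N.minus_eq_zero_iff\<close>)
    qed (use a in \<open>simp add: E eb\<close>)
    then show "free_basis R (x, r \<odot>\<^bsub>N\<^esub> y) \<ominus>\<^bsub>?F\<^esub> (r \<odot>\<^bsub>?F\<^esub> free_basis R (x, y)) \<in> {h \<in> carrier ?F. ?P h}"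
      using a by simp
  qed
  then show ?thesis by blast
qed

text \<open>The tensor is recovered from its coordinates.  The index set may be any sufficiently large finite
  set, since it will have to contain the supports of several relations at the same time.\<close>

lemma tensor_recombine:
  assumes h: "h \<in> carrier (tensor_free R M N)"
  shows "\<exists>Y0. finite Y0 \<and> Y0 \<subseteq> carrier N \<and> (\<forall>Y. finite Y \<longrightarrow> Y0 \<subseteq> Y \<longrightarrow> Y \<subseteq> carrier N \<longrightarrow>
     tensor_class R M N h =
     (\<Oplus>\<^bsub>tensor R M N\<^esub>y\<in>Y. pure_tensor R M N (tensor_coord R M y h) y))"
  using h unfolding tensor_free_def
proof (induction rule: free_mod_induct[OF M.R.is_cring, consumes 1, case_names zero add])
  case zero
  let ?T = "tensor R M N" and ?F = "tensor_free R M N" and ?p = "pure_tensor R M N" and ?cl = "tensor_class R M N"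
  note p0 = pure_tensor_zero(1)[OF M N]
  have "(\<Oplus>\<^bsub>?T\<^esub>y\<in>Y. ?p (tensor_coord R M y \<zero>\<^bsub>?F\<^esub>) y) = \<zero>\<^bsub>?T\<^esub>"
    if "Y \<subseteq> carrier N" for Y
    by (rule T.add.finprod_one_eqI)
      (use that p0 mod_hom_zero[OF F.module_axioms M tensor_coord_hom] in auto)
  then show ?case
    unfolding tensor_free_def[symmetric]
    using mod_hom_zero[OF F.module_axioms T.module_axioms tensor_cls_hom[OF M N]]
    by (intro exI[of _ "{}"]) auto
next
  case (add k r p)
  let ?T = "tensor R M N" and ?F = "tensor_free R M N" and ?p = "pure_tensor R M N" and ?cl = "tensor_class R M N"
  obtain x y0 where p: "p = (x, y0)" and xy: "x \<in> carrier M" "y0 \<in> carrier N" using add.hyps(3) by blast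
  note p0 = pure_tensor_zero(1)[OF M N]
  have k: "k \<in> carrier (tensor_free R M N)" using add.hyps(1) by (simp add: tensor_free_def)
  obtain Y0 where Y0: "finite Y0" "Y0 \<subseteq> carrier N"
    and IH: "\<And>Y. finite Y \<Longrightarrow> Y0 \<subseteq> Y \<Longrightarrow> Y \<subseteq> carrier N \<Longrightarrow>
     ?cl k = (\<Oplus>\<^bsub>?T\<^esub>y\<in>Y. ?p (tensor_coord R M y k) y)"
    using add.IH unfolding tensor_free_def[symmetric] by blast
  have r: "r \<in> carrier R" by fact
  let ?h = "k \<oplus>\<^bsub>?F\<^esub> r \<odot>\<^bsub>?F\<^esub> free_basis R p"
  have "?cl ?h = (\<Oplus>\<^bsub>?T\<^esub>y\<in>Y. ?p (tensor_coord R M y ?h) y)"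
    if Y: "finite Y" "insert y0 Y0 \<subseteq> Y" "Y \<subseteq> carrier N" for Y
  proof -
    have ck: "tensor_coord R M y k \<in> carrier M" for y by (rule mod_homD(1)[OF tensor_coord_hom k])
    have "(\<Oplus>\<^bsub>?T\<^esub>y\<in>Y. ?p (tensor_coord R M y ?h) y) =
      (\<Oplus>\<^bsub>?T\<^esub>y\<in>Y. ?p (tensor_coord R M y k) y \<oplus>\<^bsub>?T\<^esub>
          (if y0 = y then ?p (r \<odot>\<^bsub>M\<^esub> x) y else \<zero>\<^bsub>?T\<^esub>))"
    proof (rule T.finsum_cong')
      fix y assume "y \<in> Y"
      then have y: "y \<in> carrier N" using Y by blast
      have "tensor_coord R M y ?h = tensor_coord R M y k \<oplus>\<^bsub>M\<^esub> (if y0 = y then r \<odot>\<^bsub>M\<^esub> x else \<zero>\<^bsub>M\<^esub>)"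
        using k r xy tensor_basis_closed[OF M N xy]
        by (simp add: mod_homD[OF tensor_coord_hom] p tensor_coord_basis)
      then show "?p (tensor_coord R M y ?h) y =
          ?p (tensor_coord R M y k) y \<oplus>\<^bsub>?T\<^esub>
          (if y0 = y then ?p (r \<odot>\<^bsub>M\<^esub> x) y else \<zero>\<^bsub>?T\<^esub>)"
        using y r xy ck by (simp add: pure_tensor_eqs(1)[OF M N] p0)
    qed (use Y ck r xy pure_tensor_closed[OF M N] in auto)
    also have "\<dots> = (\<Oplus>\<^bsub>?T\<^esub>y\<in>Y. ?p (tensor_coord R M y k) y) \<oplus>\<^bsub>?T\<^esub>
       (\<Oplus>\<^bsub>?T\<^esub>y\<in>Y. if y0 = y then ?p (r \<odot>\<^bsub>M\<^esub> x) y else \<zero>\<^bsub>?T\<^esub>)"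
      using Y ck r xy pure_tensor_closed[OF M N] by (intro T.finsum_addf) auto
    also have "(\<Oplus>\<^bsub>?T\<^esub>y\<in>Y. if y0 = y then ?p (r \<odot>\<^bsub>M\<^esub> x) y else \<zero>\<^bsub>?T\<^esub>)
       = ?p (r \<odot>\<^bsub>M\<^esub> x) y0"
      using Y r xy pure_tensor_closed[OF M N] by (intro T.finsum_singleton) auto
    also have "(\<Oplus>\<^bsub>?T\<^esub>y\<in>Y. ?p (tensor_coord R M y k) y) =
        ?cl k"
      using IH Y by simp
    also have "?cl k \<oplus>\<^bsub>?T\<^esub> ?p (r \<odot>\<^bsub>M\<^esub> x) y0 =
        ?cl ?h"
      using k r xy tensor_basis_closed[OF M N xy]
      by (simp add: mod_homD[OF tensor_cls_hom[OF M N]] pure_tensor_eqs[OF M N] p) (simp add: pure_tensor_def)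
    finally show ?thesis by simp
  qed
  then show ?case
    unfolding tensor_free_def[symmetric]
    using Y0 xy by (intro exI[of _ "insert y0 Y0"]) auto
qed

lemma tensor_rel_sum_zero:
  assumes "set ls \<subseteq> carrier M \<times> res_K0 R N" "finite Y" "Y \<subseteq> carrier N"
    "\<And>b k. (b, k) \<in> set ls \<Longrightarrow> {y. k y \<noteq> \<zero>} \<subseteq> Y"
  shows "(\<Oplus>\<^bsub>tensor R M N\<^esub>y\<in>Y. pure_tensor R M N (rel_sum M ls y) y) = \<zero>\<^bsub>tensor R M N\<^esub>"
  using assms
proof (induction ls)
  case Nil
  let ?T = "tensor R M N" and ?F = "tensor_free R M N" and ?p = "pure_tensor R M N" and ?cl = "tensor_class R M N"
  note p0 = pure_tensor_zero(1)[OF M N]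
  show ?case by (rule T.add.finprod_one_eqI) (use Nil p0 in auto)
next
  case (Cons p ls)
  let ?T = "tensor R M N" and ?F = "tensor_free R M N" and ?p = "pure_tensor R M N" and ?cl = "tensor_class R M N"
  obtain a k where p: "p = (a, k)" by force
  have a: "a \<in> carrier M" and k: "k \<in> res_K0 R N" and ls: "set ls \<subseteq> carrier M \<times> res_K0 R N"
    using Cons.prems(1) by (auto simp: p)
  have KF: "res_K0 R N \<subseteq> carrier (free_mod R (carrier N))" by (auto simp: res_K0_iff)
  have kF: "k \<in> carrier (free_mod R (carrier N))" using k KF by blast
  note co = free_mod_coeff[OF M.R.is_cring kF]
  have l: "rel_sum M ls y \<in> carrier M" for y
    by (rule rel_sum_closed[OF M, of _ "carrier N"]) (use ls KF in auto)
  have Y: "finite Y" "Y \<subseteq> carrier N" by fact+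
  have "(\<Oplus>\<^bsub>?T\<^esub>y\<in>Y. ?p (rel_sum M (p # ls) y) y) =
    (\<Oplus>\<^bsub>?T\<^esub>y\<in>Y. ?p a (k y \<odot>\<^bsub>N\<^esub> y) \<oplus>\<^bsub>?T\<^esub> ?p (rel_sum M ls y) y)"
  proof (rule T.finsum_cong')
    fix y assume "y \<in> Y"
    then have "y \<in> carrier N" using Y by blast
    then show "?p (rel_sum M (p # ls) y) y =
        ?p a (k y \<odot>\<^bsub>N\<^esub> y) \<oplus>\<^bsub>?T\<^esub> ?p (rel_sum M ls y) y"
      using a co l by (simp add: p pure_tensor_eqs[OF M N])
  qed (use Y a co l pure_tensor_closed[OF M N] in auto)
  also have "\<dots> = (\<Oplus>\<^bsub>?T\<^esub>y\<in>Y. ?p a (k y \<odot>\<^bsub>N\<^esub> y)) \<oplus>\<^bsub>?T\<^esub>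
     (\<Oplus>\<^bsub>?T\<^esub>y\<in>Y. ?p (rel_sum M ls y) y)"
    using Y a co l pure_tensor_closed[OF M N] by (intro T.finsum_addf) auto
  also have "(\<Oplus>\<^bsub>?T\<^esub>y\<in>Y. ?p (rel_sum M ls y) y) = \<zero>\<^bsub>?T\<^esub>"
    using Cons.IH[OF ls Y] Cons.prems(4) by auto
  also have "(\<Oplus>\<^bsub>?T\<^esub>y\<in>Y. ?p a (k y \<odot>\<^bsub>N\<^esub> y)) =
      ?p a (\<Oplus>\<^bsub>N\<^esub>y\<in>Y. k y \<odot>\<^bsub>N\<^esub> y)"
    using pure_tensor_bilinear[OF M N] a Y co
    by (intro mod_hom_finsum[OF N T.module_axioms, symmetric]) (auto simp: bilinear_map_def)
  also have "(\<Oplus>\<^bsub>N\<^esub>y\<in>Y. k y \<odot>\<^bsub>N\<^esub> y) = free_lift R N (\<lambda>y. y) k"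
    using free_lift_superset[OF M.R.is_cring N _ kF Y(1) _ Y(2), of "\<lambda>y. y"] Cons.prems(4)[of a k] by (simp add: p)
  also have "\<dots> = \<zero>\<^bsub>N\<^esub>" using k by (simp add: res_K0_iff)
  also have "?p a \<zero>\<^bsub>N\<^esub> = \<zero>\<^bsub>?T\<^esub>"
    by (rule pure_tensor_zero(2)[OF M N a])
  finally show ?case by simp
qed

end

text \<open>The coordinates of a representative of \<open>z\<close> are mapped by \<open>f\<close> to a combination of relations of \<open>F\<close>;
  after elimination they are, up to \<open>t v\<close>, a combination of relations of \<open>F\<close> with coefficients in \<open>A\<close>,
  and such a combination represents zero.\<close>

theorem tensor_map_kernel:
  fixes R :: "('a, 'r) ring_scheme" (structure)
    and A :: "('a, 'm) module" and B :: "('a, 'k) module" and F :: "('a, 'n) module"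
  assumes A: "module R A" and B: "module R B" and F: "module R F" and f: "f \<in> mod_hom R A B"
    and t: "t \<in> carrier R" "\<And>a. a \<in> carrier A \<Longrightarrow> f a = \<zero>\<^bsub>B\<^esub> \<Longrightarrow> t \<odot>\<^bsub>A\<^esub> a = \<zero>\<^bsub>A\<^esub>"
    and v: "v \<in> carrier R" and abs: "idempotent_absorbing R v TYPE('n)"
    and z: "z \<in> carrier (tensor R A F)" "tensor_map R A B F f z = \<zero>\<^bsub>tensor R B F\<^esub>"
  shows "(t \<otimes> v) \<odot>\<^bsub>tensor R A F\<^esub> z = \<zero>\<^bsub>tensor R A F\<^esub>"
proof -
  interpret A: module R A by (rule A)
  interpret B: module R B by (rule B)
  interpret F: module R F by (rule F)
  interpret T: module R "tensor R A F" by (rule tensor_module[OF A F])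
  let ?T = "tensor R A F" and ?p = "pure_tensor R A F" and ?FA = "tensor_free R A F" and ?FB = "tensor_free R B F"
  note R = A.R.is_cring
  have FA: "module R ?FA" and FB: "module R ?FB"
    unfolding tensor_free_def by (rule free_mod_module[OF R])+
  obtain h where h: "h \<in> carrier ?FA"
    and zh: "z = tensor_class R A F h"
    using tensor_carrierE[OF A F z(1)] by blast
  \<comment> \<open>The map \<open>f \<otimes> F\<close> on representatives, needed to compare coordinates before and after \<open>f\<close>.\<close>
  define p where "p = free_lift R ?FB (\<lambda>(a, y). free_basis R (f a, y))"
  have p: "p \<in> mod_hom R ?FA ?FB"
    unfolding p_def tensor_free_def[of R A F]
    by (rule free_lift_hom[OF R FB]) (auto intro!: tensor_basis_closed[OF B F] mod_homD(1)[OF f])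
  have pb: "p (free_basis R (a, y)) = free_basis R (f a, y)" if "a \<in> carrier A" "y \<in> carrier F" for a y
    unfolding p_def
    using free_lift_basis[OF R FB, of "(a, y)" "carrier A \<times> carrier F"] that
      tensor_basis_closed[OF B F mod_homD(1)[OF f that(1)] that(2)] by auto
  have "tensor_map R A B F f (tensor_class R A F h) =
      tensor_class R B F (p h)"
    using h unfolding tensor_free_def[of R A F]
  proof (rule free_hom_ext[OF R tensor_module[OF B F], rotated -1])
    show "(\<lambda>h. tensor_map R A B F f (tensor_rel R A F +>\<^bsub>free_mod R (carrier A \<times> carrier F)\<^esub> h))
       \<in> mod_hom R (free_mod R (carrier A \<times> carrier F)) (tensor R B F)"
      using mod_hom_comp[OF tensor_cls_hom[OF A F] tensor_map_hom[OF A B F f]] by (simp add: tensor_free_def)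
    show "(\<lambda>h. tensor_class R B F (p h))
       \<in> mod_hom R (free_mod R (carrier A \<times> carrier F)) (tensor R B F)"
      using mod_hom_comp[OF p tensor_cls_hom[OF B F]] by (simp add: tensor_free_def)
    fix q assume "q \<in> carrier A \<times> carrier F"
    then obtain a y where q: "q = (a, y)" and ay: "a \<in> carrier A" "y \<in> carrier F" by blast
    show "tensor_map R A B F f (tensor_rel R A F +>\<^bsub>free_mod R (carrier A \<times> carrier F)\<^esub> free_basis R q) =
      tensor_class R B F (p (free_basis R q))"
      using tensor_map_pure[OF A B F f ay] pb[OF ay]
      by (simp add: q pure_tensor_def tensor_free_def)
  qed
  then have "p h \<in> tensor_rel R B F"
    using z(2) tensor_cls_zero_iff[OF B F mod_homD(1)[OF p h]] by (simp add: zh)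
  then obtain ks where ks: "set ks \<subseteq> carrier B \<times> res_K0 R F"
    and ksy: "\<And>y. y \<in> carrier F \<Longrightarrow> tensor_coord R B y (p h) = rel_sum B ks y"
    using tensor_rel_coords[OF B F] by blast
  have coord: "tensor_coord R B y (p h) = f (tensor_coord R A y h)" for y
    using h unfolding tensor_free_def[of R A F]
  proof (rule free_hom_ext[OF R B, rotated -1])
    show "(\<lambda>h. tensor_coord R B y (p h)) \<in> mod_hom R (free_mod R (carrier A \<times> carrier F)) B"
      using mod_hom_comp[OF p tensor_coord_hom[OF B F]] by (simp add: tensor_free_def)
    show "(\<lambda>h. f (tensor_coord R A y h)) \<in> mod_hom R (free_mod R (carrier A \<times> carrier F)) B"
      using mod_hom_comp[OF tensor_coord_hom[OF A F] f] by (simp add: tensor_free_def)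
    fix q assume "q \<in> carrier A \<times> carrier F"
    then obtain a y where q: "q = (a, y)" and ay: "a \<in> carrier A" "y \<in> carrier F" by blast
    then show "tensor_coord R B y' (p (free_basis R q)) = f (tensor_coord R A y' (free_basis R q))" for y'
      using mod_homD(1)[OF f ay(1)] mod_hom_zero[OF A B f]
      by (simp add: q pb tensor_coord_basis[OF A F] tensor_coord_basis[OF B F])
  qed
  have cl: "tensor_coord R A y h \<in> carrier A" for y by (rule mod_homD(1)[OF tensor_coord_hom[OF A F] h])
  obtain ls where ls: "set ls \<subseteq> carrier A \<times> res_K0 R F"
    and lsy: "\<And>y. y \<in> carrier F \<Longrightarrow>
       (t \<otimes> v) \<odot>\<^bsub>A\<^esub> tensor_coord R A y h = (t \<otimes> v) \<odot>\<^bsub>A\<^esub> rel_sum A ls y"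
    using eliminate_relations[OF A B f t v abs, of "res_K0 R F" "carrier F" ks "\<lambda>y. tensor_coord R A y h"]
      res_K0_submodule[OF A F] ks ksy coord cl unfolding res_F0_def by auto
  obtain Y0 where Y0: "finite Y0" "Y0 \<subseteq> carrier F"
    and rec: "\<And>Y. finite Y \<Longrightarrow> Y0 \<subseteq> Y \<Longrightarrow> Y \<subseteq> carrier F \<Longrightarrow>
     z = (\<Oplus>\<^bsub>?T\<^esub>y\<in>Y. ?p (tensor_coord R A y h) y)"
    using tensor_recombine[OF A F h] unfolding zh by blast
  define Y where "Y = Y0 \<union> (\<Union>(a, k)\<in>set ls. {y. k y \<noteq> \<zero>})"
  have lsF: "k \<in> carrier (free_mod R (carrier F))" if "(a, k) \<in> set ls" for a k
    using ls that by (auto simp: res_K0_iff[OF A F])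
  have Y: "finite Y" "Y0 \<subseteq> Y" "Y \<subseteq> carrier F"
    using Y0 free_mod_supp(1)[OF R lsF] subsetD[OF free_mod_supp(2)[OF R lsF]] by (auto simp: Y_def)
  have l: "rel_sum A ls y \<in> carrier A" for y
    by (rule rel_sum_closed[OF A, of _ "carrier F"]) (use ls lsF in auto)
  have tv: "t \<otimes> v \<in> carrier R" using t v by simp
  have pull: "(t \<otimes> v) \<odot>\<^bsub>?T\<^esub> (\<Oplus>\<^bsub>?T\<^esub>y\<in>Y. ?p (u y) y) =
      (\<Oplus>\<^bsub>?T\<^esub>y\<in>Y. ?p ((t \<otimes> v) \<odot>\<^bsub>A\<^esub> u y) y)"
    if u: "\<And>y. u y \<in> carrier A" for u
  proof -
    have "(t \<otimes> v) \<odot>\<^bsub>?T\<^esub> (\<Oplus>\<^bsub>?T\<^esub>y\<in>Y. ?p (u y) y) =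
      (\<Oplus>\<^bsub>?T\<^esub>y\<in>Y. (t \<otimes> v) \<odot>\<^bsub>?T\<^esub> ?p (u y) y)"
      using Y tv u pure_tensor_closed[OF A F] by (intro T.finsum_smult_ldistr) auto
    also have "\<dots> = (\<Oplus>\<^bsub>?T\<^esub>y\<in>Y. ?p ((t \<otimes> v) \<odot>\<^bsub>A\<^esub> u y) y)"
      using Y tv u pure_tensor_closed[OF A F]
      by (intro T.finsum_cong') (auto simp: pure_tensor_eqs(3)[OF A F tv u])
    finally show ?thesis .
  qed
  have "(t \<otimes> v) \<odot>\<^bsub>?T\<^esub> z =
      (\<Oplus>\<^bsub>?T\<^esub>y\<in>Y. ?p ((t \<otimes> v) \<odot>\<^bsub>A\<^esub> tensor_coord R A y h) y)"
    using rec[OF Y] pull[OF cl] by simp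
  also have "\<dots> = (\<Oplus>\<^bsub>?T\<^esub>y\<in>Y. ?p ((t \<otimes> v) \<odot>\<^bsub>A\<^esub> rel_sum A ls y) y)"
    using Y tv l lsy pure_tensor_closed[OF A F] by (intro T.finsum_cong') (auto simp: subset_iff)
  also have "\<dots> = (t \<otimes> v) \<odot>\<^bsub>?T\<^esub> (\<Oplus>\<^bsub>?T\<^esub>y\<in>Y. ?p (rel_sum A ls y) y)"
    using pull[OF l] by simp
  also have "(\<Oplus>\<^bsub>?T\<^esub>y\<in>Y. ?p (rel_sum A ls y) y) = \<zero>\<^bsub>?T\<^esub>"
    by (rule tensor_rel_sum_zero[OF A F ls Y(1,3)]) (auto simp: Y_def)
  finally show ?thesis using tv by simp
qed

section \<open>Right exactness\<close>

text \<open>A map \<open>C \<otimes> F \<rightarrow> (B \<otimes> F)/im(f \<otimes> F)\<close> is constructed whose composite with \<open>g \<otimes> F\<close> is \<open>t\<^sup>2\<close> times the projection: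
  it sends \<open>c \<otimes> y\<close> to the class of \<open>t b \<otimes> y\<close>, where \<open>g(b) = t c\<close>.  One factor \<open>t\<close> is needed to lift \<open>c\<close>, the other
  makes the class independent of the lift.\<close>

theorem tensor_map_right_exact:
  fixes R :: "('a, 'r) ring_scheme" (structure)
    and A :: "('a, 'm) module" and B :: "('a, 'k) module" and C :: "('a, 'l) module" and F :: "('a, 'n) module"
  assumes A: "module R A" and B: "module R B" and C: "module R C" and F: "module R F"
    and f: "f \<in> mod_hom R A B" and g: "g \<in> mod_hom R B C"
    and t: "t \<in> carrier R" "\<And>b. b \<in> carrier B \<Longrightarrow> g b = \<zero>\<^bsub>C\<^esub> \<Longrightarrow> t \<odot>\<^bsub>B\<^esub> b \<in> f ` carrier A"
      "\<And>c. c \<in> carrier C \<Longrightarrow> t \<odot>\<^bsub>C\<^esub> c \<in> g ` carrier B"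
    and z: "z \<in> carrier (tensor R B F)" "tensor_map R B C F g z = \<zero>\<^bsub>tensor R C F\<^esub>"
  shows "(t \<otimes> t) \<odot>\<^bsub>tensor R B F\<^esub> z \<in> tensor_map R A B F f ` carrier (tensor R A F)"
proof -
  interpret A: module R A by (rule A)
  interpret B: module R B by (rule B)
  interpret C: module R C by (rule C)
  interpret F: module R F by (rule F)
  interpret T: module R "tensor R B F" by (rule tensor_module[OF B F])
  let ?T = "tensor R B F"
  define D where "D = tensor_map R A B F f ` carrier (tensor R A F)"
  have D: "submodule D R ?T"
    unfolding D_def by (rule mod_hom_image_submodule[OF tensor_module[OF A F] T.module_axioms tensor_map_hom[OF A B F f]])
  let ?Q = "quot_mod ?T D"
  interpret Q: module R ?Q by (rule quot_mod_module[OF T.module_axioms D])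
  note cls = coset_hom[OF T.module_axioms D]
  \<comment> \<open>A section of \<open>g\<close> up to \<open>t\<close>; it is additive only modulo the kernel of \<open>g\<close>, which \<open>t\<close> moves into
    the image of \<open>f\<close>.\<close>
  define \<beta> where "\<beta> c = (SOME b. b \<in> carrier B \<and> g b = t \<odot>\<^bsub>C\<^esub> c)" for c
  have \<beta>: "\<beta> c \<in> carrier B" "g (\<beta> c) = t \<odot>\<^bsub>C\<^esub> c" if "c \<in> carrier C" for c
  proof -
    have "\<exists>b. b \<in> carrier B \<and> g b = t \<odot>\<^bsub>C\<^esub> c" using t(3)[OF that] by (auto simp: image_iff)
    then show "\<beta> c \<in> carrier B" "g (\<beta> c) = t \<odot>\<^bsub>C\<^esub> c"
      unfolding \<beta>_def by (metis (mono_tags, lifting) someI_ex)+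
  qed
  define \<psi> where "\<psi> b y = D +>\<^bsub>?T\<^esub> (t \<odot>\<^bsub>?T\<^esub> pure_tensor R B F b y)" for b y
  have \<psi>_left: "(\<lambda>b. \<psi> b y) \<in> mod_hom R B ?Q" if y: "y \<in> carrier F" for y
  proof -
    have 1: "(\<lambda>b. pure_tensor R B F b y) \<in> mod_hom R B ?T"
      using pure_tensor_bilinear[OF B F] y by (auto simp: bilinear_map_def)
    show ?thesis unfolding \<psi>_def
      by (rule mod_hom_comp[OF mod_hom_comp[OF 1 smult_hom[OF T.module_axioms t(1)]] cls])
  qed
  have \<psi>_right: "\<psi> b \<in> mod_hom R F ?Q" if b: "b \<in> carrier B" for b
  proof -
    have 1: "(\<lambda>y. pure_tensor R B F b y) \<in> mod_hom R F ?T"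
      using pure_tensor_bilinear[OF B F] b by (auto simp: bilinear_map_def)
    show ?thesis unfolding \<psi>_def
      by (rule mod_hom_comp[OF mod_hom_comp[OF 1 smult_hom[OF T.module_axioms t(1)]] cls])
  qed
  have \<psi>_cong: "\<psi> b y = \<psi> b' y"
    if b: "b \<in> carrier B" "b' \<in> carrier B" "g b = g b'" and y: "y \<in> carrier F" for b b' y
  proof -
    have "g (b \<ominus>\<^bsub>B\<^esub> b') = \<zero>\<^bsub>C\<^esub>"
      using mod_hom_minus[OF B C g b(1,2)] b mod_homD(1)[OF g] by (simp add: C.minus_eq_zero_iff)
    then obtain a where a: "a \<in> carrier A" "t \<odot>\<^bsub>B\<^esub> (b \<ominus>\<^bsub>B\<^esub> b') = f a" using t(2)[of "b \<ominus>\<^bsub>B\<^esub> b'"] b by auto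
    have "t \<odot>\<^bsub>?T\<^esub> pure_tensor R B F (b \<ominus>\<^bsub>B\<^esub> b') y = tensor_map R A B F f (pure_tensor R A F a y)"
      using a b t(1) y by (simp add: tensor_map_pure[OF A B F f] pure_tensor_eqs(3)[OF B F, symmetric])
    then have "t \<odot>\<^bsub>?T\<^esub> pure_tensor R B F (b \<ominus>\<^bsub>B\<^esub> b') y \<in> D"
      unfolding D_def using pure_tensor_closed[OF A F a(1) y] by blast
    then have "\<psi> (b \<ominus>\<^bsub>B\<^esub> b') y = \<zero>\<^bsub>?Q\<^esub>"
      unfolding \<psi>_def using coset_eq_zero_iff[OF T.module_axioms D] t(1) b y pure_tensor_closed[OF B F] by simp
    then show ?thesis
      using mod_hom_minus[OF B Q.module_axioms \<psi>_left[OF y] b(1,2)] mod_homD(1)[OF \<psi>_left[OF y]] b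
      by (simp add: Q.minus_eq_zero_iff)
  qed
  have bil: "bilinear_map R C F ?Q (\<lambda>c. \<psi> (\<beta> c))"
    unfolding bilinear_map_def
  proof (intro conjI ballI)
    fix y assume y: "y \<in> carrier F"
    note L = mod_homD[OF \<psi>_left[OF y]]
    show "(\<lambda>c. \<psi> (\<beta> c) y) \<in> mod_hom R C ?Q"
    proof (rule mod_homI)
      fix c c' assume c: "c \<in> carrier C" "c' \<in> carrier C"
      have "\<psi> (\<beta> (c \<oplus>\<^bsub>C\<^esub> c')) y = \<psi> (\<beta> c \<oplus>\<^bsub>B\<^esub> \<beta> c') y"
        using c t(1) by (intro \<psi>_cong[OF _ _ _ y]) (simp_all add: \<beta> mod_homD[OF g] C.smult_r_distr)
      then show "\<psi> (\<beta> (c \<oplus>\<^bsub>C\<^esub> c')) y = \<psi> (\<beta> c) y \<oplus>\<^bsub>?Q\<^esub> \<psi> (\<beta> c') y" using c by (simp add: \<beta> L)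
    next
      fix r c assume c: "r \<in> carrier R" "c \<in> carrier C"
      have "\<psi> (\<beta> (r \<odot>\<^bsub>C\<^esub> c)) y = \<psi> (r \<odot>\<^bsub>B\<^esub> \<beta> c) y"
        using c t(1) by (intro \<psi>_cong[OF _ _ _ y])
          (simp_all add: \<beta> mod_homD[OF g] C.smult_assoc1[symmetric] A.R.m_comm)
      then show "\<psi> (\<beta> (r \<odot>\<^bsub>C\<^esub> c)) y = r \<odot>\<^bsub>?Q\<^esub> \<psi> (\<beta> c) y" using c by (simp add: \<beta> L)
    qed (use \<beta> L in auto)
  qed (use \<beta> \<psi>_right in auto)
  obtain \<Psi> where \<Psi>: "\<Psi> \<in> mod_hom R (tensor R C F) ?Q"
    and \<Psi>p: "\<And>c y. c \<in> carrier C \<Longrightarrow> y \<in> carrier F \<Longrightarrow> \<Psi> (pure_tensor R C F c y) = \<psi> (\<beta> c) y"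
    using tensor_lift(1,2)[OF C F Q.module_axioms bil] by blast
  have "\<Psi> (tensor_map R B C F g z) = D +>\<^bsub>?T\<^esub> ((t \<otimes> t) \<odot>\<^bsub>?T\<^esub> z)"
  proof (rule tensor_hom_ext[OF B F Q.module_axioms _ _ _ z(1)])
    show "(\<lambda>z. \<Psi> (tensor_map R B C F g z)) \<in> mod_hom R ?T ?Q"
      by (rule mod_hom_comp[OF tensor_map_hom[OF B C F g] \<Psi>])
    show "(\<lambda>z. D +>\<^bsub>?T\<^esub> ((t \<otimes> t) \<odot>\<^bsub>?T\<^esub> z)) \<in> mod_hom R ?T ?Q"
      by (rule mod_hom_comp[OF smult_hom[OF T.module_axioms] cls]) (use t in auto)
    fix b y assume b: "b \<in> carrier B" and y: "y \<in> carrier F"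
    have gb: "g b \<in> carrier C" by (rule mod_homD(1)[OF g b])
    have "\<Psi> (tensor_map R B C F g (pure_tensor R B F b y)) = \<psi> (\<beta> (g b)) y"
      using b y gb by (simp add: tensor_map_pure[OF B C F g] \<Psi>p)
    also have "\<dots> = \<psi> (t \<odot>\<^bsub>B\<^esub> b) y"
      using b gb t(1) by (intro \<psi>_cong[OF _ _ _ y]) (simp_all add: \<beta> mod_homD[OF g])
    also have "\<dots> = D +>\<^bsub>?T\<^esub> ((t \<otimes> t) \<odot>\<^bsub>?T\<^esub> pure_tensor R B F b y)"
      unfolding \<psi>_def using b y t(1) pure_tensor_closed[OF B F b y]
      by (simp add: pure_tensor_eqs(3)[OF B F] T.smult_assoc1)
    finally show "\<Psi> (tensor_map R B C F g (pure_tensor R B F b y)) =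
        D +>\<^bsub>?T\<^esub> ((t \<otimes> t) \<odot>\<^bsub>?T\<^esub> pure_tensor R B F b y)" .
  qed
  moreover have "\<Psi> (tensor_map R B C F g z) = \<zero>\<^bsub>?Q\<^esub>"
    unfolding z(2) by (rule mod_hom_zero[OF tensor_module[OF C F] Q.module_axioms \<Psi>])
  ultimately show ?thesis
    using coset_eq_zero_iff[OF T.module_axioms D, of "(t \<otimes> t) \<odot>\<^bsub>?T\<^esub> z"] z(1) t(1) unfolding D_def by simp
qed

section \<open>The first Tor module\<close>

lemma zero_hom: "module R N \<Longrightarrow> (\<lambda>_. \<zero>\<^bsub>N\<^esub>) \<in> mod_hom R M N"
proof -
  assume "module R N"
  then interpret N: module R N .
  show ?thesis by (rule mod_homI) auto
qed

lemma submodule_of_sub_mod: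
  assumes M: "module R M" and N: "submodule N R M" and D: "submodule D R M" "D \<subseteq> N"
  shows "submodule D R (sub_mod M N)"
proof -
  interpret M: module R M by (rule M)
  interpret N: module R "sub_mod M N" by (rule sub_mod_module[OF M N])
  show ?thesis using D unfolding M.submodule_iff N.submodule_iff by auto
qed

lemma tensor_map_comp:
  assumes A: "module R A" and B: "module R B" and C: "module R C" and N: "module R N"
    and f: "f \<in> mod_hom R A B" and g: "g \<in> mod_hom R B C" and z: "z \<in> carrier (tensor R A N)"
  shows "tensor_map R B C N g (tensor_map R A B N f z) = tensor_map R A C N (\<lambda>x. g (f x)) z"
  by (rule tensor_hom_ext[OF A N tensor_module[OF C N]
        mod_hom_comp[OF tensor_map_hom[OF A B N f] tensor_map_hom[OF B C N g]]
        tensor_map_hom[OF A C N mod_hom_comp[OF f g]] _ z])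
    (simp add: tensor_map_pure[OF A B N f] tensor_map_pure[OF B C N g] mod_homD(1)[OF f]
      tensor_map_pure[OF A C N mod_hom_comp[OF f g]])

lemma tensor_map_zero:
  assumes A: "module R A" and B: "module R B" and N: "module R N"
    and f: "f \<in> mod_hom R A B" "\<And>x. x \<in> carrier A \<Longrightarrow> f x = \<zero>\<^bsub>B\<^esub>" and z: "z \<in> carrier (tensor R A N)"
  shows "tensor_map R A B N f z = \<zero>\<^bsub>tensor R B N\<^esub>"
proof -
  interpret B: module R B by (rule B)
  interpret T: module R "tensor R B N" by (rule tensor_module[OF B N])
  show ?thesis
    by (intro tensor_hom_ext[OF A N T.module_axioms tensor_map_hom[OF A B N f(1)]
          zero_hom[OF T.module_axioms] _ z])
      (simp add: tensor_map_pure[OF A B N f(1)] f(2) pure_tensor_zero[OF B N])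
qed

text \<open>One step of the functorial resolution: the free module on a subset \<open>K\<close> of \<open>G\<close>, mapped onto the
  submodule that \<open>K\<close> generates.\<close>

context
  fixes R :: "('a, 'r) ring_scheme" (structure) and G :: "('a, 'g) module" and K
  assumes G: "module R G" and K: "K \<subseteq> carrier G"
begin

interpretation G: module R G by (rule G)

lemma free_cover_hom: "free_lift R G (\<lambda>x. x) \<in> mod_hom R (free_mod R K) G"
  by (rule free_lift_hom[OF G.R.is_cring G]) (use K in auto)

lemma free_cover_basis: "k \<in> K \<Longrightarrow> free_lift R G (\<lambda>x. x) (free_basis R k) = k"
  by (rule free_lift_basis[OF G.R.is_cring G]) (use K in auto)

lemma free_cover_kernel:
  assumes P: "module R P" and q: "q \<in> mod_hom R G P" "\<And>k. k \<in> K \<Longrightarrow> q k = \<zero>\<^bsub>P\<^esub>"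
    and h: "h \<in> carrier (free_mod R K)"
  shows "q (free_lift R G (\<lambda>x. x) h) = \<zero>\<^bsub>P\<^esub>"
  by (rule free_hom_ext[OF G.R.is_cring P mod_hom_comp[OF free_cover_hom q(1)] zero_hom[OF P] _ h])
    (simp add: free_cover_basis q(2))

end

context
  fixes R :: "('a, 'r) ring_scheme" (structure) and M :: "('a, 'm) module" and N :: "('a, 'n) module"
  assumes M: "module R M" and N: "module R N"
begin

interpretation M: module R M by (rule M)
interpretation N: module R N by (rule N)

lemma res_modules: "module R (res_F0 R M)" "module R (res_F1 R M)" "module R (res_F2 R M)"
  unfolding res_F0_def res_F1_def res_F2_def by (rule free_mod_module[OF M.R.is_cring])+

lemma res_K0_carrier: "res_K0 R M \<subseteq> carrier (res_F0 R M)"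
  by (auto simp: res_K0_def mem_a_kernel)

lemma res_K1_iff:
  "h \<in> res_K1 R M \<longleftrightarrow> h \<in> carrier (res_F1 R M) \<and> res_d1 R M h = \<zero>\<^bsub>res_F0 R M\<^esub>"
  by (simp add: res_K1_def mem_a_kernel)

lemma res_d1_hom: "res_d1 R M \<in> mod_hom R (res_F1 R M) (res_F0 R M)"
  unfolding res_d1_def res_F1_def by (rule free_cover_hom[OF res_modules(1) res_K0_carrier])

lemma res_d1_basis: "k \<in> res_K0 R M \<Longrightarrow> res_d1 R M (free_basis R k) = k"
  unfolding res_d1_def by (rule free_cover_basis[OF res_modules(1) res_K0_carrier])

lemma res_d1_K0:
  assumes h: "h \<in> carrier (res_F1 R M)" shows "res_d1 R M h \<in> res_K0 R M"
proof -
  have "free_lift R M (\<lambda>x. x) (res_d1 R M h) = \<zero>\<^bsub>M\<^esub>"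
    unfolding res_d1_def
    by (rule free_cover_kernel[OF res_modules(1) res_K0_carrier M res_aug_hom[OF M M]])
      (use h in \<open>auto simp: res_K0_def mem_a_kernel res_F1_def\<close>)
  then show ?thesis using mod_homD(1)[OF res_d1_hom h] by (simp add: res_K0_def mem_a_kernel)
qed

lemma res_d2_hom: "res_d2 R M \<in> mod_hom R (res_F2 R M) (res_F1 R M)"
  unfolding res_d2_def res_F2_def by (rule free_cover_hom[OF res_modules(2)]) (auto simp: res_K1_iff)

lemma res_d2_basis: "k \<in> res_K1 R M \<Longrightarrow> res_d2 R M (free_basis R k) = k"
  unfolding res_d2_def by (rule free_cover_basis[OF res_modules(2)]) (auto simp: res_K1_iff)

lemma res_d1_d2:
  assumes h: "h \<in> carrier (res_F2 R M)" shows "res_d1 R M (res_d2 R M h) = \<zero>\<^bsub>res_F0 R M\<^esub>"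
  unfolding res_d2_def
  by (rule free_cover_kernel[OF res_modules(2) _ res_modules(1) res_d1_hom])
    (use h in \<open>auto simp: res_K1_iff res_F2_def\<close>)

lemma annihilates_Tor1_iff:
  assumes s: "s \<in> carrier R"
  shows "annihilates s (Tor1 R M N) \<longleftrightarrow>
    (\<forall>z\<in>carrier (tensor R (res_F1 R M) N).
       tensor_map R (res_F1 R M) (res_F0 R M) N (res_d1 R M) z = \<zero>\<^bsub>tensor R (res_F0 R M) N\<^esub> \<longrightarrow>
       s \<odot>\<^bsub>tensor R (res_F1 R M) N\<^esub> z \<in>
         tensor_map R (res_F2 R M) (res_F1 R M) N (res_d2 R M) ` carrier (tensor R (res_F2 R M) N))"
proof -
  let ?T0 = "tensor R (res_F0 R M) N" and ?T = "tensor R (res_F1 R M) N" and ?S = "tensor R (res_F2 R M) N"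
  let ?f = "tensor_map R (res_F1 R M) (res_F0 R M) N (res_d1 R M)"
  let ?g = "tensor_map R (res_F2 R M) (res_F1 R M) N (res_d2 R M)"
  note T = tensor_module[OF res_modules(1) N] tensor_module[OF res_modules(2) N] tensor_module[OF res_modules(3) N]
  have f: "?f \<in> mod_hom R ?T (tensor R (res_F0 R M) N)"
    by (rule tensor_map_hom[OF res_modules(2,1) N res_d1_hom])
  have g: "?g \<in> mod_hom R ?S ?T"
    by (rule tensor_map_hom[OF res_modules(3,2) N res_d2_hom])
  define Z where "Z = a_kernel ?T (tensor R (res_F0 R M) N) ?f"
  define B where "B = ?g ` carrier ?S"
  have Z: "submodule Z R ?T" unfolding Z_def by (rule mod_hom_kernel_submodule[OF T(2,1) f])
  have "?f (?g w) = \<zero>\<^bsub>tensor R (res_F0 R M) N\<^esub>" if w: "w \<in> carrier ?S" for w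
    unfolding tensor_map_comp[OF res_modules(3,2,1) N res_d2_hom res_d1_hom w]
    by (rule tensor_map_zero[OF res_modules(3,1) N mod_hom_comp[OF res_d2_hom res_d1_hom] res_d1_d2 w])
  then have BZ: "B \<subseteq> Z" unfolding B_def Z_def using mod_homD(1)[OF g] by (auto simp: mem_a_kernel)
  have B: "submodule B R (sub_mod ?T Z)"
    by (rule submodule_of_sub_mod[OF T(2) Z _ BZ]) (unfold B_def, rule mod_hom_image_submodule[OF T(3,2) g])
  have "Tor1 R M N = quot_mod (sub_mod ?T Z) B" by (simp add: Tor1_def Let_def Z_def B_def)
  then show ?thesis
    unfolding annihilates_quot_mod[OF sub_mod_module[OF T(2) Z] B s]
    by (simp add: annihilates_quot_mod[OF sub_mod_module[OF T(2) Z] B s]) (auto simp: Z_def B_def mem_a_kernel)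
qed

text \<open>The differential \<open>F\<^sub>1 \<rightarrow> F\<^sub>0\<close> factors through its image \<open>K\<close>.  A cycle in \<open>F\<^sub>1 \<otimes> N\<close> maps into the kernel of
  \<open>K \<otimes> N \<rightarrow> F\<^sub>0 \<otimes> N\<close>, which \<open>v\<close> kills; right exactness of \<open>F\<^sub>2 \<rightarrow> F\<^sub>1 \<rightarrow> K \<rightarrow> 0\<close> then makes \<open>v\<close> times
  the cycle a boundary.\<close>

theorem Tor1_annihilated:
  assumes v: "v \<in> carrier R" and abs: "idempotent_absorbing R v TYPE('n)"
  shows "annihilates v (Tor1 R M N)"
  unfolding annihilates_Tor1_iff[OF v]
proof (intro ballI impI)
  let ?T = "tensor R (res_F1 R M) N"
  fix z assume z: "z \<in> carrier ?T"
    and z0: "tensor_map R (res_F1 R M) (res_F0 R M) N (res_d1 R M) z = \<zero>\<^bsub>tensor R (res_F0 R M) N\<^esub>"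
  interpret F0: module R "res_F0 R M" by (rule res_modules)
  interpret F1: module R "res_F1 R M" by (rule res_modules)
  interpret T: module R ?T by (rule tensor_module[OF res_modules(2) N])
  define K where "K = sub_mod (res_F0 R M) (res_K0 R M)"
  have K: "module R K" unfolding K_def by (rule sub_mod_module[OF res_modules(1) res_K0_submodule[OF M M]])
  interpret K: module R K by (rule K)
  have inc: "(\<lambda>x. x) \<in> mod_hom R K (res_F0 R M)"
    by (rule mod_homI) (use res_K0_carrier in \<open>auto simp: K_def\<close>)
  have d: "res_d1 R M \<in> mod_hom R (res_F1 R M) K"
    by (rule mod_homI) (auto simp: K_def res_d1_K0 mod_homD[OF res_d1_hom])
  note dT = mod_homD[OF tensor_map_hom[OF res_modules(2) K N d]]
  let ?z = "tensor_map R (res_F1 R M) K N (res_d1 R M) z"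
  have "tensor_map R K (res_F0 R M) N (\<lambda>x. x) ?z = \<zero>\<^bsub>tensor R (res_F0 R M) N\<^esub>"
    using tensor_map_comp[OF res_modules(2) K res_modules(1) N d inc z] z0 by simp
  then have "(\<one> \<otimes> v) \<odot>\<^bsub>tensor R K N\<^esub> ?z = \<zero>\<^bsub>tensor R K N\<^esub>"
    using tensor_map_kernel[OF K res_modules(1) N inc M.R.one_closed _ v abs dT(1)[OF z]]
    by (auto simp: K_def)
  then have vz: "tensor_map R (res_F1 R M) K N (res_d1 R M) (v \<odot>\<^bsub>?T\<^esub> z) = \<zero>\<^bsub>tensor R K N\<^esub>"
    using v z dT by simp
  have "(\<one> \<otimes> \<one>) \<odot>\<^bsub>?T\<^esub> (v \<odot>\<^bsub>?T\<^esub> z) \<in>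
     tensor_map R (res_F2 R M) (res_F1 R M) N (res_d2 R M) ` carrier (tensor R (res_F2 R M) N)"
  proof (rule tensor_map_right_exact[OF res_modules(3,2) K N res_d2_hom d M.R.one_closed _ _ _ vz])
    fix b assume b: "b \<in> carrier (res_F1 R M)" "res_d1 R M b = \<zero>\<^bsub>K\<^esub>"
    then have "b \<in> res_K1 R M" by (simp add: res_K1_iff K_def)
    then have "b = res_d2 R M (free_basis R b)" "free_basis R b \<in> carrier (res_F2 R M)"
      unfolding res_F2_def by (simp_all add: res_d2_basis free_basis_closed[OF M.R.is_cring])
    then show "\<one> \<odot>\<^bsub>res_F1 R M\<^esub> b \<in> res_d2 R M ` carrier (res_F2 R M)" using b(1) by auto
  next
    fix c assume c: "c \<in> carrier K"
    then have "c \<in> res_K0 R M" by (simp add: K_def)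
    then have "c = res_d1 R M (free_basis R c)" "free_basis R c \<in> carrier (res_F1 R M)"
      unfolding res_F1_def by (simp_all add: res_d1_basis free_basis_closed[OF M.R.is_cring])
    then show "\<one> \<odot>\<^bsub>K\<^esub> c \<in> res_d1 R M ` carrier (res_F1 R M)" using c by auto
  qed (use v z in auto)
  then show "v \<odot>\<^bsub>?T\<^esub> z \<in>
     tensor_map R (res_F2 R M) (res_F1 R M) N (res_d2 R M) ` carrier (tensor R (res_F2 R M) N)"
    using v z by simp
qed

end

section \<open>Uniform flatness\<close>

text \<open>If \<open>p\<close>, \<open>q\<close> and \<open>r\<close> witness the exactness of the given sequence at \<open>A\<close>, \<open>B\<close> and \<open>C\<close>, then \<open>p v\<close>, \<open>(q r)\<^sup>2\<close>
  and \<open>r\<close> witness that of the tensored one.  The factor \<open>v\<close> comes from the kernel of \<open>A \<otimes> F \<rightarrow> B \<otimes> F\<close>.\<close>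

theorem uS_flat_if_idempotent_absorbing:
  fixes R :: "('a, 'r) ring_scheme" (structure) and F :: "('a, 'm) module"
  assumes S: "submonoid S R" and F: "module R F" and v: "v \<in> S" and abs: "idempotent_absorbing R v TYPE('m)"
  shows "uS_flat R S F"
  unfolding uS_flat_def
proof (intro allI impI)
  fix A B C :: "('a, 'm) module" and f g
  assume A: "module R A" and B: "module R B" and C: "module R C"
    and f: "f \<in> mod_hom R A B" and g: "g \<in> mod_hom R B C" and ex: "uS_short_exact S A B C f g"
  interpret A: module R A by (rule A)
  interpret B: module R B by (rule B)
  interpret C: module R C by (rule C)
  let ?A = "tensor R A F" and ?B = "tensor R B F" and ?C = "tensor R C F"
  let ?f = "tensor_map R A B F f" and ?g = "tensor_map R B C F g"
  interpret TA: module R ?A by (rule tensor_module[OF A F])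
  interpret TB: module R ?B by (rule tensor_module[OF B F])
  interpret TC: module R ?C by (rule tensor_module[OF C F])
  have fT: "?f \<in> mod_hom R ?A ?B" by (rule tensor_map_hom[OF A B F f])
  have gT: "?g \<in> mod_hom R ?B ?C" by (rule tensor_map_hom[OF B C F g])
  have SR: "s \<in> carrier R" if "s \<in> S" for s by (rule submonoid.mem_carrier[OF S that])
  have SS: "s \<otimes> t \<in> S" if "s \<in> S" "t \<in> S" for s t by (rule submonoid.m_closed[OF S that])
  obtain p where p: "p \<in> S" "\<And>a. a \<in> carrier A \<Longrightarrow> f a = \<zero>\<^bsub>B\<^esub> \<Longrightarrow> p \<odot>\<^bsub>A\<^esub> a = \<zero>\<^bsub>A\<^esub>"
    using ex unfolding uS_short_exact_def uS_exact_def by (auto simp: mem_a_kernel zero_mod_def)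
  obtain q where q: "q \<in> S" "\<And>b. b \<in> carrier B \<Longrightarrow> g b = \<zero>\<^bsub>C\<^esub> \<Longrightarrow> q \<odot>\<^bsub>B\<^esub> b \<in> f ` carrier A"
      "\<And>a. a \<in> carrier A \<Longrightarrow> g (q \<odot>\<^bsub>B\<^esub> f a) = \<zero>\<^bsub>C\<^esub>"
    using ex unfolding uS_short_exact_def uS_exact_def by (auto simp: mem_a_kernel)
  obtain r where r: "r \<in> S" "\<And>c. c \<in> carrier C \<Longrightarrow> r \<odot>\<^bsub>C\<^esub> c \<in> g ` carrier B"
    using ex unfolding uS_short_exact_def uS_exact_def by (auto simp: mem_a_kernel zero_mod_def)
  show "uS_short_exact S ?A ?B ?C ?f ?g"
    unfolding uS_short_exact_def
  proof (intro conjI)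
    have "(p \<otimes> v) \<odot>\<^bsub>?A\<^esub> z = \<zero>\<^bsub>?A\<^esub>" if "z \<in> carrier ?A" "?f z = \<zero>\<^bsub>?B\<^esub>" for z
      using tensor_map_kernel[OF A B F f SR[OF p(1)] p(2) SR[OF v] abs that] .
    then show "uS_exact S zero_mod ?A ?B (\<lambda>_. \<zero>\<^bsub>?A\<^esub>) ?f"
      unfolding uS_exact_def using SS[OF p(1) v] SR mod_hom_zero[OF TA.module_axioms TB.module_axioms fT]
      by (intro bexI[of _ "p \<otimes> v"]) (auto simp: mem_a_kernel zero_mod_def)
  next
    let ?t = "q \<otimes> r"
    have t: "?t \<in> S" "?t \<in> carrier R" using SS q(1) r(1) SR by auto
    have 1: "?t \<odot>\<^bsub>B\<^esub> b \<in> f ` carrier A" if b: "b \<in> carrier B" "g b = \<zero>\<^bsub>C\<^esub>" for b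
    proof -
      have "?t \<odot>\<^bsub>B\<^esub> b = r \<odot>\<^bsub>B\<^esub> (q \<odot>\<^bsub>B\<^esub> b)"
        using b SR[OF q(1)] SR[OF r(1)] by (simp add: B.smult_assoc1[symmetric] A.R.m_comm)
      then show ?thesis
        using q(2)[OF b] submodule.smult_closed[OF mod_hom_image_submodule[OF A B f] SR[OF r(1)]] by simp
    qed
    have 2: "?t \<odot>\<^bsub>C\<^esub> c \<in> g ` carrier B" if c: "c \<in> carrier C" for c
      using r(2)[OF c] submodule.smult_closed[OF mod_hom_image_submodule[OF B C g] SR[OF q(1)]]
        C.smult_assoc1[OF SR[OF q(1)] SR[OF r(1)] c] by simp
    have 3: "(?t \<otimes> ?t) \<odot>\<^bsub>?B\<^esub> z \<in> ?f ` carrier ?A" if "z \<in> carrier ?B" "?g z = \<zero>\<^bsub>?C\<^esub>" for z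
      using tensor_map_right_exact[OF A B C F f g t(2) 1 2 that] .
    have 4: "?g ((?t \<otimes> ?t) \<odot>\<^bsub>?B\<^esub> ?f w) = \<zero>\<^bsub>?C\<^esub>" if w: "w \<in> carrier ?A" for w
    proof -
      have fw: "?f w \<in> carrier ?B" by (rule mod_homD(1)[OF fT w])
      have qf: "(\<lambda>a. q \<odot>\<^bsub>B\<^esub> f a) \<in> mod_hom R A B" by (rule mod_hom_comp[OF f smult_hom[OF B SR[OF q(1)]]])
      have "q \<odot>\<^bsub>?C\<^esub> ?g (?f w) = \<zero>\<^bsub>?C\<^esub>"
      proof -
        have "q \<odot>\<^bsub>?C\<^esub> ?g (?f w) = q \<odot>\<^bsub>?C\<^esub> tensor_map R A C F (\<lambda>x. g (f x)) w"
          unfolding tensor_map_comp[OF A B C F f g w] ..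
        also have "\<dots> = tensor_map R A C F (\<lambda>x. q \<odot>\<^bsub>C\<^esub> g (f x)) w"
          by (rule tensor_hom_ext[OF A F TC.module_axioms mod_hom_comp[OF tensor_map_hom[OF A C F mod_hom_comp[OF f g]] smult_hom[OF TC.module_axioms SR[OF q(1)]]]
              tensor_map_hom[OF A C F mod_hom_comp[OF mod_hom_comp[OF f g] smult_hom[OF C SR[OF q(1)]]]] _ w])
            (simp add: tensor_map_pure[OF A C F mod_hom_comp[OF f g]]
              tensor_map_pure[OF A C F mod_hom_comp[OF mod_hom_comp[OF f g] smult_hom[OF C SR[OF q(1)]]]]
              pure_tensor_eqs(3)[OF C F SR[OF q(1)]] mod_homD(1)[OF f] mod_homD(1)[OF g])
        also have "\<dots> = \<zero>\<^bsub>?C\<^esub>"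
          by (rule tensor_map_zero[OF A C F mod_hom_comp[OF mod_hom_comp[OF f g] smult_hom[OF C SR[OF q(1)]]] _ w])
            (use q(3) SR[OF q(1)] in \<open>simp add: mod_homD[OF g] mod_homD(1)[OF f]\<close>)
        finally show ?thesis .
      qed
      then have "(r \<otimes> ?t) \<odot>\<^bsub>?C\<^esub> (q \<odot>\<^bsub>?C\<^esub> ?g (?f w)) = \<zero>\<^bsub>?C\<^esub>" using t SR[OF r(1)] by simp
      moreover have "?t \<otimes> ?t = (r \<otimes> ?t) \<otimes> q" using SR[OF q(1)] SR[OF r(1)] by (simp add: A.R.m_ac)
      ultimately show ?thesis
        using fw t SR[OF q(1)] SR[OF r(1)] mod_homD(1)[OF gT fw]
        by (simp add: mod_homD(3)[OF gT] TC.smult_assoc1)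
    qed
    show "uS_exact S ?A ?B ?C ?f ?g"
      unfolding uS_exact_def using SS[OF t(1) t(1)] t(2) 3 4 mod_homD(1)[OF fT]
      by (intro bexI[of _ "?t \<otimes> ?t"]) (auto simp: mem_a_kernel)
  next
    have "r \<odot>\<^bsub>?C\<^esub> z \<in> ?g ` carrier ?B" if z: "z \<in> carrier ?C" for z
      using z
    proof (induction rule: tensor_induct[OF C F, consumes 1, case_names zero add])
      note I = mod_hom_image_submodule[OF TB.module_axioms TC.module_axioms gT, unfolded TC.submodule_iff]
      case zero
      then show ?case using I SR[OF r(1)] by simp
    next
      case (add z c y)
      obtain b where b: "b \<in> carrier B" "r \<odot>\<^bsub>C\<^esub> c = g b" using r(2)[OF add.hyps(2)] by blast
      have "r \<odot>\<^bsub>?C\<^esub> pure_tensor R C F c y = ?g (pure_tensor R B F b y)"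
        using add.hyps b SR[OF r(1)]
        by (simp add: tensor_map_pure[OF B C F g] pure_tensor_eqs(3)[OF C F, symmetric])
      then have "r \<odot>\<^bsub>?C\<^esub> pure_tensor R C F c y \<in> ?g ` carrier ?B"
        using pure_tensor_closed[OF B F b(1) add.hyps(3)] by blast
      then have "r \<odot>\<^bsub>?C\<^esub> z \<oplus>\<^bsub>?C\<^esub> r \<odot>\<^bsub>?C\<^esub> pure_tensor R C F c y \<in> ?g ` carrier ?B"
        using TC.submoduleE(5)[OF mod_hom_image_submodule[OF TB.module_axioms TC.module_axioms gT] add.IH]
        by blast
      then show ?case
        using add.hyps SR[OF r(1)] pure_tensor_closed[OF C F] by (simp add: TC.smult_r_distr)
    qed
    moreover have "r \<odot>\<^bsub>?C\<^esub> ?g z \<in> carrier ?C" if "z \<in> carrier ?B" for z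
      using that SR[OF r(1)] mod_homD(1)[OF gT] by simp
    ultimately show "uS_exact S ?B ?C zero_mod ?g (\<lambda>_. ())"
      unfolding uS_exact_def using r(1) by (intro bexI[of _ r]) (auto simp: mem_a_kernel zero_mod_def)
  qed
qed

section \<open>Detecting divisibility by a square\<close>

lemma ideal_submodule:
  assumes "cring R" "ideal I R" shows "submodule I R (reg_mod R)"
proof -
  interpret cring R by fact
  interpret I: ideal I R by fact
  interpret G: module R "reg_mod R" by (rule reg_mod_module) (rule is_cring)
  show ?thesis unfolding G.submodule_iff using I.a_subset I.I_l_closed by auto
qed

lemma (in cring) mem_cgenideal: "x \<in> PIdl a \<longleftrightarrow> (\<exists>r\<in>carrier R. x = r \<otimes> a)"
  unfolding cgenideal_def by auto

lemma (in cring) cgenideal_mult_square: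
  assumes "a \<in> carrier R" "x \<in> PIdl a" "y \<in> PIdl a"
  shows "x \<otimes> y \<in> PIdl (a \<otimes> a)"
proof -
  obtain r s where "r \<in> carrier R" "x = r \<otimes> a" "s \<in> carrier R" "y = s \<otimes> a"
    using assms by (auto simp: mem_cgenideal)
  then have "x \<otimes> y = (r \<otimes> s) \<otimes> (a \<otimes> a)" "r \<otimes> s \<in> carrier R" using assms(1) by (simp_all add: m_ac)
  then show ?thesis unfolding mem_cgenideal by blast
qed

text \<open>If \<open>p\<close> takes values in \<open>(a)\<close> and \<open>\<theta>\<close> is defined modulo \<open>(a)\<close>, then their product is defined
  modulo \<open>(a\<^sup>2)\<close>.\<close>

lemma square_pairing:
  fixes R :: "('a, 'r) ring_scheme" (structure) and A :: "('a, 'm) module" and F :: "('a, 'n) module"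
  defines "G \<equiv> reg_mod R"
  assumes A: "module R A" and F: "module R F" and a: "a \<in> carrier R"
    and lam: "p \<in> mod_hom R A G" "\<And>x. x \<in> carrier A \<Longrightarrow> p x \<in> PIdl a"
    and \<theta>: "\<theta> \<in> mod_hom R F (cyclic_mod R (PIdl a))"
  shows "\<exists>\<Psi>\<in>mod_hom R (tensor R A F) (cyclic_mod R (PIdl (a \<otimes> a))).
     \<forall>x\<in>carrier A. \<forall>y\<in>carrier F. \<forall>u\<in>carrier R. \<theta> y = PIdl a +>\<^bsub>G\<^esub> u \<longrightarrow>
       \<Psi> (pure_tensor R A F x y) = PIdl (a \<otimes> a) +>\<^bsub>G\<^esub> (p x \<otimes> u)"
proof -
  interpret A: module R A by (rule A)
  interpret F: module R F by (rule F)
  have G: "module R G" unfolding G_def by (rule reg_mod_module[OF A.R.is_cring])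
  interpret G: module R G by (rule G)
  let ?I = "PIdl a" and ?J = "PIdl (a \<otimes> a)"
  have I: "submodule ?I R G" and J: "submodule ?J R G"
    unfolding G_def using A.R.cgenideal_ideal a ideal_submodule[OF A.R.is_cring] by auto
  have Gs [simp]: "carrier G = carrier R" "smult G = mult R" by (simp_all add: G_def)
  have Q: "module R (quot_mod G ?J)" by (rule quot_mod_module[OF G J])
  define f where "f x u = ?J +>\<^bsub>G\<^esub> (p x \<otimes> u)" for x u
  have lR: "p x \<in> carrier R" if "x \<in> carrier A" for x using mod_homD(1)[OF lam(1) that] by simp
  have f1: "f x \<in> mod_hom R G (quot_mod G ?J)" if x: "x \<in> carrier A" for x
    unfolding f_def using mod_hom_comp[OF smult_hom[OF G lR[OF x]] coset_hom[OF G J]] by simp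
  have f0: "f x u = \<zero>\<^bsub>quot_mod G ?J\<^esub>" if x: "x \<in> carrier A" and u: "u \<in> ?I" for x u
  proof -
    have "p x \<otimes> u \<in> ?J" by (rule A.R.cgenideal_mult_square[OF a lam(2)[OF x] u])
    moreover have "p x \<otimes> u \<in> carrier G" using lR[OF x] I[unfolded G.submodule_iff] u by auto
    ultimately show ?thesis unfolding f_def using coset_eq_zero_iff[OF G J] by blast
  qed
  define \<eta> where "\<eta> x C = the_elem (f x ` C)" for x C
  have \<eta>: "\<eta> x \<in> mod_hom R (quot_mod G ?I) (quot_mod G ?J)" if x: "x \<in> carrier A" for x
    using quot_lift(1)[OF G I Q f1[OF x] f0[OF x]] unfolding \<eta>_def .
  have \<eta>u: "\<eta> x (?I +>\<^bsub>G\<^esub> u) = f x u" if "x \<in> carrier A" "u \<in> carrier R" for x u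
    using quot_lift(2)[OF G I Q f1[OF that(1)] f0[OF that(1)], of u] that(2) unfolding \<eta>_def by simp
  have \<theta>': "\<theta> \<in> mod_hom R F (quot_mod G ?I)" using \<theta> by (simp add: G_def)
  have bil: "bilinear_map R A F (quot_mod G ?J) (\<lambda>x y. \<eta> x (\<theta> y))"
    unfolding bilinear_map_def
  proof (intro conjI ballI)
    fix x assume "x \<in> carrier A"
    then show "(\<lambda>y. \<eta> x (\<theta> y)) \<in> mod_hom R F (quot_mod G ?J)" by (rule mod_hom_comp[OF \<theta>' \<eta>])
  next
    fix y assume "y \<in> carrier F"
    then obtain u where u: "u \<in> carrier R" "\<theta> y = ?I +>\<^bsub>G\<^esub> u"
      using mod_homD(1)[OF \<theta>'] by (auto simp: quot_mod_carrier)
    have h: "(\<lambda>x. ?J +>\<^bsub>G\<^esub> (p x \<otimes> u)) \<in> mod_hom R A (quot_mod G ?J)"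
      using mod_hom_comp[OF mod_hom_comp[OF lam(1)[unfolded G_def] scalar_hom[OF G, of u]] coset_hom[OF G J]] u(1) by simp
    show "(\<lambda>x. \<eta> x (\<theta> y)) \<in> mod_hom R A (quot_mod G ?J)"
      by (rule mod_homI) (use mod_homD[OF h] in \<open>simp_all add: u \<eta>u f_def\<close>)
  qed
  show ?thesis
    unfolding G_def[symmetric]
    using tensor_lift(1,2)[OF A F Q bil]
    by (intro bexI[of _ "\<lambda>C. the_elem (free_lift R (quot_mod G ?J) (\<lambda>(x, y). \<eta> x (\<theta> y)) ` C)"])
      (auto simp: \<eta>u f_def)
qed

text \<open>The general form, with homomorphisms to \<open>R/a\<close> in place of the modules \<open>R/a\<close> themselves, covers
  cyclic modules and direct sums of them.  Lift \<open>\<theta>\<close> to the free module on \<open>M\<close>, restrict it to the kernel of the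
  augmentation, where its values lie in \<open>(a)\<close>, and compose with the differential; the pairing with \<open>\<theta>'\<close>
  vanishes on boundaries and takes the value \<open>a\<close> modulo \<open>(a\<^sup>2)\<close> on the cycle given by \<open>a m = 0\<close> and \<open>n\<close>.\<close>

theorem Tor1_annihilator_square:
  fixes R :: "('a, 'r) ring_scheme" (structure) and M :: "('a, 'm) module" and N :: "('a, 'n) module"
  defines "G \<equiv> reg_mod R"
  assumes M: "module R M" and N: "module R N" and a: "a \<in> carrier R" and s: "s \<in> carrier R"
    and \<theta>: "\<theta> \<in> mod_hom R M (cyclic_mod R (PIdl a))"
    and m: "m \<in> carrier M" "\<theta> m = PIdl a +>\<^bsub>G\<^esub> \<one>" "a \<odot>\<^bsub>M\<^esub> m = \<zero>\<^bsub>M\<^esub>"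
    and \<theta>': "\<theta>' \<in> mod_hom R N (cyclic_mod R (PIdl a))"
    and n: "n \<in> carrier N" "\<theta>' n = PIdl a +>\<^bsub>G\<^esub> \<one>" "a \<odot>\<^bsub>N\<^esub> n = \<zero>\<^bsub>N\<^esub>"
    and ann: "annihilates s (Tor1 R M N)"
  shows "s \<otimes> a \<in> PIdl (a \<otimes> a)"
proof -
  interpret M: module R M by (rule M)
  interpret N: module R N by (rule N)
  note R = M.R.is_cring
  have G: "module R G" unfolding G_def by (rule reg_mod_module[OF R])
  interpret G: module R G by (rule G)
  note res = res_modules[OF M N]
  interpret F0: module R "res_F0 R M" by (rule res)
  interpret F1: module R "res_F1 R M" by (rule res)
  let ?I = "PIdl a" and ?J = "PIdl (a \<otimes> a)"
  have I: "submodule ?I R G" and J: "submodule ?J R G"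
    unfolding G_def using M.R.cgenideal_ideal a ideal_submodule[OF R] by auto
  have Gs [simp]: "carrier G = carrier R" "smult G = mult R" "add G = add R" "zero G = zero R"
    by (simp_all add: G_def)
  have Q: "module R (quot_mod G ?J)" and QI: "module R (quot_mod G ?I)"
    using quot_mod_module[OF G J] quot_mod_module[OF G I] .
  interpret Q: module R "quot_mod G ?J" by (rule Q)
  have \<theta>G: "\<theta> \<in> mod_hom R M (quot_mod G ?I)" using \<theta> by (simp add: G_def)
  \<comment> \<open>A lift of \<open>\<theta>\<close> to the free module on \<open>M\<close>; on the kernel of the augmentation its values lie in
    the ideal generated by \<open>a\<close>.\<close>
  define l where "l x = (SOME r. r \<in> carrier R \<and> \<theta> x = ?I +>\<^bsub>G\<^esub> r)" for x
  have l: "l x \<in> carrier R" "\<theta> x = ?I +>\<^bsub>G\<^esub> l x" if "x \<in> carrier M" for x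
  proof -
    have "\<exists>r. r \<in> carrier R \<and> \<theta> x = ?I +>\<^bsub>G\<^esub> r"
      using mod_homD(1)[OF \<theta>G that] by (auto simp: quot_mod_carrier)
    then show "l x \<in> carrier R" "\<theta> x = ?I +>\<^bsub>G\<^esub> l x"
      unfolding l_def by (metis (mono_tags, lifting) someI_ex)+
  qed
  define L where "L = free_lift R G l"
  have L: "L \<in> mod_hom R (res_F0 R M) G"
    unfolding L_def res_F0_def by (rule free_lift_hom[OF R G]) (use l in auto)
  have Lb: "L (free_basis R x) = l x" if "x \<in> carrier M" for x
    unfolding L_def by (rule free_lift_basis[OF R G that]) (use l that in auto)
  have L\<theta>: "?I +>\<^bsub>G\<^esub> L h = \<theta> (free_lift R M (\<lambda>x. x) h)" if h: "h \<in> carrier (res_F0 R M)" for h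
    by (rule free_hom_ext[OF R QI mod_hom_comp[OF L coset_hom[OF G I], unfolded res_F0_def]
          mod_hom_comp[OF res_aug_hom[OF M M] \<theta>G, unfolded res_F0_def] _ h[unfolded res_F0_def]])
      (simp add: Lb l res_aug_basis[OF M M])
  have LK: "L k \<in> ?I" if k: "k \<in> res_K0 R M" for k
  proof -
    have kF: "k \<in> carrier (res_F0 R M)" and k0: "free_lift R M (\<lambda>x. x) k = \<zero>\<^bsub>M\<^esub>"
      using k by (auto simp: res_K0_def mem_a_kernel)
    have "?I +>\<^bsub>G\<^esub> L k = \<zero>\<^bsub>quot_mod G ?I\<^esub>"
      unfolding L\<theta>[OF kF] k0 by (rule mod_hom_zero[OF M QI \<theta>G])
    then show ?thesis using coset_eq_zero_iff[OF G I mod_homD(1)[OF L kF]] by blast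
  qed
  let ?d1 = "res_d1 R M" and ?d2 = "res_d2 R M"
  note d1 = res_d1_hom[OF M N] and d2 = res_d2_hom[OF M N]
  let ?T = "tensor R (res_F1 R M) N" and ?S = "tensor R (res_F2 R M) N" and ?U = "tensor R (res_F0 R M) N"
  let ?t1 = "tensor_map R (res_F1 R M) (res_F0 R M) N ?d1" and ?t2 = "tensor_map R (res_F2 R M) (res_F1 R M) N ?d2"
  have Ld: "(\<lambda>h. L (?d1 h)) \<in> mod_hom R (res_F1 R M) (reg_mod R)"
    using mod_hom_comp[OF d1 L] by (simp add: G_def)
  obtain \<Psi> where \<Psi>: "\<Psi> \<in> mod_hom R ?T (quot_mod G ?J)"
    and \<Psi>p: "\<And>h y u. h \<in> carrier (res_F1 R M) \<Longrightarrow> y \<in> carrier N \<Longrightarrow> u \<in> carrier R \<Longrightarrow>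
       \<theta>' y = ?I +>\<^bsub>G\<^esub> u \<Longrightarrow> \<Psi> (pure_tensor R (res_F1 R M) N h y) = ?J +>\<^bsub>G\<^esub> (L (?d1 h) \<otimes> u)"
    using square_pairing[OF res(2) N a Ld LK[OF res_d1_K0[OF M N]] \<theta>'] unfolding G_def by blast
  have \<Psi>0: "\<Psi> (?t2 w) = \<zero>\<^bsub>quot_mod G ?J\<^esub>" if w: "w \<in> carrier ?S" for w
  proof (rule tensor_hom_ext[OF res(3) N Q mod_hom_comp[OF tensor_map_hom[OF res(3,2) N d2] \<Psi>] zero_hom[OF Q] _ w])
    fix h y assume h: "h \<in> carrier (res_F2 R M)" and y: "y \<in> carrier N"
    obtain u where u: "u \<in> carrier R" "\<theta>' y = ?I +>\<^bsub>G\<^esub> u"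
      using mod_homD(1)[OF \<theta>' y] by (auto simp: quot_mod_carrier G_def)
    have "\<Psi> (?t2 (pure_tensor R (res_F2 R M) N h y)) = ?J +>\<^bsub>G\<^esub> (L (?d1 (?d2 h)) \<otimes> u)"
      using h y u mod_homD(1)[OF d2 h] by (simp add: tensor_map_pure[OF res(3,2) N d2] \<Psi>p)
    also have "L (?d1 (?d2 h)) = \<zero>"
      unfolding res_d1_d2[OF M N h] using mod_hom_zero[OF res(1) G L] by simp
    finally show "\<Psi> (?t2 (pure_tensor R (res_F2 R M) N h y)) = \<zero>\<^bsub>quot_mod G ?J\<^esub>"
      using u(1) coset_zero[OF G J] by (simp add: quot_mod_zero)
  qed
  \<comment> \<open>The relation \<open>a \<odot> m = 0\<close>, tensored with \<open>n\<close>, is the cycle to be tested.\<close>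
  define k where "k = a \<odot>\<^bsub>res_F0 R M\<^esub> free_basis R m"
  have em: "free_basis R m \<in> carrier (res_F0 R M)" by (rule res_basis_closed[OF M M m(1)])
  have k: "k \<in> res_K0 R M"
    unfolding res_K0_def mem_a_kernel k_def
    using a em m by (simp add: mod_homD(3)[OF res_aug_hom[OF M M]] res_aug_basis[OF M M])
  have ek: "free_basis R k \<in> carrier (res_F1 R M)" unfolding res_F1_def by (rule free_basis_closed[OF R k])
  define z where "z = pure_tensor R (res_F1 R M) N (free_basis R k) n"
  have z: "z \<in> carrier ?T" unfolding z_def by (rule pure_tensor_closed[OF res(2) N ek n(1)])
  have "?t1 z = pure_tensor R (res_F0 R M) N k n"
    unfolding z_def tensor_map_pure[OF res(2,1) N d1 ek n(1)] res_d1_basis[OF M N k] ..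
  also have "\<dots> = pure_tensor R (res_F0 R M) N (free_basis R m) (a \<odot>\<^bsub>N\<^esub> n)"
    unfolding k_def using pure_tensor_eqs(3,4)[OF res(1) N a em n(1)] by simp
  also have "\<dots> = \<zero>\<^bsub>?U\<^esub>" unfolding n(3) by (rule pure_tensor_zero(2)[OF res(1) N em])
  finally have "s \<odot>\<^bsub>?T\<^esub> z \<in> ?t2 ` carrier ?S"
    using ann z unfolding annihilates_Tor1_iff[OF M N s] by blast
  then have "\<Psi> (s \<odot>\<^bsub>?T\<^esub> z) = \<zero>\<^bsub>quot_mod G ?J\<^esub>" using \<Psi>0 by auto
  moreover have "\<Psi> z = ?J +>\<^bsub>G\<^esub> (a \<otimes> l m)"
    unfolding z_def using \<Psi>p[OF ek n(1) M.R.one_closed n(2)] l[OF m(1)] a em m(1)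
    by (simp add: res_d1_basis[OF M N k]) (simp add: k_def mod_homD[OF L] Lb)
  ultimately have "?J +>\<^bsub>G\<^esub> (s \<otimes> (a \<otimes> l m)) = \<zero>\<^bsub>quot_mod G ?J\<^esub>"
    using coset_smult[OF G J s, of "a \<otimes> l m"] a l[OF m(1)] mod_homD(3)[OF \<Psi> s z] by simp
  then have 1: "s \<otimes> (a \<otimes> l m) \<in> ?J"
    using coset_eq_zero_iff[OF G J, of "s \<otimes> (a \<otimes> l m)"] a s l[OF m(1)] by simp
  have "l m \<ominus>\<^bsub>G\<^esub> \<one> \<in> ?I"
    using l[OF m(1)] m(2) G.coset_eq_iff[OF I, of "l m" \<one>] by simp
  then have "l m \<ominus> \<one> \<in> ?I" using reg_mod_minus[OF R, of "l m" \<one>] l[OF m(1)] by (simp add: G_def)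
  then have "a \<otimes> (l m \<ominus> \<one>) \<in> ?J"
    by (rule M.R.cgenideal_mult_square[OF a M.R.cgenideal_self[OF a]])
  then have 2: "s \<otimes> (a \<otimes> (l m \<ominus> \<one>)) \<in> ?J"
    using submodule.smult_closed[OF J s] by simp
  have "s \<otimes> (a \<otimes> l m) \<ominus>\<^bsub>G\<^esub> s \<otimes> (a \<otimes> (l m \<ominus> \<one>)) \<in> ?J"
    by (rule G.submodule_minus[OF J 1 2])
  moreover have "s \<otimes> (a \<otimes> l m) \<ominus> s \<otimes> (a \<otimes> (l m \<ominus> \<one>)) = s \<otimes> a"
  proof -
    have "s \<otimes> (a \<otimes> l m) = s \<otimes> (a \<otimes> (l m \<ominus> \<one>)) \<oplus> s \<otimes> a"
    proof -
      have "l m = (l m \<ominus> \<one>) \<oplus> \<one>" using l[OF m(1)] by (simp add: a_minus_def M.R.a_assoc M.R.l_neg)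
      then have "s \<otimes> (a \<otimes> l m) = s \<otimes> (a \<otimes> ((l m \<ominus> \<one>) \<oplus> \<one>))" by simp
      also have "\<dots> = s \<otimes> (a \<otimes> (l m \<ominus> \<one>)) \<oplus> s \<otimes> a"
        using s a M.R.minus_closed[OF l(1)[OF m(1)] M.R.one_closed] by (simp add: M.R.r_distr)
      finally show ?thesis .
    qed
    then show ?thesis
      using s a M.R.minus_closed[OF l(1)[OF m(1)] M.R.one_closed]
      by (simp add: a_minus_def M.R.a_ac) (simp add: M.R.a_assoc[symmetric] M.R.r_neg M.R.l_neg)
  qed
  ultimately show ?thesis
    using reg_mod_minus[OF R, of "s \<otimes> (a \<otimes> l m)" "s \<otimes> (a \<otimes> (l m \<ominus> \<one>))"] s a l[OF m(1)]
    by (simp add: G_def)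
qed

section \<open>Transport of structure\<close>

text \<open>Quotient modules have sets as elements and hence live in ever larger types; transport along an
  injection brings them back into a prescribed type.\<close>

definition transport_mod :: "('m \<Rightarrow> 'n) \<Rightarrow> ('a, 'm) module \<Rightarrow> ('a, 'n) module" where
  "transport_mod \<iota> M = (let j = inv_into (carrier M) \<iota> in
    \<lparr>carrier = \<iota> ` carrier M, mult = undefined, one = undefined,
     zero = \<iota> \<zero>\<^bsub>M\<^esub>, add = (\<lambda>x y. \<iota> (j x \<oplus>\<^bsub>M\<^esub> j y)), smult = (\<lambda>r x. \<iota> (r \<odot>\<^bsub>M\<^esub> j x))\<rparr>)"

lemma transport_mod:
  fixes M :: "('a, 'm) module" and \<iota> :: "'m \<Rightarrow> 'n"
  assumes M: "module R M" and inj: "inj_on \<iota> (carrier M)"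
  shows "module R (transport_mod \<iota> M)"
    and "\<iota> \<in> mod_hom R M (transport_mod \<iota> M)"
    and "inv_into (carrier M) \<iota> \<in> mod_hom R (transport_mod \<iota> M) M"
    and "carrier (transport_mod \<iota> M) = \<iota> ` carrier M"
proof -
  interpret M: module R M by (rule M)
  note [simp] = inv_into_f_f[OF inj]
  have ops: "carrier (transport_mod \<iota> M) = \<iota> ` carrier M" "\<zero>\<^bsub>transport_mod \<iota> M\<^esub> = \<iota> \<zero>\<^bsub>M\<^esub>"
    "x \<in> carrier M \<Longrightarrow> y \<in> carrier M \<Longrightarrow> \<iota> x \<oplus>\<^bsub>transport_mod \<iota> M\<^esub> \<iota> y = \<iota> (x \<oplus>\<^bsub>M\<^esub> y)"
    "x \<in> carrier M \<Longrightarrow> r \<odot>\<^bsub>transport_mod \<iota> M\<^esub> \<iota> x = \<iota> (r \<odot>\<^bsub>M\<^esub> x)" for x y r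
    by (simp_all add: transport_mod_def Let_def)
  show "carrier (transport_mod \<iota> M) = \<iota> ` carrier M" by (rule ops(1))
  show "module R (transport_mod \<iota> M)"
  proof (rule moduleI[OF M.R.is_cring])
    show "abelian_group (transport_mod \<iota> M)"
    proof (rule abelian_groupI)
      fix x assume "x \<in> carrier (transport_mod \<iota> M)"
      then obtain y where y: "y \<in> carrier M" "x = \<iota> y" by (auto simp: ops)
      then show "\<exists>z\<in>carrier (transport_mod \<iota> M). z \<oplus>\<^bsub>transport_mod \<iota> M\<^esub> x = \<zero>\<^bsub>transport_mod \<iota> M\<^esub>"
        by (intro bexI[of _ "\<iota> (\<ominus>\<^bsub>M\<^esub> y)"]) (auto simp: ops M.l_neg)
    qed (auto simp: ops M.a_ac)
  qed (auto simp: ops M.smult_l_distr M.smult_r_distr M.smult_assoc1)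
  show "\<iota> \<in> mod_hom R M (transport_mod \<iota> M)" by (rule mod_homI) (auto simp: ops)
  show "inv_into (carrier M) \<iota> \<in> mod_hom R (transport_mod \<iota> M) M" by (rule mod_homI) (auto simp: ops)
qed

section \<open>A test sequence\<close>

text \<open>The last clause says that, for every \<open>a\<close>, the sequence contains \<open>0 \<rightarrow> (a) \<rightarrow> R \<rightarrow> R/a \<rightarrow> 0\<close> well enough to detect
  divisibility by \<open>a\<^sup>2\<close>: the elements \<open>x\<close>, \<open>b\<close> and \<open>y\<close> play the roles of \<open>a\<close> in \<open>(a)\<close>, of \<open>1\<close> in \<open>R\<close> and of
  the class of \<open>1\<close> in \<open>R/a\<close>.\<close>

definition square_test_sequence :: "('a, 'r) ring_scheme \<Rightarrow> ('a, 'm) module \<Rightarrow> ('a, 'm) module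
    \<Rightarrow> ('a, 'm) module \<Rightarrow> ('m \<Rightarrow> 'm) \<Rightarrow> ('m \<Rightarrow> 'm) \<Rightarrow> bool" where
  "square_test_sequence R A B C f g \<longleftrightarrow>
    module R A \<and> module R B \<and> module R C \<and> f \<in> mod_hom R A B \<and> g \<in> mod_hom R B C \<and>
    (\<forall>x\<in>carrier A. f x = \<zero>\<^bsub>B\<^esub> \<longrightarrow> x = \<zero>\<^bsub>A\<^esub>) \<and> a_kernel B C g = f ` carrier A \<and> g ` carrier B = carrier C \<and>
    (\<forall>a\<in>carrier R. \<exists>l\<in>mod_hom R A (reg_mod R). \<exists>\<theta>\<in>mod_hom R C (cyclic_mod R (PIdl\<^bsub>R\<^esub> a)).
       \<exists>x\<in>carrier A. \<exists>b\<in>carrier B. \<exists>y\<in>carrier C. (\<forall>x\<in>carrier A. l x \<in> PIdl\<^bsub>R\<^esub> a) \<and>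
         l x = a \<and> f x = a \<odot>\<^bsub>B\<^esub> b \<and> \<theta> y = PIdl\<^bsub>R\<^esub> a +>\<^bsub>reg_mod R\<^esub> \<one>\<^bsub>R\<^esub> \<and> a \<odot>\<^bsub>C\<^esub> y = \<zero>\<^bsub>C\<^esub>)"

text \<open>The direct sum of the sequences \<open>0 \<rightarrow> (a) \<rightarrow> R \<rightarrow> R/a \<rightarrow> 0\<close> over all \<open>a\<close>.  The middle term is the free module on
  the elements of \<open>R\<close>, transported by \<open>\<iota>\<close>; the quotient is realised on representatives of its classes,
  so that it lives in the same type.\<close>

lemma square_test_sequence_exists:
  fixes R :: "('a, 'r) ring_scheme" (structure) and \<iota> :: "('a \<Rightarrow> 'a) \<Rightarrow> 'w"
  assumes R: "cring R" and \<iota>: "inj \<iota>"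
  shows "\<exists>(A :: ('a, 'w) module) (B :: ('a, 'w) module) (C :: ('a, 'w) module) f g.
    square_test_sequence R A B C f g"
proof -
  interpret R: cring R by (rule R)
  let ?D = "free_mod R (carrier R)"
  note D = free_mod_module[OF R, of "carrier R"]
  interpret D: module R ?D by (rule D)
  have G: "module R (reg_mod R)" by (rule reg_mod_module[OF R])
  interpret G: module R "reg_mod R" by (rule G)
  have inj: "inj_on \<iota> (carrier ?D)" using \<iota> by (rule inj_on_subset) simp
  define B where "B = transport_mod \<iota> ?D"
  note tr = transport_mod[OF D inj, folded B_def]
  interpret B: module R B by (rule tr(1))
  define ev where "ev a b = inv_into (carrier ?D) \<iota> b a" for a b
  have ev: "ev a \<in> mod_hom R B (reg_mod R)" for a
    unfolding ev_def by (rule mod_hom_comp[OF tr(3) coeff_hom[OF R]])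
  have I: "submodule (PIdl a) R (reg_mod R)" if "a \<in> carrier R" for a
    by (rule ideal_submodule[OF R R.cgenideal_ideal[OF that]])
  define K where "K = {b \<in> carrier B. \<forall>a\<in>carrier R. ev a b \<in> PIdl a}"
  have K: "submodule K R B"
    unfolding B.submodule_iff K_def
    using mod_homD[OF ev] mod_hom_zero[OF tr(1) G ev] I[unfolded G.submodule_iff] by auto
  define A where "A = sub_mod B K"
  have A: "module R A" unfolding A_def by (rule sub_mod_module[OF tr(1) K])
  define Q where "Q = quot_mod B K"
  have Q: "module R Q" unfolding Q_def by (rule quot_mod_module[OF tr(1) K])
  interpret Q: module R Q by (rule Q)
  \<comment> \<open>Distinct classes have distinct representatives, so \<open>\<kappa>\<close> is injective on the quotient.\<close>
  define \<kappa> where "\<kappa> C = (SOME b. b \<in> C)" for C :: "'w set"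
  have \<kappa>: "K +>\<^bsub>B\<^esub> \<kappa> C = C" if CQ: "C \<in> carrier Q" for C
  proof -
    obtain b where b: "b \<in> carrier B" "C = K +>\<^bsub>B\<^esub> b" using CQ by (auto simp: Q_def quot_mod_carrier)
    have "\<kappa> C \<in> K +>\<^bsub>B\<^esub> b" unfolding \<kappa>_def b(2) by (rule someI[of _ b], rule B.coset_self[OF K b(1)])
    then show ?thesis using B.coset_memD(3)[OF K b(1)] b(2) by simp
  qed
  have inj\<kappa>: "inj_on \<kappa> (carrier Q)" by (rule inj_onI) (metis \<kappa>)
  define C where "C = transport_mod \<kappa> Q"
  note trC = transport_mod[OF Q inj\<kappa>, folded C_def]
  interpret C: module R C by (rule trC(1))
  define cl where "cl b = K +>\<^bsub>B\<^esub> b" for b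
  have cl: "cl \<in> mod_hom R B Q" unfolding cl_def Q_def by (rule coset_hom[OF tr(1) K])
  define g where "g b = \<kappa> (cl b)" for b
  have g: "g \<in> mod_hom R B C" unfolding g_def by (rule mod_hom_comp[OF cl trC(2)])
  have inc: "(\<lambda>x. x) \<in> mod_hom R A B"
    by (rule mod_homI) (auto simp: A_def K_def)
  have clQ: "carrier Q = cl ` carrier B" by (auto simp: Q_def quot_mod_carrier cl_def)
  have g0: "g b = \<zero>\<^bsub>C\<^esub> \<longleftrightarrow> b \<in> K" if b: "b \<in> carrier B" for b
  proof -
    have "g b = \<zero>\<^bsub>C\<^esub> \<longleftrightarrow> cl b = \<zero>\<^bsub>Q\<^esub>"
      using inj_on_eq_iff[OF inj\<kappa> mod_homD(1)[OF cl b] Q.zero_closed] mod_hom_zero[OF Q trC(1,2)]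
      unfolding g_def by metis
    then show ?thesis using coset_eq_zero_iff[OF tr(1) K b] by (simp add: Q_def cl_def)
  qed
  have ker: "a_kernel B C g = (\<lambda>x. x) ` carrier A"
    using g0 by (auto simp: mem_a_kernel A_def K_def)
  have surj: "g ` carrier B = carrier C"
    unfolding trC(4) clQ g_def by auto
  have data: "\<exists>l\<in>mod_hom R A (reg_mod R). \<exists>\<theta>\<in>mod_hom R C (cyclic_mod R (PIdl a)).
       \<exists>x\<in>carrier A. \<exists>b\<in>carrier B. \<exists>y\<in>carrier C. (\<forall>x\<in>carrier A. l x \<in> PIdl a) \<and>
         l x = a \<and> x = a \<odot>\<^bsub>B\<^esub> b \<and> \<theta> y = PIdl a +>\<^bsub>reg_mod R\<^esub> \<one> \<and> a \<odot>\<^bsub>C\<^esub> y = \<zero>\<^bsub>C\<^esub>"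
    if a: "a \<in> carrier R" for a
  proof -
    let ?Q = "cyclic_mod R (PIdl a)"
    have Qa: "module R ?Q" by (rule quot_mod_module[OF G I[OF a]])
    let ?f = "\<lambda>b. PIdl a +>\<^bsub>reg_mod R\<^esub> ev a b"
    have f: "?f \<in> mod_hom R B ?Q" by (rule mod_hom_comp[OF ev coset_hom[OF G I[OF a]]])
    have f0: "?f b = \<zero>\<^bsub>?Q\<^esub>" if b: "b \<in> K" for b
      using coset_eq_zero_iff[OF G I[OF a], of "ev a b"] b a mod_homD(1)[OF ev, of b a] by (auto simp: K_def)
    note ql = quot_lift[OF tr(1) K Qa f f0, folded Q_def]
    let ?\<theta> = "\<lambda>c. the_elem (?f ` inv_into (carrier Q) \<kappa> c)"
    have \<theta>: "?\<theta> \<in> mod_hom R C ?Q" by (rule mod_hom_comp[OF trC(3) ql(1)]) auto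
    let ?b = "\<iota> (free_basis R a)"
    have e: "free_basis R a \<in> carrier ?D" by (rule free_basis_closed[OF R a])
    have b: "?b \<in> carrier B" by (rule mod_homD(1)[OF tr(2) e])
    have evb: "ev c ?b = (if c = a then \<one> else \<zero>)" for c
      unfolding ev_def inv_into_f_f[OF inj e] by (simp add: free_basis_def)
    have evab: "ev c (a \<odot>\<^bsub>B\<^esub> ?b) = (if c = a then a else \<zero>)" for c
      using mod_homD(3)[OF ev a b] a by (simp add: evb)
    have abK: "a \<odot>\<^bsub>B\<^esub> ?b \<in> K"
      unfolding K_def using a b R.cgenideal_self I[unfolded G.submodule_iff] by (auto simp: evab)
    have ag: "a \<odot>\<^bsub>C\<^esub> g ?b = \<zero>\<^bsub>C\<^esub>"
      using g0[of "a \<odot>\<^bsub>B\<^esub> ?b"] abK a b mod_homD(3)[OF g a b] by simp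
    have "?\<theta> (g ?b) = the_elem (?f ` (K +>\<^bsub>B\<^esub> ?b))"
      unfolding g_def using inv_into_f_f[OF inj\<kappa> mod_homD(1)[OF cl b]] by (simp add: cl_def)
    also have "\<dots> = ?f ?b" by (rule ql(2)[OF _ b]) auto
    finally have \<theta>b: "?\<theta> (g ?b) = PIdl a +>\<^bsub>reg_mod R\<^esub> \<one>" by (simp add: evb)
    have "ev a \<in> mod_hom R A (reg_mod R)" using mod_hom_comp[OF inc ev] by simp
    then show ?thesis
      using \<theta> abK b ag \<theta>b mod_homD(1)[OF g b] a
      by (intro bexI[of _ "ev a"] bexI[of _ ?\<theta>] bexI[of _ "a \<odot>\<^bsub>B\<^esub> ?b"] bexI[of _ ?b] bexI[of _ "g ?b"])
        (auto simp: evab A_def K_def)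
  qed
  have "\<forall>x\<in>carrier A. x = \<zero>\<^bsub>B\<^esub> \<longrightarrow> x = \<zero>\<^bsub>A\<^esub>" by (simp add: A_def)
  then have "square_test_sequence R A B C (\<lambda>x. x) g"
    unfolding square_test_sequence_def using A tr(1) trC(1) inc g ker surj ballI[OF data] by (intro conjI)
  then show ?thesis by blast
qed

section \<open>Generation by idempotents\<close>

lemma principal_ideal_fg:
  fixes R :: "('a, 'r) ring_scheme" (structure)
  assumes R: "cring R" and a: "a \<in> carrier R"
  shows "fg_mod R (ideal_mod R (PIdl a))"
proof -
  interpret cring R by (rule R)
  note I = ideal_submodule[OF R cgenideal_ideal[OF a]]
  have G: "module R (reg_mod R)" by (rule reg_mod_module[OF R])
  interpret M: module R "ideal_mod R (PIdl a)" by (rule sub_mod_module[OF G I])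
  have "carrier (ideal_mod R (PIdl a)) \<subseteq> mod_span R (ideal_mod R (PIdl a)) {a}"
  proof
    fix x assume "x \<in> carrier (ideal_mod R (PIdl a))"
    then obtain r where r: "r \<in> carrier R" "x = r \<otimes> a" by (auto simp: mem_cgenideal)
    have "submodule (mod_span R (ideal_mod R (PIdl a)) {a}) R (ideal_mod R (PIdl a))"
      by (rule mod_span_submodule[OF M.module_axioms]) (use cgenideal_self[OF a] in auto)
    moreover have "a \<in> mod_span R (ideal_mod R (PIdl a)) {a}" using mod_span_incl by fastforce
    ultimately show "x \<in> mod_span R (ideal_mod R (PIdl a)) {a}"
      using submodule.smult_closed r by fastforce
  qed
  moreover have "mod_span R (ideal_mod R (PIdl a)) {a} \<subseteq> carrier (ideal_mod R (PIdl a))"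
    by (rule mod_span_least[OF M.carrier_is_submodule]) (use cgenideal_self[OF a] in auto)
  ultimately show ?thesis
    unfolding fg_mod_def using cgenideal_self[OF a] by (intro exI[of _ "{a}"]) auto
qed

text \<open>As generators of \<open>I\<close> take all idempotents in it.  An idempotent \<open>g \<in> I\<close> that absorbs finitely many generators of \<open>I\<close>
  absorbs all of \<open>I\<close>, so \<open>v x = v x g\<close> for \<open>x \<in> I\<close>.\<close>

lemma uS_generated_by_idempotents_if_absorbing:
  fixes R :: "('a, 'r) ring_scheme" (structure)
  assumes R: "cring R" and v: "v \<in> S" "v \<in> carrier R" and abs: "idempotent_absorbing R v TYPE('a)"
    and fam: "\<And>I. I \<in> \<I> \<Longrightarrow> ideal I R \<and> fg_mod R (ideal_mod R I)"
  shows "uS_generated_by_idempotents R S \<I>"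
proof -
  interpret cring R by (rule R)
  have G: "module R (reg_mod R)" by (rule reg_mod_module[OF R])
  interpret G: module R "reg_mod R" by (rule G)
  define E where "E I = {e \<in> I. e \<otimes> e = e}" for I
  have "v \<otimes> x \<in> mod_span R (ideal_mod R I) (E I)" if I: "I \<in> \<I>" and x: "x \<in> I" for I x
  proof -
    have id: "ideal I R" and fg: "fg_mod R (ideal_mod R I)" using fam[OF I] by auto
    have sub: "submodule I R (reg_mod R)" by (rule ideal_submodule[OF R id])
    note sub' = sub[unfolded G.submodule_iff]
    interpret M: module R "ideal_mod R I" by (rule sub_mod_module[OF G sub])
    obtain Y where Y: "finite Y" "Y \<subseteq> I" "mod_span R (ideal_mod R I) Y = I"
      using fg unfolding fg_mod_def by auto
    have YR: "y \<in> carrier R" if "y \<in> Y" for y using sub' Y(2) that by auto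
    then obtain c where c: "c \<in> Y \<rightarrow> carrier R"
      and cY: "lin_comb (reg_mod R) Y c (\<lambda>y. y) \<otimes> lin_comb (reg_mod R) Y c (\<lambda>y. y) = lin_comb (reg_mod R) Y c (\<lambda>y. y)"
        "\<And>y. y \<in> Y \<Longrightarrow> v \<otimes> (lin_comb (reg_mod R) Y c (\<lambda>y. y) \<otimes> y) = v \<otimes> y"
      using abs[unfolded idempotent_absorbing_def Let_def, rule_format, of Y "\<lambda>y. y"] Y(1) by auto
    define g where "g = lin_comb (reg_mod R) Y c (\<lambda>y. y)"
    have gI: "g \<in> I"
    proof -
      have "(\<Oplus>\<^bsub>reg_mod R\<^esub>y\<in>Z. c y \<otimes> y) \<in> I" if "finite Z" "Z \<subseteq> Y" for Z
        using that
      proof (induction Z)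
        case (insert z Z)
        have cl: "c y \<otimes> y \<in> I" if "y \<in> Y" for y using sub' c Y(2) that by (auto simp: Pi_iff subset_iff)
        have "(\<Oplus>\<^bsub>reg_mod R\<^esub>y\<in>insert z Z. c y \<otimes> y) = c z \<otimes> z \<oplus> (\<Oplus>\<^bsub>reg_mod R\<^esub>y\<in>Z. c y \<otimes> y)"
          using insert.hyps insert.prems c YR by (subst G.finsum_insert) (auto simp: Pi_iff subset_iff)
        then show ?case using insert cl sub' by auto
      qed (use sub' in simp)
      then show ?thesis unfolding g_def lin_comb_def using Y(1) by simp
    qed
    have gR: "g \<in> carrier R" using gI sub' by auto
    define H where "H = {x \<in> I. v \<otimes> (g \<otimes> x) = v \<otimes> x}"
    have "submodule H R (ideal_mod R I)"
      unfolding M.submodule_iff H_def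
    proof (intro conjI ballI)
      fix x y assume "x \<in> {x \<in> I. v \<otimes> (g \<otimes> x) = v \<otimes> x}" "y \<in> {x \<in> I. v \<otimes> (g \<otimes> x) = v \<otimes> x}"
      then show "x \<oplus>\<^bsub>ideal_mod R I\<^esub> y \<in> {x \<in> I. v \<otimes> (g \<otimes> x) = v \<otimes> x}"
        using sub' v gR by (auto simp: r_distr subset_iff)
    next
      fix r x assume r: "r \<in> carrier R" and x: "x \<in> {x \<in> I. v \<otimes> (g \<otimes> x) = v \<otimes> x}"
      then have xR: "x \<in> carrier R" using sub' by auto
      have "v \<otimes> (g \<otimes> (r \<otimes> x)) = r \<otimes> (v \<otimes> (g \<otimes> x))" using r xR v gR by (simp add: m_ac)
      also have "\<dots> = v \<otimes> (r \<otimes> x)" using r x xR v by (simp add: m_ac)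
      finally show "r \<odot>\<^bsub>ideal_mod R I\<^esub> x \<in> {x \<in> I. v \<otimes> (g \<otimes> x) = v \<otimes> x}"
        using sub' r x by auto
    qed (use sub' v gR in auto)
    then have "I \<subseteq> H"
      using mod_span_least[of H R "ideal_mod R I" Y] Y cY(2) by (auto simp: H_def g_def)
    then have "v \<otimes> (g \<otimes> x) = v \<otimes> x" using x by (auto simp: H_def)
    moreover have xR: "x \<in> carrier R" using x sub' by auto
    ultimately have vx: "v \<otimes> x = (v \<otimes> x) \<otimes> g" using v gR by (simp add: m_ac)
    have "submodule (mod_span R (ideal_mod R I) (E I)) R (ideal_mod R I)"
      by (rule mod_span_submodule[OF M.module_axioms]) (auto simp: E_def)
    moreover have "g \<in> mod_span R (ideal_mod R I) (E I)"
      using mod_span_incl[of "E I" R "ideal_mod R I"] gI cY(1) by (auto simp: E_def g_def)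
    ultimately have "(v \<otimes> x) \<otimes> g \<in> mod_span R (ideal_mod R I) (E I)"
      using submodule.smult_closed[of _ R "ideal_mod R I" "v \<otimes> x" g] v xR by simp
    then show ?thesis using vx by simp
  qed
  then show ?thesis
    unfolding uS_generated_by_idempotents_def uS_generated_def
    using v(1) by (intro exI[of _ E]) (auto simp: E_def)
qed

text \<open>An idempotent in \<open>(a)\<close> equals its own square and therefore lies in \<open>(a\<^sup>2)\<close>.\<close>

lemma square_divides_if_generated_by_idempotents:
  fixes R :: "('a, 'r) ring_scheme" (structure)
  assumes R: "cring R" and S: "S \<subseteq> carrier R" and gen: "uS_generated_by_idempotents R S \<I>"
    and fam: "\<And>a. a \<in> carrier R \<Longrightarrow> PIdl a \<in> \<I>"
  shows "\<exists>s\<in>S. \<forall>a\<in>carrier R. s \<otimes> a \<in> PIdl (a \<otimes> a)"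
proof -
  interpret cring R by (rule R)
  have G: "module R (reg_mod R)" by (rule reg_mod_module[OF R])
  obtain E where E: "\<And>I. I \<in> \<I> \<Longrightarrow> E I \<subseteq> {e \<in> I. e \<otimes> e = e}" and "uS_generated R S \<I> (ideal_mod R) E"
    using gen unfolding uS_generated_by_idempotents_def by blast
  then obtain s where s: "s \<in> S"
    and span: "\<And>I x. I \<in> \<I> \<Longrightarrow> x \<in> I \<Longrightarrow> s \<otimes> x \<in> mod_span R (ideal_mod R I) (E I)"
    unfolding uS_generated_def by auto
  have "s \<otimes> a \<in> PIdl (a \<otimes> a)" if a: "a \<in> carrier R" for a
  proof -
    have I: "submodule (PIdl a) R (reg_mod R)" by (rule ideal_submodule[OF R cgenideal_ideal[OF a]])
    have J: "submodule (PIdl (a \<otimes> a)) R (reg_mod R)"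
      by (rule ideal_submodule[OF R cgenideal_ideal]) (use a in auto)
    have JI: "PIdl (a \<otimes> a) \<subseteq> PIdl a"
    proof
      fix x assume "x \<in> PIdl (a \<otimes> a)"
      then obtain r where "r \<in> carrier R" "x = r \<otimes> (a \<otimes> a)" by (auto simp: mem_cgenideal)
      then have "x = (r \<otimes> a) \<otimes> a" "r \<otimes> a \<in> carrier R" using a by (simp_all add: m_ac)
      then show "x \<in> PIdl a" unfolding mem_cgenideal by blast
    qed
    have "E (PIdl a) \<subseteq> PIdl (a \<otimes> a)"
      using E[OF fam[OF a]] cgenideal_mult_square[OF a] by force
    then have "mod_span R (ideal_mod R (PIdl a)) (E (PIdl a)) \<subseteq> PIdl (a \<otimes> a)"
      by (rule mod_span_least[OF submodule_of_sub_mod[OF G I J JI]])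
    then show ?thesis using span[OF fam[OF a] cgenideal_self[OF a]] by blast
  qed
  then show ?thesis using s by blast
qed

section \<open>The equivalences\<close>

lemma uS_von_Neumann_regular_iff:
  fixes R :: "('a, 'r) ring_scheme" (structure)
  assumes R: "cring R" and S: "S \<subseteq> carrier R"
  shows "uS_von_Neumann_regular R S \<longleftrightarrow> (\<exists>s\<in>S. \<forall>a\<in>carrier R. s \<otimes> a \<in> PIdl (a \<otimes> a))"
proof -
  interpret cring R by (rule R)
  show ?thesis
    unfolding uS_von_Neumann_regular_def mem_cgenideal
    by (intro bex_cong ball_cong refl) (simp add: numeral_2_eq_2)
qed

lemma idempotent_absorbing_if_uS_von_Neumann_regular:
  fixes R :: "('a, 'r) ring_scheme" (structure)
  assumes R: "cring R" and S: "submonoid S R" and vnr: "uS_von_Neumann_regular R S"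
  shows "\<exists>v\<in>S. idempotent_absorbing R v TYPE('x)"
proof -
  interpret cring R by (rule R)
  have SR: "S \<subseteq> carrier R" by (rule submonoid.subset[OF S])
  obtain s where s: "s \<in> S" "\<And>a. a \<in> carrier R \<Longrightarrow> \<exists>r\<in>carrier R. s \<otimes> a = r \<otimes> (a \<otimes> a)"
    using vnr unfolding uS_von_Neumann_regular_iff[OF R SR] mem_cgenideal by blast
  have "s \<otimes> s \<otimes> s \<in> S" using s(1) submonoid.m_closed[OF S] by blast
  then show ?thesis using idempotent_absorbing_if_vnr[of s] s SR by blast
qed

lemma coset_one_annihilated:
  fixes R :: "('a, 'r) ring_scheme" (structure)
  assumes R: "cring R" and a: "a \<in> carrier R"
  shows "PIdl a +>\<^bsub>reg_mod R\<^esub> \<one> \<in> carrier (cyclic_mod R (PIdl a))"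
    and "a \<odot>\<^bsub>cyclic_mod R (PIdl a)\<^esub> (PIdl a +>\<^bsub>reg_mod R\<^esub> \<one>) = \<zero>\<^bsub>cyclic_mod R (PIdl a)\<^esub>"
proof -
  interpret cring R by (rule R)
  have G: "module R (reg_mod R)" by (rule reg_mod_module[OF R])
  have I: "submodule (PIdl a) R (reg_mod R)" by (rule ideal_submodule[OF R cgenideal_ideal[OF a]])
  show "PIdl a +>\<^bsub>reg_mod R\<^esub> \<one> \<in> carrier (cyclic_mod R (PIdl a))" by (simp add: quot_mod_carrier)
  show "a \<odot>\<^bsub>cyclic_mod R (PIdl a)\<^esub> (PIdl a +>\<^bsub>reg_mod R\<^esub> \<one>) = \<zero>\<^bsub>cyclic_mod R (PIdl a)\<^esub>"
    using coset_smult[OF G I a, of \<one>] coset_eq_zero_iff[OF G I, of a] a cgenideal_self[OF a] by simp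
qed

text \<open>Tensor the test sequence with its own last term \<open>C\<close>.  The element \<open>x \<otimes> y\<close> of \<open>A \<otimes> C\<close> goes to \<open>a b \<otimes> y = b \<otimes> a y = 0\<close>,
  so the witness \<open>s\<close> of exactness at \<open>A \<otimes> C\<close> kills it; the pairing with values in \<open>R/(a\<^sup>2)\<close> turns this into
  \<open>s a \<in> (a\<^sup>2)\<close>.  The witness does not depend on \<open>a\<close>, because the sequence does not.\<close>

lemma flat_module_square:
  fixes R :: "('a, 'r) ring_scheme" (structure) and \<iota> :: "('a \<Rightarrow> 'a) \<Rightarrow> 'w"
  assumes R: "cring R" and S: "submonoid S R" and \<iota>: "inj \<iota>"
    and flat: "\<And>M :: ('a, 'w) module. module R M \<Longrightarrow> uS_flat R S M"
  shows "\<exists>s\<in>S. \<forall>a\<in>carrier R. s \<otimes> a \<in> PIdl (a \<otimes> a)"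
proof -
  interpret cring R by (rule R)
  note SR = submonoid.mem_carrier[OF S]
  have G: "module R (reg_mod R)" by (rule reg_mod_module[OF R])
  obtain A B C :: "('a, 'w) module" and f g where T: "square_test_sequence R A B C f g"
    using square_test_sequence_exists[OF R \<iota>] by blast
  note T = T[unfolded square_test_sequence_def]
  have A: "module R A" and B: "module R B" and C: "module R C"
    and f: "f \<in> mod_hom R A B" and g: "g \<in> mod_hom R B C"
    and inj: "\<forall>x\<in>carrier A. f x = \<zero>\<^bsub>B\<^esub> \<longrightarrow> x = \<zero>\<^bsub>A\<^esub>"
    and ker: "a_kernel B C g = f ` carrier A" and surj: "g ` carrier B = carrier C"
    using T by - (elim conjE, assumption)+
  have data: "\<exists>l\<in>mod_hom R A (reg_mod R). \<exists>\<theta>\<in>mod_hom R C (cyclic_mod R (PIdl a)).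
       \<exists>x\<in>carrier A. \<exists>b\<in>carrier B. \<exists>y\<in>carrier C. (\<forall>x\<in>carrier A. l x \<in> PIdl a) \<and>
         l x = a \<and> f x = a \<odot>\<^bsub>B\<^esub> b \<and> \<theta> y = PIdl a +>\<^bsub>reg_mod R\<^esub> \<one> \<and> a \<odot>\<^bsub>C\<^esub> y = \<zero>\<^bsub>C\<^esub>"
    if "a \<in> carrier R" for a
    using T that by (elim conjE) (drule (1) bspec)
  interpret A: module R A by (rule A)
  interpret B: module R B by (rule B)
  interpret C: module R C by (rule C)
  let ?A = "tensor R A C" and ?B = "tensor R B C"
  interpret TA: module R ?A by (rule tensor_module[OF A C])
  interpret TB: module R ?B by (rule tensor_module[OF B C])
  have one: "\<one> \<in> S" by (rule submonoid.one_closed[OF S])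
  have "uS_short_exact S A B C f g"
    unfolding uS_short_exact_def
  proof (intro conjI)
    show "uS_exact S zero_mod A B (\<lambda>_. \<zero>\<^bsub>A\<^esub>) f"
      unfolding uS_exact_def using one inj mod_hom_zero[OF A B f]
      by (intro bexI[of _ \<one>]) (auto simp: mem_a_kernel zero_mod_def)
    have "y \<in> carrier B" if "y \<in> f ` carrier A" for y using that mod_homD(1)[OF f] by auto
    then show "uS_exact S A B C f g"
      unfolding uS_exact_def ker using one by (intro bexI[of _ \<one>]) (simp_all add: B.smult_one)
    show "uS_exact S B C zero_mod g (\<lambda>_. ())"
      unfolding uS_exact_def surj using one
      by (intro bexI[of _ \<one>]) (auto simp: mem_a_kernel zero_mod_def)
  qed
  then have "uS_short_exact S ?A ?B (tensor R C C) (tensor_map R A B C f) (tensor_map R B C C g)"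
    using flat[OF C] A B C f g unfolding uS_flat_def by blast
  then obtain s where s: "s \<in> S"
    and kill: "\<And>z. z \<in> carrier ?A \<Longrightarrow> tensor_map R A B C f z = \<zero>\<^bsub>?B\<^esub> \<Longrightarrow> s \<odot>\<^bsub>?A\<^esub> z = \<zero>\<^bsub>?A\<^esub>"
    unfolding uS_short_exact_def uS_exact_def by (auto simp: mem_a_kernel zero_mod_def)
  have sR: "s \<in> carrier R" by (rule SR[OF s])
  have "s \<otimes> a \<in> PIdl (a \<otimes> a)" if a: "a \<in> carrier R" for a
  proof -
    let ?J = "PIdl (a \<otimes> a)"
    obtain l \<theta> x b y where l: "l \<in> mod_hom R A (reg_mod R)" "\<And>x. x \<in> carrier A \<Longrightarrow> l x \<in> PIdl a"
      and \<theta>: "\<theta> \<in> mod_hom R C (cyclic_mod R (PIdl a))"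
      and x: "x \<in> carrier A" "l x = a" "f x = a \<odot>\<^bsub>B\<^esub> b" and b: "b \<in> carrier B"
      and y: "y \<in> carrier C" "\<theta> y = PIdl a +>\<^bsub>reg_mod R\<^esub> \<one>" "a \<odot>\<^bsub>C\<^esub> y = \<zero>\<^bsub>C\<^esub>"
      using data[OF a] by blast
    have J: "submodule ?J R (reg_mod R)"
      by (rule ideal_submodule[OF R cgenideal_ideal]) (use a in auto)
    obtain \<Psi> where \<Psi>: "\<Psi> \<in> mod_hom R ?A (cyclic_mod R ?J)"
      and \<Psi>p: "\<Psi> (pure_tensor R A C x y) = ?J +>\<^bsub>reg_mod R\<^esub> a"
      using square_pairing[OF A C a l \<theta>] x y a one_closed by (metis r_one)
    have z: "pure_tensor R A C x y \<in> carrier ?A" by (rule pure_tensor_closed[OF A C x(1) y(1)])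
    have "tensor_map R A B C f (pure_tensor R A C x y) = pure_tensor R B C b (a \<odot>\<^bsub>C\<^esub> y)"
      using tensor_map_pure[OF A B C f x(1) y(1)] pure_tensor_eqs(3,4)[OF B C a b y(1)] x(3) by simp
    also have "\<dots> = \<zero>\<^bsub>?B\<^esub>"
      unfolding y(3) by (rule pure_tensor_zero(2)[OF B C b])
    finally have "s \<odot>\<^bsub>?A\<^esub> pure_tensor R A C x y = \<zero>\<^bsub>?A\<^esub>" by (rule kill[OF z])
    then have "s \<odot>\<^bsub>cyclic_mod R ?J\<^esub> (?J +>\<^bsub>reg_mod R\<^esub> a) = \<zero>\<^bsub>cyclic_mod R ?J\<^esub>"
      using mod_homD(3)[OF \<Psi> sR z] mod_hom_zero[OF TA.module_axioms quot_mod_module[OF G J] \<Psi>] \<Psi>p by simp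
    then show ?thesis
      using coset_smult[OF G J sR, of a] coset_eq_zero_iff[OF G J, of "s \<otimes> a"] a sR by simp
  qed
  then show ?thesis using s by blast
qed

text \<open>The last term \<open>C\<close> of the test sequence maps to every \<open>R/a\<close>, so a single annihilator of
  \<open>Tor\<^sub>1(C, C)\<close> works for all \<open>a\<close>.\<close>

lemma Tor1_all_modules_square:
  fixes R :: "('a, 'r) ring_scheme" (structure) and \<iota> :: "('a \<Rightarrow> 'a) \<Rightarrow> 'w"
  assumes R: "cring R" and S: "submonoid S R" and \<iota>: "inj \<iota>"
    and tor: "\<And>(M :: ('a, 'w) module) (N :: ('a, 'w) module). module R M \<Longrightarrow> module R N \<Longrightarrow> \<exists>s\<in>S. annihilates s (Tor1 R M N)"
  shows "\<exists>s\<in>S. \<forall>a\<in>carrier R. s \<otimes> a \<in> PIdl (a \<otimes> a)"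
proof -
  obtain A B C :: "('a, 'w) module" and f g where T: "square_test_sequence R A B C f g"
    using square_test_sequence_exists[OF R \<iota>] by blast
  note T = T[unfolded square_test_sequence_def]
  have C: "module R C" using T by (elim conjE)
  have data: "\<exists>\<theta>\<in>mod_hom R C (cyclic_mod R (PIdl a)). \<exists>y\<in>carrier C.
         \<theta> y = PIdl a +>\<^bsub>reg_mod R\<^esub> \<one> \<and> a \<odot>\<^bsub>C\<^esub> y = \<zero>\<^bsub>C\<^esub>" if a: "a \<in> carrier R" for a
    using T a by (elim conjE) (drule (1) bspec, blast)
  obtain s where s: "s \<in> S" "annihilates s (Tor1 R C C)" using tor[OF C C] by blast
  have "s \<otimes> a \<in> PIdl (a \<otimes> a)" if a: "a \<in> carrier R" for a
    using data[OF a] Tor1_annihilator_square[OF C C a submonoid.mem_carrier[OF S s(1)] _ _ _ _ _ _ _ _ s(2)]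
    by (elim bexE conjE)
  then show ?thesis using s(1) by blast
qed

theorem theorem3p13:
  fixes R :: "('a, 'r) ring_scheme" (structure) and S :: "'a set"
  assumes "cring R" and "submonoid S R"
  shows
    "(uS_von_Neumann_regular R S \<longleftrightarrow>
       (\<forall>(M :: ('a, ('a, 'u) univ) module) (N :: ('a, ('a, 'u) univ) module).
          module R M \<longrightarrow> module R N \<longrightarrow> (\<exists>s\<in>S. annihilates s (Tor1 R M N)))) \<and>
     (uS_von_Neumann_regular R S \<longleftrightarrow>
       (\<exists>s\<in>S. \<forall>I J. ideal I R \<longrightarrow> ideal J R \<longrightarrow>
          annihilates s (Tor1 R (cyclic_mod R I) (cyclic_mod R J)))) \<and>
     (uS_von_Neumann_regular R S \<longleftrightarrow>
       (\<exists>s\<in>S. \<forall>I J. ideal I R \<longrightarrow> ideal J R \<longrightarrow>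
          S_finite R S (ideal_mod R I) \<longrightarrow> S_finite R S (ideal_mod R J) \<longrightarrow>
          annihilates s (Tor1 R (cyclic_mod R I) (cyclic_mod R J)))) \<and>
     (uS_von_Neumann_regular R S \<longleftrightarrow>
       (\<exists>s\<in>S. \<forall>a\<in>carrier R.
          annihilates s (Tor1 R (cyclic_mod R (Idl {a})) (cyclic_mod R (Idl {a}))))) \<and>
     (uS_von_Neumann_regular R S \<longleftrightarrow>
       (\<forall>M :: ('a, ('a, 'u) univ) module. module R M \<longrightarrow> uS_flat R S M)) \<and>
     (uS_von_Neumann_regular R S \<longleftrightarrow>
       uS_generated_by_idempotents R S {I. principalideal I R}) \<and>
     (uS_von_Neumann_regular R S \<longleftrightarrow>
       uS_generated_by_idempotents R S {I. ideal I R \<and> fg_mod R (ideal_mod R I)})"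
proof -
  interpret cring R by (rule assms(1))
  note R = assms(1) and S = assms(2)
  have SR: "S \<subseteq> carrier R" by (rule submonoid.subset[OF S])
  have G: "module R (reg_mod R)" by (rule reg_mod_module[OF R])
  let ?vnr = "uS_von_Neumann_regular R S"
  note vnr_iff = uS_von_Neumann_regular_iff[OF R SR]
  have cyc: "module R (cyclic_mod R I)" if "ideal I R" for I
    by (rule quot_mod_module[OF G ideal_submodule[OF R that]])
  have idl: "Idl {a} = PIdl a" if "a \<in> carrier R" for a using cgenideal_eq_genideal[OF that] by simp
  \<comment> \<open>The injection of the functions on \<open>'a\<close> into the universe: a function is stored through its values at
    heads of lists, each as a singleton.\<close>
  define \<iota> :: "('a \<Rightarrow> 'a) \<Rightarrow> ('a, 'u) univ" where "\<iota> h = Inl (\<lambda>xs. {h (hd xs)})" for h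
  have \<iota>: "inj \<iota>"
  proof (rule injI)
    fix h k :: "'a \<Rightarrow> 'a" assume "\<iota> h = \<iota> k"
    then have "{h (hd [x])} = {k (hd [x])}" for x unfolding \<iota>_def by (metis sum.inject(1))
    then show "h = k" by (auto simp: fun_eq_iff)
  qed

  have 2: "\<exists>s\<in>S. annihilates s (Tor1 R M N)"
    if ?vnr "module R M" "module R N" for M N :: "('a, ('a, 'u) univ) module"
    using idempotent_absorbing_if_uS_von_Neumann_regular[OF R S that(1)] Tor1_annihilated[OF that(2,3)] SR by blast
  have 3: "\<exists>s\<in>S. \<forall>I J. ideal I R \<longrightarrow> ideal J R \<longrightarrow> annihilates s (Tor1 R (cyclic_mod R I) (cyclic_mod R J))" if ?vnr
    using idempotent_absorbing_if_uS_von_Neumann_regular[OF R S that] Tor1_annihilated[OF cyc cyc] SR by blast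
  have 5: "?vnr" if tor: "\<exists>s\<in>S. \<forall>a\<in>carrier R. annihilates s (Tor1 R (cyclic_mod R (Idl {a})) (cyclic_mod R (Idl {a})))"
  proof -
    obtain s where s: "s \<in> S"
      and ann: "\<And>a. a \<in> carrier R \<Longrightarrow> annihilates s (Tor1 R (cyclic_mod R (PIdl a)) (cyclic_mod R (PIdl a)))"
      using tor idl by auto
    have "s \<otimes> a \<in> PIdl (a \<otimes> a)" if a: "a \<in> carrier R" for a
    proof -
      have h: "(\<lambda>x. x) \<in> mod_hom R (cyclic_mod R (PIdl a)) (cyclic_mod R (PIdl a))" by (rule mod_homI) auto
      note one = coset_one_annihilated[OF R a]
      note Q = cyc[OF cgenideal_ideal[OF a]]
      show ?thesis
        using Tor1_annihilator_square[OF Q Q a _ h one(1) refl one(2) h one(1) refl one(2) ann[OF a]] s SR by blast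
    qed
    then show ?vnr unfolding vnr_iff using s by blast
  qed
  have Sfin: "S_finite R S (ideal_mod R (Idl {a}))" if a: "a \<in> carrier R" for a
  proof -
    have I: "submodule (PIdl a) R (reg_mod R)" by (rule ideal_submodule[OF R cgenideal_ideal[OF a]])
    interpret M: module R "ideal_mod R (PIdl a)" by (rule sub_mod_module[OF G I])
    have "submodule (PIdl a) R (ideal_mod R (PIdl a))" using M.carrier_is_submodule by simp
    then show ?thesis
      unfolding S_finite_def idl[OF a]
      using principal_ideal_fg[OF R a] submonoid.one_closed[OF S] M.smult_one
      by (intro bexI[of _ \<one>] exI[of _ "PIdl a"]) auto
  qed
  have pid: "ideal (Idl {a}) R" if "a \<in> carrier R" for a using cgenideal_ideal[OF that] idl[OF that] by simp
  have E2: "?vnr \<longleftrightarrow> (\<forall>(M :: ('a, ('a, 'u) univ) module) (N :: ('a, ('a, 'u) univ) module).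
          module R M \<longrightarrow> module R N \<longrightarrow> (\<exists>s\<in>S. annihilates s (Tor1 R M N)))"
    using 2 Tor1_all_modules_square[OF R S \<iota>] vnr_iff by blast
  have E3: "?vnr \<longleftrightarrow> (\<exists>s\<in>S. \<forall>I J. ideal I R \<longrightarrow> ideal J R \<longrightarrow>
          annihilates s (Tor1 R (cyclic_mod R I) (cyclic_mod R J)))"
    using 3 5 pid by blast
  have E4: "?vnr \<longleftrightarrow> (\<exists>s\<in>S. \<forall>I J. ideal I R \<longrightarrow> ideal J R \<longrightarrow>
          S_finite R S (ideal_mod R I) \<longrightarrow> S_finite R S (ideal_mod R J) \<longrightarrow>
          annihilates s (Tor1 R (cyclic_mod R I) (cyclic_mod R J)))"
    using 3 5 pid Sfin by blast
  have E5: "?vnr \<longleftrightarrow> (\<exists>s\<in>S. \<forall>a\<in>carrier R.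
          annihilates s (Tor1 R (cyclic_mod R (Idl {a})) (cyclic_mod R (Idl {a}))))"
    using 3 5 pid by blast
  have E6: "?vnr \<longleftrightarrow> (\<forall>M :: ('a, ('a, 'u) univ) module. module R M \<longrightarrow> uS_flat R S M)"
    using idempotent_absorbing_if_uS_von_Neumann_regular[OF R S] uS_flat_if_idempotent_absorbing[OF S] flat_module_square[OF R S \<iota>] vnr_iff by blast
  have fg: "fg_mod R (ideal_mod R I)" if I: "principalideal I R" for I
  proof -
    obtain a where "a \<in> carrier R" "I = Idl {a}" using principalideal.generate[OF I] by blast
    then show ?thesis using principal_ideal_fg[OF R] idl by simp
  qed
  have gen: "uS_generated_by_idempotents R S \<I>"
    if ?vnr "\<And>I. I \<in> \<I> \<Longrightarrow> ideal I R \<and> fg_mod R (ideal_mod R I)" for \<I>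
    using idempotent_absorbing_if_uS_von_Neumann_regular[OF R S that(1)] uS_generated_by_idempotents_if_absorbing[OF R _ _ _ that(2)] SR by blast
  have E7: "?vnr \<longleftrightarrow> uS_generated_by_idempotents R S {I. principalideal I R}"
    using gen[of "{I. principalideal I R}"] fg principalideal.axioms(1)
      square_divides_if_generated_by_idempotents[OF R SR, of "{I. principalideal I R}"]
      cgenideal_is_principalideal vnr_iff by blast
  have E8: "?vnr \<longleftrightarrow> uS_generated_by_idempotents R S {I. ideal I R \<and> fg_mod R (ideal_mod R I)}"
    using gen[of "{I. ideal I R \<and> fg_mod R (ideal_mod R I)}"]
      square_divides_if_generated_by_idempotents[OF R SR, of "{I. ideal I R \<and> fg_mod R (ideal_mod R I)}"]
      cgenideal_ideal principal_ideal_fg[OF R] vnr_iff by blast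
  show ?thesis using E2 E3 E4 E5 E6 E7 E8 by (intro conjI)
qed

end
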